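(* Let $\Omega=(a,b)\times(c,d)\subset\mathbb{R}^2$, $1<\alpha\le 2$, $T>0$, $M\ge 1$ an integer, $\tau=T/M$, let $\mu_u,\mu_v>0$, $F,\kappa>0$, and $u_0,v_0\in H^{\alpha/2}_0(\Omega)$. Let $U^n,V^n\in H^{\alpha/2}_0(\Omega)$, $0\le n\le M$, with $U^0=u_0$, $V^0=v_0$, satisfy the Crank–Nicolson time semi-discrete scheme \[ \frac{U^{n+1}-U^n}{\tau}=-\mu_u(-\Delta)^{\alpha/2}U^{n+\frac12}-U^{n+\frac12}(\tilde V^{n})^2+F(1-U^{n+\frac12}), \] \[ \frac{V^{n+1}-V^n}{\tau}=-\mu_v(-\Delta)^{\alpha/2}V^{n+\frac12}+U^{n+\frac12}(\tilde V^{n})^2-(F+\kappa)V^{n+\frac12}, \] for $0\le n\le M-1$, where $U^{n+\frac12}=\frac{U^n+U^{n+1}}{2}$, $V^{n+\frac12}=\frac{V^n+V^{n+1}}{2}$, $\tilde V^0=V^0$, and $\tilde V^n=V^{*,n+\frac12}=\frac{3V^n-V^{n-1}}{2}$ for $1\le n\le M-1$. Then the scheme is unconditionally stable (no restriction on $\tau$), and for $0\le n\le M-1$, \[ \|U^{n+1}\|^2\le\|u_0\|^2+FT|\Omega|, \] and, with $W^n=U^n+V^n$, \[ \|W^{n+1}\|^2\le\|u_0+v_0\|^2+\Bigl(\kappa T+\frac{|\mu_v-\mu_u|^2}{2\mu_u\mu_v|\cos(\frac{\pi\alpha}{2})|^2}\Bigr)\|u_0\|^2+\Bigl(1+\kappa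 T+\frac{|\mu_v-\mu_u|^2}{2\mu_u\mu_v|\cos(\frac{\pi\alpha}{2})|^2}\Bigr)FT|\Omega|. \]
   Context: $\|\cdot\|$ denotes the $L^2(\Omega)$ norm and $|\Omega|$ the area of $\Omega$. $H^{\alpha/2}_0(\Omega)$ is the closure of $C_0^\infty(\Omega)$ in $H^{\alpha/2}(\Omega)$. The fractional Laplacian is defined via Riesz derivatives: \[ -(-\Delta)^{\alpha/2}u=-\frac{1}{2\cos(\frac{\pi\alpha}{2})}\bigl({}_aD_x^\alpha u+{}_xD_b^\alpha u\bigr)-\frac{1}{2\cos(\frac{\pi\alpha}{2})}\bigl({}_cD_y^\alpha u+{}_yD_d^\alpha u\bigr), \] where, for $1<\alpha<2$, ${}_aD_x^\alpha u(x,y)=\frac{1}{\Gamma(2-\alpha)}\frac{\partial^2}{\partial x^2}\int_a^x(x-s)^{1-\alpha}u(s,y)\,ds$ and ${}_xD_b^\alpha u(x,y)=\frac{1}{\Gamma(2-\alpha)}\frac{\partial^2}{\partial x^2}\int_x^b(s-x)^{1-\alpha}u(s,y)\,ds$ are the left and right Riemann–Liouville derivatives (analogously in $y$ on $(c,d)$), and for $\alpha=2$ they reduce to $\partial_x^2$ (resp. $\partial_y^2$). This scheme is the time semi-discretization of the fractional Gray–Scott system $\partial_t u=-\mu_u(-\Delta)^{\alpha/2}u-uv^2+F(1-u)$, $\partial_t v=-\mu_v(-\Delta)^{\alpha/2}v+uv^2-(F+\kappa)v$ with homogeneous Dirichlet boundary conditions. *)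

theory Defs
  imports "HOL-Analysis.Analysis"
begin

type_synonym fn2 = "real \<times> real \<Rightarrow> real"

definition Omega :: "real \<Rightarrow> real \<Rightarrow> real \<Rightarrow> real \<Rightarrow> (real \<times> real) set" where
  "Omega a b c d = {a<..<b} \<times> {c<..<d}"

definition px :: "fn2 \<Rightarrow> fn2" where
  "px f = (\<lambda>(x,y). deriv (\<lambda>s. f (s,y)) x)"
definition py :: "fn2 \<Rightarrow> fn2" where
  "py f = (\<lambda>(x,y). deriv (\<lambda>t. f (x,t)) y)"

definition iter_partial :: "bool list \<Rightarrow> fn2 \<Rightarrow> fn2" where
  "iter_partial ds f = foldr (\<lambda>d h. if d then px h else py h) ds f"

definition smooth2 :: "fn2 \<Rightarrow> bool" where
  "smooth2 f \<longleftrightarrow> (\<forall>ds. continuous_on UNIV (iter_partial ds f) \<and>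
      (\<forall>x y. (\<lambda>s. iter_partial ds f (s,y)) differentiable (at x) \<and>
             (\<lambda>t. iter_partial ds f (x,t)) differentiable (at y)))"

definition Cc_inf :: "(real \<times> real) set \<Rightarrow> fn2 set" where
  "Cc_inf S = {f. smooth2 f \<and> compact (closure {p. f p \<noteq> 0}) \<and> closure {p. f p \<noteq> 0} \<subseteq> S}"

definition L2norm :: "(real \<times> real) set \<Rightarrow> fn2 \<Rightarrow> real" where
  "L2norm S u = sqrt (LINT p:S|lborel. (u p)\<^sup>2)"

definition inL2 :: "(real \<times> real) set \<Rightarrow> fn2 \<Rightarrow> bool" where
  "inL2 S u \<longleftrightarrow> u \<in> borel_measurable lborel \<and> set_integrable lborel S (\<lambda>p. (u p)\<^sup>2)"

text \<open>Squared H^{alpha/2} seminorm of a C_0^infinity function (extended by zero to R^2):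
  Gagliardo seminorm for alpha < 2, Dirichlet integral for alpha = 2.\<close>
definition Hs_semi2 :: "real \<Rightarrow> fn2 \<Rightarrow> real" where
  "Hs_semi2 \<alpha> f =
     (if \<alpha> = 2 then (\<integral>p. (px f p)\<^sup>2 + (py f p)\<^sup>2 \<partial>lborel)
      else (\<integral>pq. (f (fst pq) - f (snd pq))\<^sup>2 / (dist (fst pq) (snd pq)) powr (2 + \<alpha>)
              \<partial>(lborel :: ((real \<times> real) \<times> (real \<times> real)) measure)))"

text \<open>H^{alpha/2}_0(Omega): closure of C_0^infinity(Omega) w.r.t. the H^{alpha/2} norm, i.e.
  the L^2(Omega) functions that are L^2-limits of C_0^infinity(Omega) sequences which are
  Cauchy in the H^{alpha/2} norm.\<close>
definition H0 :: "real \<Rightarrow> (real \<times> real) set \<Rightarrow> fn2 \<Rightarrow> bool" where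
  "H0 \<alpha> S u \<longleftrightarrow> inL2 S u \<and>
     (\<exists>\<phi> :: nat \<Rightarrow> fn2. (\<forall>k. \<phi> k \<in> Cc_inf S) \<and>
        (\<lambda>k. L2norm S (\<lambda>p. \<phi> k p - u p)) \<longlonglongrightarrow> 0 \<and>
        (\<forall>e>0. \<exists>N. \<forall>m\<ge>N. \<forall>n\<ge>N. Hs_semi2 \<alpha> (\<lambda>p. \<phi> m p - \<phi> n p) < e))"

definition RL_left_x :: "real \<Rightarrow> real \<Rightarrow> fn2 \<Rightarrow> fn2" where
  "RL_left_x \<alpha> a f = (\<lambda>(x,y). if \<alpha> = 2 then deriv (deriv (\<lambda>s. f (s,y))) x
     else 1 / Gamma (2 - \<alpha>) *
       deriv (deriv (\<lambda>z. integral {a..z} (\<lambda>s. (z - s) powr (1 - \<alpha>) * f (s,y)))) x)"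

definition RL_right_x :: "real \<Rightarrow> real \<Rightarrow> fn2 \<Rightarrow> fn2" where
  "RL_right_x \<alpha> b f = (\<lambda>(x,y). if \<alpha> = 2 then deriv (deriv (\<lambda>s. f (s,y))) x
     else 1 / Gamma (2 - \<alpha>) *
       deriv (deriv (\<lambda>z. integral {z..b} (\<lambda>s. (s - z) powr (1 - \<alpha>) * f (s,y)))) x)"

definition RL_left_y :: "real \<Rightarrow> real \<Rightarrow> fn2 \<Rightarrow> fn2" where
  "RL_left_y \<alpha> c f = (\<lambda>(x,y). if \<alpha> = 2 then deriv (deriv (\<lambda>t. f (x,t))) y
     else 1 / Gamma (2 - \<alpha>) *
       deriv (deriv (\<lambda>z. integral {c..z} (\<lambda>t. (z - t) powr (1 - \<alpha>) * f (x,t)))) y)"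

definition RL_right_y :: "real \<Rightarrow> real \<Rightarrow> fn2 \<Rightarrow> fn2" where
  "RL_right_y \<alpha> d f = (\<lambda>(x,y). if \<alpha> = 2 then deriv (deriv (\<lambda>t. f (x,t))) y
     else 1 / Gamma (2 - \<alpha>) *
       deriv (deriv (\<lambda>z. integral {z..d} (\<lambda>t. (t - z) powr (1 - \<alpha>) * f (x,t)))) y)"

text \<open>The fractional Laplacian (-Delta)^{alpha/2} via Riesz derivatives:
  -(-Delta)^{alpha/2} u = -1/(2 cos(pi alpha/2)) (aDx u + xDb u + cDy u + yDd u).\<close>
definition frac_lap :: "real \<Rightarrow> real \<Rightarrow> real \<Rightarrow> real \<Rightarrow> real \<Rightarrow> fn2 \<Rightarrow> fn2" where
  "frac_lap \<alpha> a b c d f = (\<lambda>p. 1 / (2 * cos (pi * \<alpha> / 2)) *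
      (RL_left_x \<alpha> a f p + RL_right_x \<alpha> b f p + RL_left_y \<alpha> c f p + RL_right_y \<alpha> d f p))"

end

theory Submission
  imports Defs
begin

text \<open>
  Testing the first equation with the midpoint value of \<open>U\<close> and the sum of both equations with the
  midpoint value of \<open>U + V\<close> (where the reaction terms cancel) gives discrete energy identities; Young's
  inequality absorbs the cross term of the diffusion form \<open>B\<close> into the dissipation of \<open>U\<close> that the
  first identity controls, and summation over the time steps gives both bounds.

  As the scheme holds only against smooth test functions, the midpoint values are reached as limits.
  For \<open>\<alpha> < 2\<close>, integration by parts in the shift \<open>h\<close> turns \<open>B(f, f)\<close> into a positive multiple
  of the integral of \<open>h powr (-1 - \<alpha>) * D h\<close>, where \<open>D h\<close> is the squared L2 norm of the difference of
  \<open>f\<close> and its translate by \<open>h\<close> along a coordinate axis. So \<open>B\<close> is symmetric, positive and dominated by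
  the Gagliardo norm. Since \<open>\<alpha> > 1\<close>, a function on the line is bounded by its energy; applied to
  the horizontal and vertical slices this bounds the square of \<open>f (x, y)\<close> both by a function of \<open>y\<close> and by a
  function of \<open>x\<close>, whence an L4 bound, which is what the limit in the cubic term needs.
\<close>

section \<open>Test functions and their partial derivatives\<close>

text \<open>The scheme is weak: the fractional Laplacian always falls on the test function, so for a
  general iterate \<open>u\<close> the expression \<open>form u u\<close> does not represent its
  energy, and testing with a midpoint is not a mere substitution. The dissipation enters as a number
  \<open>E\<close>, the limit of the form along approximating test functions. It exists because the
  scheme itself makes all other terms converge, once \<open>form u (us k)\<close> and
  \<open>form (us k) (us k)\<close> are known to differ by a null sequence. Stability without a
  restriction on the time step comes from signs: the cubic term is nonpositive when tested with
  \<open>U\<close> and cancels in the sum, and completing squares bounds the rest by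
  \<open>F / 4\<close> and a multiple of the square of \<open>U\<close>, which the first estimate
  controls already. No Gronwall inequality is needed. The argument yields constants sharper than the
  claimed ones: half the source terms, and a diffusion quotient with denominator
  \<open>4 * \<mu>u * \<mu>v\<close>. The cosine of the claim enters only in the last comparison,
  through its square being at most 1.\<close>

lemma iter_partial_Cons:
  "iter_partial (True # ds) f = px (iter_partial ds f)"
  "iter_partial (False # ds) f = py (iter_partial ds f)"
  by (simp_all add: iter_partial_def)

lemma iter_partial_Nil [simp]: "iter_partial [] f = f"
  by (simp add: iter_partial_def)

lemma smooth2_DERIV:
  assumes "smooth2 f"
  shows "((\<lambda>s. iter_partial ds f (s, y)) has_real_derivative iter_partial (True # ds) f (x, y)) (at x)"
    and "((\<lambda>t. iter_partial ds f (x, t)) has_real_derivative iter_partial (False # ds) f (x, y)) (at y)"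
  using assms by (auto simp: smooth2_def iter_partial_Cons px_def py_def DERIV_deriv_iff_real_differentiable)

lemma smooth2_cont:
  assumes "smooth2 f"
  shows "continuous_on UNIV (iter_partial ds f)"
  using assms by (auto simp: smooth2_def)

text \<open>\<open>deriv\<close> is additive only on differentiable functions, so each step of the
  induction over the word of partials draws on the smoothness of both functions.\<close>

lemma iter_partial_lincomb:
  assumes "smooth2 f" "smooth2 g"
  shows "iter_partial ds (\<lambda>p. r * f p + s * g p) = (\<lambda>p. r * iter_partial ds f p + s * iter_partial ds g p)"
proof (induction ds)
  case (Cons e ds)
  show ?case
  proof (rule ext)
    fix p :: "real \<times> real"
    obtain x y where xy: "p = (x, y)" by fastforce
    note D = DERIV_add[OF DERIV_cmult[OF smooth2_DERIV(1)[OF assms(1)]] DERIV_cmult[OF smooth2_DERIV(1)[OF assms(2)]]]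
      DERIV_add[OF DERIV_cmult[OF smooth2_DERIV(2)[OF assms(1)]] DERIV_cmult[OF smooth2_DERIV(2)[OF assms(2)]]]
    show "iter_partial (e # ds) (\<lambda>p. r * f p + s * g p) p
      = r * iter_partial (e # ds) f p + s * iter_partial (e # ds) g p"
    proof (cases e)
      case True
      have "iter_partial (e # ds) (\<lambda>p. r * f p + s * g p) p
        = deriv (\<lambda>z. r * iter_partial ds f (z, y) + s * iter_partial ds g (z, y)) x"
        by (simp add: True iter_partial_Cons Cons.IH xy px_def)
      with DERIV_imp_deriv[OF D(1)] show ?thesis by (simp add: True xy)
    next
      case False
      have "iter_partial (e # ds) (\<lambda>p. r * f p + s * g p) p
        = deriv (\<lambda>z. r * iter_partial ds f (x, z) + s * iter_partial ds g (x, z)) y"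
        by (simp add: False iter_partial_Cons Cons.IH xy py_def)
      with DERIV_imp_deriv[OF D(2)] show ?thesis by (simp add: False xy)
    qed
  qed
qed simp

lemma smooth2_lincomb:
  assumes "smooth2 f" "smooth2 g"
  shows "smooth2 (\<lambda>p. r * f p + s * g p)"
proof -
  note D = smooth2_DERIV[unfolded has_field_derivative_def, THEN differentiableI]
  have "(\<lambda>x. r * iter_partial ds f (x, y) + s * iter_partial ds g (x, y)) differentiable (at x)" for ds x y
    by (intro differentiable_add differentiable_mult differentiable_const D(1) assms)
  moreover have "(\<lambda>y. r * iter_partial ds f (x, y) + s * iter_partial ds g (x, y)) differentiable (at y)" for ds x y
    by (intro differentiable_add differentiable_mult differentiable_const D(2) assms)
  moreover have "continuous_on UNIV (\<lambda>p. r * iter_partial ds f p + s * iter_partial ds g p)" for ds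
    by (intro continuous_intros smooth2_cont assms)
  ultimately show ?thesis
    by (simp add: smooth2_def iter_partial_lincomb[OF assms])
qed

lemma Cc_infD:
  assumes "f \<in> Cc_inf S"
  shows "smooth2 f" "compact (closure {p. f p \<noteq> 0})" "closure {p. f p \<noteq> 0} \<subseteq> S"
  using assms unfolding Cc_inf_def by blast+

lemma Cc_inf_lincomb:
  assumes "f \<in> Cc_inf S" "g \<in> Cc_inf S"
  shows "(\<lambda>p. r * f p + s * g p) \<in> Cc_inf S"
proof -
  let ?K = "closure {p. f p \<noteq> 0} \<union> closure {p. g p \<noteq> 0}"
  let ?h = "\<lambda>p. r * f p + s * g p"
  have "closure {p. ?h p \<noteq> 0} \<subseteq> closure ({p. f p \<noteq> 0} \<union> {p. g p \<noteq> 0})"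
    by (intro closure_mono) auto
  then have sub: "closure {p. ?h p \<noteq> 0} \<subseteq> ?K"
    by (simp add: closure_Un)
  have K: "compact ?K" by (intro compact_Un Cc_infD(2)[OF assms(1)] Cc_infD(2)[OF assms(2)])
  have "compact (?K \<inter> closure {p. ?h p \<noteq> 0})"
    by (rule compact_Int_closed[OF K closed_closure])
  also have "?K \<inter> closure {p. ?h p \<noteq> 0} = closure {p. ?h p \<noteq> 0}"
    using sub by (rule Int_absorb1)
  finally have "compact (closure {p. ?h p \<noteq> 0})" .
  moreover have "?K \<subseteq> S" "smooth2 ?h"
    using Cc_infD[OF assms(1)] Cc_infD[OF assms(2)] smooth2_lincomb by blast+
  ultimately show ?thesis using sub unfolding Cc_inf_def by blast
qed

lemma Cc_inf_partial_eq_0: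
  assumes "f \<in> Cc_inf S" "p \<notin> S"
  shows "iter_partial ds f p = 0"
proof -
  let ?O = "- closure {p. f p \<noteq> 0}"
  have sm: "smooth2 f" by (rule Cc_infD(1)[OF assms(1)])
  have op: "open ?O" by auto
  \<comment> \<open>Locality of derivatives needs a neighbourhood, so the induction runs on the open
    set off the closed support; the complement of \<open>S\<close> need not be open.\<close>
  have "\<forall>q\<in>?O. iter_partial ds f q = 0"
  proof (induction ds)
    case Nil
    then show ?case using closure_subset[of "{p. f p \<noteq> 0}"] by auto
  next
    case (Cons e ds)
    show ?case
    proof
      fix q assume q: "q \<in> ?O"
      obtain x y where xy: "q = (x, y)" by fastforce
      have ox: "open ((\<lambda>s. (s, y)) -` ?O)" by (intro open_vimage op continuous_intros)
      have oy: "open ((\<lambda>t. (x, t)) -` ?O)" by (intro open_vimage op continuous_intros)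
      have "((\<lambda>s. iter_partial ds f (s, y)) has_real_derivative 0) (at x)"
        by (rule has_field_derivative_transform_within_open[OF DERIV_const ox]) (use q xy Cons in auto)
      moreover have "((\<lambda>t. iter_partial ds f (x, t)) has_real_derivative 0) (at y)"
        by (rule has_field_derivative_transform_within_open[OF DERIV_const oy]) (use q xy Cons in auto)
      ultimately show "iter_partial (e # ds) f q = 0"
        using DERIV_unique[OF smooth2_DERIV(1)[OF sm]] DERIV_unique[OF smooth2_DERIV(2)[OF sm]]
        by (cases e) (auto simp: xy)
    qed
  qed
  then show ?thesis using Cc_infD(3)[OF assms(1)] assms(2) by blast
qed

text \<open>Abstracts the sequence of pure x-derivatives of a test function from
  \<open>iter_partial\<close>, so that one set of lemmas serves \<open>dx\<close> and, after
  exchanging the coordinates, \<open>dy\<close>.\<close>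

definition x_chain :: "real \<Rightarrow> real \<Rightarrow> real \<Rightarrow> real \<Rightarrow> (nat \<Rightarrow> fn2) \<Rightarrow> bool" where
  "x_chain a b c d f \<longleftrightarrow> (\<forall>n. continuous_on UNIV (f n)
     \<and> (\<forall>x y. ((\<lambda>s. f n (s, y)) has_real_derivative f (Suc n) (x, y)) (at x))
     \<and> (\<forall>p. p \<notin> Omega a b c d \<longrightarrow> f n p = 0))"

definition dx :: "nat \<Rightarrow> fn2 \<Rightarrow> fn2" where
  "dx n f = iter_partial (replicate n True) f"

text \<open>
  Statements about the y-direction are obtained by applying those about the x-direction to
  \<open>f \<circ> prod.swap\<close>; accordingly \<open>dy n f\<close> takes its arguments in the order \<open>(y, x)\<close>.
\<close>

definition dy :: "nat \<Rightarrow> fn2 \<Rightarrow> fn2" where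
  "dy n f = iter_partial (replicate n False) f \<circ> prod.swap"

lemma dx_0 [simp]: "dx 0 f = f" and dy_0: "dy 0 f = f \<circ> prod.swap"
  by (simp_all add: dx_def dy_def)

lemma x_chain_dx:
  assumes "f \<in> Cc_inf (Omega a b c d)"
  shows "x_chain a b c d (\<lambda>n. dx n f)"
proof -
  have sm: "smooth2 f" by (rule Cc_infD(1)[OF assms])
  show ?thesis
    unfolding x_chain_def dx_def replicate_Suc
    by (intro conjI allI impI smooth2_cont[OF sm] smooth2_DERIV(1)[OF sm] Cc_inf_partial_eq_0[OF assms])
qed

lemma Omega_swap: "p \<notin> Omega c d a b \<Longrightarrow> prod.swap p \<notin> Omega a b c d"
  by (cases p) (auto simp: Omega_def)

lemma x_chain_dy:
  assumes "f \<in> Cc_inf (Omega a b c d)"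
  shows "x_chain c d a b (\<lambda>n. dy n f)"
proof -
  have sm: "smooth2 f" by (rule Cc_infD(1)[OF assms])
  have "continuous_on UNIV (iter_partial ds f \<circ> prod.swap)" for ds
    by (intro continuous_on_compose continuous_on_subset[OF smooth2_cont[OF sm]] continuous_on_swap) auto
  then show ?thesis
    unfolding x_chain_def dy_def replicate_Suc o_apply swap_simp
    by (intro conjI allI impI smooth2_DERIV(2)[OF sm] Cc_inf_partial_eq_0[OF assms] Omega_swap)
qed

section \<open>Riemann--Liouville derivatives of test functions\<close>

lemma x_chainD:
  assumes "x_chain a b c d f"
  shows "continuous_on UNIV (f n)"
    and "((\<lambda>s. f n (s, y)) has_real_derivative f (Suc n) (x, y)) (at x)"
    and "p \<notin> Omega a b c d \<Longrightarrow> f n p = 0"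
  using assms unfolding x_chain_def by blast+

lemma x_chain_measurable:
  assumes "x_chain a b c d f"
  shows "f n \<in> borel_measurable borel"
  using x_chainD(1)[OF assms] by (rule borel_measurable_continuous_onI)

lemma Omega_subset_cbox: "Omega a b c d \<subseteq> cbox (a, c) (b, d)"
  by (auto simp: Omega_def cbox_Pair_eq)

lemma Omega_measurable [measurable, simp]: "Omega a b c d \<in> sets borel"
  unfolding Omega_def by (intro borel_open open_Times) auto

lemma emeasure_Omega_finite: "emeasure lborel (Omega a b c d) < \<infinity>"
  by (rule le_less_trans[OF emeasure_mono[OF Omega_subset_cbox] emeasure_lborel_cbox_finite]) simp

lemma x_chain_bounded:
  assumes "x_chain a b c d f"
  obtains C where "C \<ge> 0" "\<And>p. \<bar>f n p\<bar> \<le> C"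
proof -
  have "compact (f n ` cbox (a, c) (b, d))"
    by (intro compact_continuous_image continuous_on_subset[OF x_chainD(1)[OF assms]] compact_cbox) simp
  then obtain C where C: "\<And>p. p \<in> cbox (a, c) (b, d) \<Longrightarrow> \<bar>f n p\<bar> \<le> C"
    using compact_imp_bounded bounded_iff by (metis imageI real_norm_def)
  have "\<bar>f n p\<bar> \<le> max C 0" for p
    using C[of p] x_chainD(3)[OF assms, of p n] Omega_subset_cbox[of a b c d]
    by (cases "p \<in> Omega a b c d") (auto simp: le_max_iff_disj)
  then show ?thesis using that[of "max C 0"] by simp
qed

lemma integrable_supported:
  fixes F :: fn2
  assumes "F \<in> borel_measurable borel" "\<And>p. \<bar>F p\<bar> \<le> C" "\<And>p. p \<notin> Omega a b c d \<Longrightarrow> F p = 0"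
  shows "integrable lborel F"
proof -
  have C: "C \<ge> 0" using assms(2)[of "(0, 0)"] by linarith
  have "integrable lborel (\<lambda>p. C * indicator (Omega a b c d) p)"
    using emeasure_Omega_finite by (intro integrable_mult_right integrable_real_indicator) auto
  then show ?thesis
  proof (rule Bochner_Integration.integrable_bound)
    show "F \<in> borel_measurable lborel" using assms(1) by simp
    show "AE p in lborel. norm (F p) \<le> norm (C * indicator (Omega a b c d) p)"
      using assms(2,3) C by (intro AE_I2) (auto simp: indicator_def)
  qed
qed

lemma x_chain_integrable:
  assumes "x_chain a b c d f"
  shows "integrable lborel (f n)"
proof -
  obtain C where "\<And>p. \<bar>f n p\<bar> \<le> C" using x_chain_bounded[OF assms] by metis
  then show ?thesis
    by (rule integrable_supported[OF x_chain_measurable[OF assms] _ x_chainD(3)[OF assms]])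
qed

lemma integrable_mult_bounded:
  fixes k F :: "'a \<Rightarrow> real"
  assumes "integrable M k" "F \<in> borel_measurable M" "\<And>p. \<bar>F p\<bar> \<le> C"
  shows "integrable M (\<lambda>p. k p * F p)"
proof -
  have "C \<ge> 0" using assms(3)[of undefined] by linarith
  then have le: "\<bar>F p\<bar> \<le> \<bar>C\<bar>" for p using assms(3)[of p] by simp
  have "integrable M (\<lambda>p. C * k p)" using assms(1) by simp
  then show ?thesis
    by (rule Bochner_Integration.integrable_bound)
      (use assms(1,2) le in \<open>auto simp: abs_mult mult.commute[of "\<bar>C\<bar>"] intro!: AE_I2 mult_left_mono\<close>)
qed

section \<open>Translation invariance and differentiation under the integral sign\<close>

lemma lborel_integral_shift:
  fixes F :: "'a::euclidean_space \<Rightarrow> real"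
  assumes [measurable]: "F \<in> borel_measurable borel"
  shows "(\<integral>p. F (p + w) \<partial>lborel) = (\<integral>p. F p \<partial>lborel)"
proof -
  have "(\<integral>p. F p \<partial>lborel) = (\<integral>p. F p \<partial>distr lborel borel ((+) w))"
    by (simp add: lborel_distr_plus)
  also have "\<dots> = (\<integral>p. F (w + p) \<partial>lborel)" by (rule integral_distr) auto
  finally show ?thesis by (simp add: add.commute)
qed

lemma nn_integral_lborel_shift:
  fixes F :: "'a::euclidean_space \<Rightarrow> ennreal"
  assumes [measurable]: "F \<in> borel_measurable borel"
  shows "(\<integral>\<^sup>+p. F (p + w) \<partial>lborel) = (\<integral>\<^sup>+p. F p \<partial>lborel)"
proof -
  have "(\<integral>\<^sup>+p. F p \<partial>lborel) = (\<integral>\<^sup>+p. F p \<partial>distr lborel borel ((+) w))"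
    by (simp add: lborel_distr_plus)
  also have "\<dots> = (\<integral>\<^sup>+p. F (w + p) \<partial>lborel)" by (rule nn_integral_distr) auto
  finally show ?thesis by (simp add: add.commute)
qed

text \<open>The mean value inequality is used twice: for \<open>g1\<close>, and then for
  \<open>g\<close> minus its linear part, whose derivative \<open>g1 v - g1 z\<close> is of first
  order on the segment.\<close>

lemma taylor_bound:
  fixes g g1 g2 :: "real \<Rightarrow> real"
  assumes "\<And>z. (g has_real_derivative g1 z) (at z)" "\<And>z. (g1 has_real_derivative g2 z) (at z)"
    and "\<And>z. \<bar>g2 z\<bar> \<le> C"
  shows "\<bar>g w - g z - (w - z) * g1 z\<bar> \<le> C * (w - z)\<^sup>2"
proof -
  have C: "C \<ge> 0" using assms(3)[of 0] by linarith
  have 1: "norm (g1 v - g1 z) \<le> C * norm (v - z)" for v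
    by (rule field_differentiable_bound[of UNIV g1 g2 C])
      (use assms(2,3) in auto)
  let ?h = "\<lambda>v. g v - v * g1 z"
  have "norm (?h w - ?h z) \<le> (C * norm (w - z)) * norm (w - z)"
  proof (rule field_differentiable_bound[of "closed_segment z w" ?h "\<lambda>v. g1 v - g1 z"])
    fix v assume v: "v \<in> closed_segment z w"
    show "(?h has_field_derivative g1 v - g1 z) (at v within closed_segment z w)"
      using DERIV_subset[OF assms(1)[of v]] by (auto intro!: derivative_eq_intros)
    have "norm (v - z) \<le> norm (w - z)" using segment_bound(1)[OF v] by (simp add: norm_minus_commute)
    then show "norm (g1 v - g1 z) \<le> C * norm (w - z)"
      using 1[of v] C by (meson mult_left_mono order_trans)
  qed auto
  then show ?thesis by (simp add: algebra_simps power2_eq_square abs_mult_self_eq)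
qed

lemma DERIV_of_quadratic_bound:
  fixes F :: "real \<Rightarrow> real"
  assumes "\<And>z. \<bar>F z - F x - (z - x) * D\<bar> \<le> K * (z - x)\<^sup>2"
  shows "(F has_real_derivative D) (at x)"
proof -
  have "((\<lambda>z. (F z - F x) / (z - x) - D) \<longlongrightarrow> 0) (at x)"
  proof (rule Lim_null_comparison)
    show "((\<lambda>z. K * \<bar>z - x\<bar>) \<longlongrightarrow> 0) (at x)"
      by (auto intro!: tendsto_eq_intros)
    show "\<forall>\<^sub>F z in at x. norm ((F z - F x) / (z - x) - D) \<le> K * \<bar>z - x\<bar>"
    proof (rule eventually_at_topological[THEN iffD2, rule_format], intro exI[of _ UNIV] conjI ballI impI)
      fix z assume "z \<noteq> x"
      then have "(F z - F x) / (z - x) - D = (F z - F x - (z - x) * D) / (z - x)"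
        by (simp add: field_simps)
      then have "norm ((F z - F x) / (z - x) - D) = \<bar>F z - F x - (z - x) * D\<bar> / \<bar>z - x\<bar>"
        by simp
      also have "\<dots> \<le> K * (z - x)\<^sup>2 / \<bar>z - x\<bar>"
        by (intro divide_right_mono assms) auto
      also have "\<dots> = K * \<bar>z - x\<bar>"
        using \<open>z \<noteq> x\<close> by (simp add: power2_eq_square field_simps)
      finally show "norm ((F z - F x) / (z - x) - D) \<le> K * \<bar>z - x\<bar>" .
    qed auto
  qed
  then show ?thesis
    unfolding has_field_derivative_iff using Lim_null by blast
qed

text \<open>A quadratic remainder with a constant uniform in \<open>p\<close> takes the place of
  dominated convergence: integrated against the weight \<open>k\<close> it is again a quadratic
  remainder.\<close>

lemma DERIV_integral_of_taylor:
  fixes k :: "'a \<Rightarrow> real" and f f1 :: "'a \<Rightarrow> real \<Rightarrow> real"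
  assumes k: "integrable M k"
    and f: "\<And>z. integrable M (\<lambda>p. k p * f p z)"
    and f1: "integrable M (\<lambda>p. k p * f1 p x)"
    and T: "\<And>p z. \<bar>f p z - f p x - (z - x) * f1 p x\<bar> \<le> C * (z - x)\<^sup>2"
  shows "((\<lambda>z. \<integral>p. k p * f p z \<partial>M) has_real_derivative (\<integral>p. k p * f1 p x \<partial>M)) (at x)"
proof (rule DERIV_of_quadratic_bound)
  fix z
  let ?R = "\<lambda>p. f p z - f p x - (z - x) * f1 p x"
  have eq: "(\<integral>p. k p * f p z \<partial>M) - (\<integral>p. k p * f p x \<partial>M) - (z - x) * (\<integral>p. k p * f1 p x \<partial>M)
    = (\<integral>p. k p * f p z - k p * f p x - (z - x) * (k p * f1 p x) \<partial>M)"
    using f f1 by simp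
  have "\<bar>\<integral>p. k p * f p z - k p * f p x - (z - x) * (k p * f1 p x) \<partial>M\<bar>
    \<le> (\<integral>p. \<bar>k p * f p z - k p * f p x - (z - x) * (k p * f1 p x)\<bar> \<partial>M)"
    by (rule integral_abs_bound)
  also have "\<dots> \<le> (\<integral>p. \<bar>k p\<bar> * (C * (z - x)\<^sup>2) \<partial>M)"
  proof (rule integral_mono)
    fix p
    have "\<bar>k p * f p z - k p * f p x - (z - x) * (k p * f1 p x)\<bar> = \<bar>k p\<bar> * \<bar>?R p\<bar>"
      by (simp add: abs_mult[symmetric] algebra_simps)
    then show "\<bar>k p * f p z - k p * f p x - (z - x) * (k p * f1 p x)\<bar> \<le> \<bar>k p\<bar> * (C * (z - x)\<^sup>2)"
      using T[of p z] by (simp add: mult_left_mono)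
  qed (use k f f1 in auto)
  finally show "\<bar>(\<integral>p. k p * f p z \<partial>M) - (\<integral>p. k p * f p x \<partial>M) - (z - x) * (\<integral>p. k p * f1 p x \<partial>M)\<bar>
     \<le> ((\<integral>p. \<bar>k p\<bar> \<partial>M) * C) * (z - x)\<^sup>2"
    unfolding eq by (simp add: mult_ac)
qed

lemma x_chain_taylor:
  assumes "x_chain a b c d f"
  obtains C where "\<And>x y z. \<bar>f n (z, y) - f n (x, y) - (z - x) * f (Suc n) (x, y)\<bar> \<le> C * (z - x)\<^sup>2"
proof -
  obtain C where C: "\<And>p. \<bar>f (Suc (Suc n)) p\<bar> \<le> C" using x_chain_bounded[OF assms] by metis
  show ?thesis
    by (rule that, rule taylor_bound[OF x_chainD(2)[OF assms] x_chainD(2)[OF assms] C])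
qed

text \<open>The Riemann--Liouville kernel in the variable \<open>h\<close>, the distance to the
  evaluation point. With \<open>L\<close> the side length of the rectangle the cut-off loses nothing
  at interior points, since test functions vanish outside; it makes the kernel integrable for
  \<alpha> < 2.\<close>

definition riesz_kernel :: "real \<Rightarrow> real \<Rightarrow> real \<Rightarrow> real" where
  "riesz_kernel \<alpha> L h = indicator {0<..L} h * h powr (1 - \<alpha>)"

lemma riesz_kernel_measurable [measurable]: "riesz_kernel \<alpha> L \<in> borel_measurable borel"
  unfolding riesz_kernel_def by measurable

lemma riesz_kernel_nonneg: "riesz_kernel \<alpha> L h \<ge> 0"
  by (simp add: riesz_kernel_def)

lemma riesz_kernel_integrable:
  assumes "\<alpha> < 2"
  shows "integrable lborel (riesz_kernel \<alpha> L)"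
proof (cases "L \<ge> 0")
  case True
  have "(\<lambda>h. h powr (1 - \<alpha>)) integrable_on {0..L}"
    using assms True by (intro integrable_on_powr_from_0) auto
  then have "(\<lambda>h. h powr (1 - \<alpha>)) absolutely_integrable_on {0..L}"
    by (intro nonnegative_absolutely_integrable_1) auto
  then have "integrable lborel (\<lambda>h. indicator {0..L} h *\<^sub>R h powr (1 - \<alpha>))"
    unfolding set_integrable_def by (subst (asm) integrable_completion) auto
  also have "(\<lambda>h. indicator {0..L} h *\<^sub>R h powr (1 - \<alpha>)) = riesz_kernel \<alpha> L"
    by (auto simp: riesz_kernel_def fun_eq_iff indicator_def)
  finally show ?thesis .
next
  case False
  then have "riesz_kernel \<alpha> L = (\<lambda>h. 0)" by (auto simp: riesz_kernel_def fun_eq_iff indicator_def)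
  then show ?thesis by simp
qed

lemma x_chain_slice_measurable:
  assumes "x_chain a b c d f" "g \<in> borel_measurable M"
  shows "(\<lambda>h. f n (g h, y)) \<in> borel_measurable M"
  by (rule measurable_compose[OF borel_measurable_Pair[OF assms(2)] x_chain_measurable[OF assms(1)]]) simp

lemma riesz_slice_integrable:
  assumes "x_chain a b c d f" "\<alpha> < 2"
  shows "integrable lborel (\<lambda>h. riesz_kernel \<alpha> L h * f n (x + s * h, y))"
proof -
  obtain C where C: "\<And>p. \<bar>f n p\<bar> \<le> C" using x_chain_bounded[OF assms(1)] by metis
  show ?thesis
    by (rule integrable_mult_bounded[OF riesz_kernel_integrable[OF assms(2)] x_chain_slice_measurable[OF assms(1)] C]) auto
qed

text \<open>With the evaluation point moved into the argument of \<open>f\<close>, the kernel does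
  not depend on \<open>x\<close>: the derivative falls on the smooth factor and the singular kernel
  is never differentiated.\<close>

lemma DERIV_riesz_slice:
  assumes "x_chain a b c d f" "\<alpha> < 2"
  shows "((\<lambda>x. \<integral>h. riesz_kernel \<alpha> L h * f n (x + s * h, y) \<partial>lborel) has_real_derivative
     (\<integral>h. riesz_kernel \<alpha> L h * f (Suc n) (x + s * h, y) \<partial>lborel)) (at x)"
proof -
  obtain C where C: "\<And>x y z. \<bar>f n (z, y) - f n (x, y) - (z - x) * f (Suc n) (x, y)\<bar> \<le> C * (z - x)\<^sup>2"
    using x_chain_taylor[OF assms(1), of n] by metis
  show ?thesis
  proof (rule DERIV_integral_of_taylor[OF riesz_kernel_integrable[OF assms(2)]])
    fix h z
    show "\<bar>f n (z + s * h, y) - f n (x + s * h, y) - (z - x) * f (Suc n) (x + s * h, y)\<bar> \<le> C * (z - x)\<^sup>2"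
      using C[of "z + s * h" y "x + s * h"] by simp
  qed (rule riesz_slice_integrable[OF assms])+
qed

definition riesz_part :: "real \<Rightarrow> real \<Rightarrow> real \<Rightarrow> fn2 \<Rightarrow> fn2" where
  "riesz_part \<alpha> L s g = (\<lambda>(x, y). \<integral>h. riesz_kernel \<alpha> L h * g (x + s * h, y) \<partial>lborel)"

text \<open>The substitution \<open>s = z - h\<close>. Its range reaches beyond \<open>a\<close>,
  where \<open>f\<close> vanishes; at \<open>s = z\<close> both integrands are 0, the left one
  because \<open>0 powr r = 0\<close>, the right one because the kernel excludes 0.\<close>

lemma integral_RL_left:
  assumes "x_chain a b c d f" "\<alpha> < 2" "z \<in> {a<..<b}"
  shows "integral {a..z} (\<lambda>s. (z - s) powr (1 - \<alpha>) * f n (s, y)) = riesz_part \<alpha> (b - a) (-1) (f n) (z, y)"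
proof -
  let ?k = "riesz_kernel \<alpha> (b - a)"
  have eq: "?k (z + -1 * s) * f n (z + -1 * (z + -1 * s), y)
    = indicator {a..z} s *\<^sub>R ((z - s) powr (1 - \<alpha>) * f n (s, y))" for s
    using assms(3) x_chainD(3)[OF assms(1), of "(s, y)" n]
    by (cases "s \<in> {a..z}"; cases "s = a"; cases "s = z")
      (auto simp: riesz_kernel_def indicator_def Omega_def)
  have "integrable lborel (\<lambda>s. ?k (z + -1 * s) * f n (z + -1 * (z + -1 * s), y))"
    by (rule lborel_integrable_real_affine[OF riesz_slice_integrable[OF assms(1,2)]]) simp
  then have int: "set_integrable lborel {a..z} (\<lambda>s. (z - s) powr (1 - \<alpha>) * f n (s, y))"
    unfolding eq set_integrable_def .
  have "riesz_part \<alpha> (b - a) (-1) (f n) (z, y)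
    = (\<integral>s. ?k (z + -1 * s) * f n (z + -1 * (z + -1 * s), y) \<partial>lborel)"
    unfolding riesz_part_def prod.case by (subst lborel_integral_real_affine[of "-1" _ z]) auto
  also have "\<dots> = integral {a..z} (\<lambda>s. (z - s) powr (1 - \<alpha>) * f n (s, y))"
    unfolding eq using set_borel_integral_eq_integral(2)[OF int] by (simp add: set_lebesgue_integral_def)
  finally show ?thesis by simp
qed

lemma integral_RL_right:
  assumes "x_chain a b c d f" "\<alpha> < 2" "z \<in> {a<..<b}"
  shows "integral {z..b} (\<lambda>s. (s - z) powr (1 - \<alpha>) * f n (s, y)) = riesz_part \<alpha> (b - a) 1 (f n) (z, y)"
proof -
  let ?k = "riesz_kernel \<alpha> (b - a)"
  have eq: "?k (-z + 1 * s) * f n (z + 1 * (-z + 1 * s), y)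
    = indicator {z..b} s *\<^sub>R ((s - z) powr (1 - \<alpha>) * f n (s, y))" for s
    using assms(3) x_chainD(3)[OF assms(1), of "(s, y)" n]
    by (cases "s \<in> {z..b}"; cases "s = b"; cases "s = z")
      (auto simp: riesz_kernel_def indicator_def Omega_def)
  have "integrable lborel (\<lambda>s. ?k (-z + 1 * s) * f n (z + 1 * (-z + 1 * s), y))"
    by (rule lborel_integrable_real_affine[OF riesz_slice_integrable[OF assms(1,2)]]) simp
  then have int: "set_integrable lborel {z..b} (\<lambda>s. (s - z) powr (1 - \<alpha>) * f n (s, y))"
    unfolding eq set_integrable_def .
  have "riesz_part \<alpha> (b - a) 1 (f n) (z, y)
    = (\<integral>s. ?k (-z + 1 * s) * f n (z + 1 * (-z + 1 * s), y) \<partial>lborel)"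
    unfolding riesz_part_def prod.case by (subst lborel_integral_real_affine[of 1 _ "-z"]) auto
  also have "\<dots> = integral {z..b} (\<lambda>s. (s - z) powr (1 - \<alpha>) * f n (s, y))"
    unfolding eq using set_borel_integral_eq_integral(2)[OF int] by (simp add: set_lebesgue_integral_def)
  finally show ?thesis by simp
qed

text \<open>The Riemann--Liouville integral is identified with a smooth function only on the open
  interval, so the outer \<open>deriv\<close> needs the inner one on a whole neighbourhood and not
  just at \<open>x\<close>.\<close>

lemma deriv2_eq_of_eq_on_open:
  fixes G F0 F1 F2 :: "real \<Rightarrow> real"
  assumes "open S" "x \<in> S" "\<And>z. z \<in> S \<Longrightarrow> G z = F0 z"
    and "\<And>z. (F0 has_real_derivative F1 z) (at z)" "\<And>z. (F1 has_real_derivative F2 z) (at z)"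
  shows "deriv (deriv G) x = F2 x"
proof -
  have 1: "deriv G z = F1 z" if "z \<in> S" for z
  proof -
    have "(G has_real_derivative F1 z) (at z)"
      by (rule has_field_derivative_transform_within_open[OF assms(4,1) that]) (simp add: assms(3))
    then show ?thesis by (rule DERIV_imp_deriv)
  qed
  have "(deriv G has_real_derivative F2 x) (at x)"
    by (rule has_field_derivative_transform_within_open[OF assms(5,1,2)]) (simp add: 1)
  then show ?thesis by (rule DERIV_imp_deriv)
qed

text \<open>One coordinate direction of the fractional Laplacian, as an operator on the second
  derivative \<open>g\<close> rather than on the function. For \<open>\<alpha> = 2\<close> the
  prefactor is \<open>1 / (2 * cos pi) = - 1 / 2\<close> and both one-sided derivatives equal
  \<open>g\<close>, hence \<open>- g\<close>.\<close>

definition riesz :: "real \<Rightarrow> real \<Rightarrow> fn2 \<Rightarrow> fn2" where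
  "riesz \<alpha> L g p = (if \<alpha> = 2 then - g p
     else 1 / (2 * cos (pi * \<alpha> / 2) * Gamma (2 - \<alpha>)) * (riesz_part \<alpha> L (-1) g p + riesz_part \<alpha> L 1 g p))"

lemma RL_x_sum_eq_riesz:
  assumes "x_chain a b c d f" "\<alpha> \<le> 2" "x \<in> {a<..<b}"
  shows "1 / (2 * cos (pi * \<alpha> / 2)) * (RL_left_x \<alpha> a (f 0) (x, y) + RL_right_x \<alpha> b (f 0) (x, y))
    = riesz \<alpha> (b - a) (f 2) (x, y)"
proof (cases "\<alpha> = 2")
  case True
  have "deriv (deriv (\<lambda>s. f 0 (s, y))) x = f (Suc (Suc 0)) (x, y)"
    by (rule deriv2_eq_of_eq_on_open[OF open_UNIV _ _ x_chainD(2)[OF assms(1)] x_chainD(2)[OF assms(1)]]) auto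
  with True show ?thesis by (simp add: RL_left_x_def RL_right_x_def riesz_def numeral_2_eq_2)
next
  case False
  then have lt: "\<alpha> < 2" using assms(2) by simp
  have "deriv (deriv (\<lambda>z. integral {a..z} (\<lambda>s. (z - s) powr (1 - \<alpha>) * f 0 (s, y)))) x
     = riesz_part \<alpha> (b - a) (-1) (f (Suc (Suc 0))) (x, y)"
    unfolding riesz_part_def prod.case
    by (rule deriv2_eq_of_eq_on_open[OF open_greaterThanLessThan assms(3) _
          DERIV_riesz_slice[OF assms(1) lt] DERIV_riesz_slice[OF assms(1) lt]])
      (simp only: integral_RL_left[OF assms(1) lt] riesz_part_def prod.case)
  moreover have "deriv (deriv (\<lambda>z. integral {z..b} (\<lambda>s. (s - z) powr (1 - \<alpha>) * f 0 (s, y)))) x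
     = riesz_part \<alpha> (b - a) 1 (f (Suc (Suc 0))) (x, y)"
    unfolding riesz_part_def prod.case
    by (rule deriv2_eq_of_eq_on_open[OF open_greaterThanLessThan assms(3) _
          DERIV_riesz_slice[OF assms(1) lt] DERIV_riesz_slice[OF assms(1) lt]])
      (simp only: integral_RL_right[OF assms(1) lt] riesz_part_def prod.case)
  ultimately show ?thesis
    using False by (simp add: RL_left_x_def RL_right_x_def riesz_def numeral_2_eq_2 distrib_left add_divide_distrib mult_ac)
qed

lemma RL_left_y_swap: "RL_left_y \<alpha> c f (x, y) = RL_left_x \<alpha> c (f \<circ> prod.swap) (y, x)"
  and RL_right_y_swap: "RL_right_y \<alpha> c f (x, y) = RL_right_x \<alpha> c (f \<circ> prod.swap) (y, x)"
  by (simp_all add: RL_left_x_def RL_left_y_def RL_right_x_def RL_right_y_def)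

lemma frac_lap_eq_riesz:
  assumes "f \<in> Cc_inf (Omega a b c d)" "\<alpha> \<le> 2" "p \<in> Omega a b c d"
  shows "frac_lap \<alpha> a b c d f p = riesz \<alpha> (b - a) (dx 2 f) p + riesz \<alpha> (d - c) (dy 2 f) (prod.swap p)"
proof -
  obtain x y where p: "p = (x, y)" "x \<in> {a<..<b}" "y \<in> {c<..<d}" using assms(3) by (auto simp: Omega_def)
  note 1 = RL_x_sum_eq_riesz[OF x_chain_dx[OF assms(1)] assms(2) p(2), of y]
  note 2 = RL_x_sum_eq_riesz[OF x_chain_dy[OF assms(1)] assms(2) p(3), of x]
  show ?thesis
    unfolding p(1) swap_simp 1[symmetric] 2[symmetric]
    by (simp add: frac_lap_def dy_0 RL_left_y_swap RL_right_y_swap distrib_left)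
qed

section \<open>Symmetry and positivity of the Riesz form\<close>

lemma riesz_part_measurable:
  assumes "g \<in> borel_measurable borel"
  shows "riesz_part \<alpha> L s g \<in> borel_measurable borel"
proof -
  have 1: "(\<lambda>q::(real \<times> real) \<times> real. (fst (fst q) + s * snd q, snd (fst q))) \<in> borel_measurable (borel \<Otimes>\<^sub>M lborel)"
    by (intro borel_measurable_Pair) (simp_all add: borel_prod[symmetric])
  have "(\<lambda>q. riesz_kernel \<alpha> L (snd q) * g (fst (fst q) + s * snd q, snd (fst q))) \<in> borel_measurable (borel \<Otimes>\<^sub>M lborel)"
    using measurable_compose[OF 1 assms] by measurable
  then have "(\<lambda>p. \<integral>h. riesz_kernel \<alpha> L h * g (fst p + s * h, snd p) \<partial>lborel) \<in> borel_measurable borel"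
    by (intro lborel.borel_measurable_lebesgue_integral) (simp add: case_prod_beta')
  then show ?thesis by (simp add: riesz_part_def case_prod_beta')
qed

lemma riesz_part_bounded:
  assumes "x_chain a b c d f" "\<alpha> < 2"
  obtains C where "\<And>p. \<bar>riesz_part \<alpha> L s (f n) p\<bar> \<le> C"
proof -
  obtain B where B: "\<And>p. \<bar>f n p\<bar> \<le> B" using x_chain_bounded[OF assms(1)] by metis
  show ?thesis
  proof (rule that)
    fix p :: "real \<times> real"
    obtain x y where p: "p = (x, y)" by fastforce
    have "\<bar>riesz_part \<alpha> L s (f n) p\<bar> \<le> (\<integral>h. \<bar>riesz_kernel \<alpha> L h * f n (x + s * h, y)\<bar> \<partial>lborel)"
      unfolding riesz_part_def p prod.case by (rule integral_abs_bound)
    also have "\<dots> \<le> (\<integral>h. riesz_kernel \<alpha> L h * B \<partial>lborel)"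
      using riesz_slice_integrable[OF assms] riesz_kernel_integrable[OF assms(2)]
      by (intro integral_mono integrable_abs) (auto simp: abs_mult riesz_kernel_nonneg intro!: mult_left_mono B)
    finally show "\<bar>riesz_part \<alpha> L s (f n) p\<bar> \<le> (\<integral>h. riesz_kernel \<alpha> L h * B \<partial>lborel)" .
  qed
qed

lemma riesz_measurable:
  assumes "x_chain a b c d f"
  shows "riesz \<alpha> L (f n) \<in> borel_measurable borel"
proof -
  note [measurable] = x_chain_measurable[OF assms] riesz_part_measurable[OF x_chain_measurable[OF assms]]
  show ?thesis unfolding riesz_def by measurable
qed

lemma riesz_bounded:
  assumes "x_chain a b c d f" "\<alpha> \<le> 2"
  obtains C where "\<And>p. \<bar>riesz \<alpha> L (f n) p\<bar> \<le> C"
proof (cases "\<alpha> = 2")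
  case True
  obtain B where "\<And>p. \<bar>f n p\<bar> \<le> B" using x_chain_bounded[OF assms(1)] by metis
  with True that[of B] show ?thesis by (simp add: riesz_def)
next
  case False
  then have lt: "\<alpha> < 2" using assms(2) by simp
  obtain B where B: "\<And>p. \<bar>riesz_part \<alpha> L (-1) (f n) p\<bar> \<le> B" using riesz_part_bounded[OF assms(1) lt] by metis
  obtain B' where B': "\<And>p. \<bar>riesz_part \<alpha> L 1 (f n) p\<bar> \<le> B'" using riesz_part_bounded[OF assms(1) lt] by metis
  let ?K = "1 / (2 * cos (pi * \<alpha> / 2) * Gamma (2 - \<alpha>))"
  have "\<bar>riesz \<alpha> L (f n) p\<bar> \<le> \<bar>?K\<bar> * (B + B')" for p
  proof -
    have "\<bar>riesz_part \<alpha> L (-1) (f n) p + riesz_part \<alpha> L 1 (f n) p\<bar> \<le> B + B'"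
      using B[of p] B'[of p] by linarith
    then have "\<bar>?K\<bar> * \<bar>riesz_part \<alpha> L (-1) (f n) p + riesz_part \<alpha> L 1 (f n) p\<bar> \<le> \<bar>?K\<bar> * (B + B')"
      by (intro mult_left_mono) auto
    then show ?thesis using False by (simp only: riesz_def if_False abs_mult)
  qed
  then show ?thesis by (rule that)
qed

text \<open>
  By translation invariance, exchanging the two functions reflects \<open>h\<close>; this is what yields
  the symmetry of the Riesz form without integrating by parts in \<open>x\<close>.
\<close>

definition corr :: "fn2 \<Rightarrow> fn2 \<Rightarrow> real \<Rightarrow> real" where
  "corr g f h = (\<integral>p. g p * f (p + (h, 0)) \<partial>lborel)"

lemma x_chain_shift_measurable:
  assumes "x_chain a b c d f"
  shows "(\<lambda>p. f n (p + w)) \<in> borel_measurable borel"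
  by (rule measurable_compose[OF _ x_chain_measurable[OF assms]]) simp

lemma corr_integrable:
  assumes "integrable lborel g" "x_chain a b c d f"
  shows "integrable lborel (\<lambda>p. g p * f n (p + w))"
proof -
  obtain B where B: "\<And>p. \<bar>f n p\<bar> \<le> B" using x_chain_bounded[OF assms(2)] by metis
  show ?thesis
    by (rule integrable_mult_bounded[OF assms(1) _ B]) (simp add: x_chain_shift_measurable[OF assms(2)])
qed

lemma corr_bounded:
  assumes "integrable lborel g" "x_chain a b c d f"
  obtains C where "\<And>h. \<bar>corr g (f n) h\<bar> \<le> C"
proof -
  obtain B where B: "\<And>p. \<bar>f n p\<bar> \<le> B" using x_chain_bounded[OF assms(2)] by metis
  show ?thesis
  proof (rule that)
    fix h
    have "\<bar>corr g (f n) h\<bar> \<le> (\<integral>p. \<bar>g p * f n (p + (h, 0))\<bar> \<partial>lborel)"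
      unfolding corr_def by (rule integral_abs_bound)
    also have "\<dots> \<le> (\<integral>p. \<bar>g p\<bar> * B \<partial>lborel)"
      using assms(1) corr_integrable[OF assms]
      by (intro integral_mono integrable_abs) (auto simp: abs_mult intro!: mult_left_mono B)
    finally show "\<bar>corr g (f n) h\<bar> \<le> (\<integral>p. \<bar>g p\<bar> * B \<partial>lborel)" .
  qed
qed

lemma DERIV_corr:
  assumes "integrable lborel g" "x_chain a b c d f"
  shows "(corr g (f n) has_real_derivative corr g (f (Suc n)) h) (at h)"
proof -
  obtain C where C: "\<And>x y z. \<bar>f n (z, y) - f n (x, y) - (z - x) * f (Suc n) (x, y)\<bar> \<le> C * (z - x)\<^sup>2"
    using x_chain_taylor[OF assms(2), of n] by metis
  have "((\<lambda>h. \<integral>p. g p * f n (p + (h, 0)) \<partial>lborel) has_real_derivative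
     (\<integral>p. g p * f (Suc n) (p + (h, 0)) \<partial>lborel)) (at h)"
  proof (rule DERIV_integral_of_taylor[OF assms(1)])
    fix p z
    show "\<bar>f n (p + (z, 0)) - f n (p + (h, 0)) - (z - h) * f (Suc n) (p + (h, 0))\<bar> \<le> C * (z - h)\<^sup>2"
      using C[of "fst p + z" "snd p" "fst p + h"] by (cases p) simp
  qed (rule corr_integrable[OF assms])+
  then show ?thesis by (simp add: corr_def[abs_def])
qed

lemma corr_commute:
  assumes [measurable]: "g \<in> borel_measurable borel" "f \<in> borel_measurable borel"
  shows "corr g f h = corr f g (- h)"
proof -
  have "corr f g (- h) = (\<integral>p. f (p + (h, 0)) * g (p + (h, 0) + (- h, 0)) \<partial>lborel)"
    unfolding corr_def by (rule lborel_integral_shift[symmetric]) measurable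
  then show ?thesis by (simp add: corr_def add.assoc mult.commute zero_prod_def[symmetric])
qed

text \<open>Fubini reduces the pairing in the plane to a one-dimensional kernel integral, so that
  symmetry and positivity become statements about functions of the shift alone.\<close>

lemma integral_mult_riesz_part:
  assumes "integrable lborel g" "x_chain a b c d f" "\<alpha> < 2"
  shows "(\<integral>p. g p * riesz_part \<alpha> L s (f n) p \<partial>lborel) = (\<integral>h. riesz_kernel \<alpha> L h * corr g (f n) (s * h) \<partial>lborel)"
proof -
  obtain B where B: "\<And>p. \<bar>f n p\<bar> \<le> B" using x_chain_bounded[OF assms(2)] by metis
  note [measurable] = borel_measurable_integrable[OF assms(1)] x_chain_measurable[OF assms(2)]
  let ?k = "riesz_kernel \<alpha> L"
  have "integrable (lborel \<Otimes>\<^sub>M lborel) (\<lambda>(p, h). g p * ?k h)"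
  proof (rule lborel_pair.Fubini_integrable)
    show "integrable lborel (\<lambda>p. \<integral>h. norm (case (p, h) of (p, h) \<Rightarrow> g p * ?k h) \<partial>lborel)"
      using assms(1) by (simp add: abs_mult)
    show "AE p in lborel. integrable lborel (\<lambda>h. case (p, h) of (p, h) \<Rightarrow> g p * ?k h)"
      using riesz_kernel_integrable[OF assms(3)] by simp
  qed measurable
  then have "integrable (lborel \<Otimes>\<^sub>M lborel) (\<lambda>q. (case q of (p, h) \<Rightarrow> g p * ?k h) * f n (fst q + (s * snd q, 0)))"
  proof (rule integrable_mult_bounded)
    have "(\<lambda>q::(real \<times> real) \<times> real. fst q + (s * snd q, 0)) \<in> borel_measurable (lborel \<Otimes>\<^sub>M lborel)"
      by (intro borel_measurable_add borel_measurable_Pair) measurable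
    then show "(\<lambda>q. f n (fst q + (s * snd q, 0))) \<in> borel_measurable (lborel \<Otimes>\<^sub>M lborel)"
      by (rule measurable_compose) measurable
  qed (rule B)
  also have "(\<lambda>q. (case q of (p, h) \<Rightarrow> g p * ?k h) * f n (fst q + (s * snd q, 0)))
     = (\<lambda>(p, h). ?k h * (g p * f n (p + (s * h, 0))))"
    by (auto simp: fun_eq_iff)
  finally have "(\<integral>h. \<integral>p. ?k h * (g p * f n (p + (s * h, 0))) \<partial>lborel \<partial>lborel)
     = (\<integral>p. \<integral>h. ?k h * (g p * f n (p + (s * h, 0))) \<partial>lborel \<partial>lborel)"
    by (rule lborel_pair.Fubini_integral)
  moreover have "(\<integral>p. ?k h * (g p * f n (p + (s * h, 0))) \<partial>lborel) = ?k h * corr g (f n) (s * h)" for h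
    by (simp add: corr_def)
  moreover have "(\<integral>h. ?k h * (g p * f n (p + (s * h, 0))) \<partial>lborel) = g p * riesz_part \<alpha> L s (f n) p" for p
    by (cases p) (simp add: riesz_part_def mult.left_commute[of "?k _"])
  ultimately show ?thesis by (simp only:)
qed

text \<open>Two integrations by parts move both derivatives from \<open>D2\<close> to the kernel.
  What remains is the integral of
  \<open>\<alpha> * (\<alpha> - 1) * h powr (- 1 - \<alpha>) * D h\<close> and the boundary term
  \<open>(\<alpha> - 1) * L powr (- \<alpha>) * D L\<close>; both are nonnegative. The remaining
  boundary terms vanish by the assumptions on \<open>D\<close> and \<open>D1\<close> at 0 and
  \<open>L\<close>.\<close>

lemma riesz_FTC:
  fixes D D1 D2 :: "real \<Rightarrow> real"
  assumes \<alpha>: "1 < \<alpha>" "\<alpha> < 2" and L: "L > 0"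
    and D: "\<And>h. (D has_real_derivative D1 h) (at h)" "\<And>h. (D1 has_real_derivative D2 h) (at h)"
    and D2: "\<And>h. \<bar>D2 h\<bar> \<le> C" "D2 \<in> borel_measurable borel"
    and z: "D 0 = 0" "D1 0 = 0" "D1 L = 0" and nn: "\<And>h. D h \<ge> 0"
  shows "0 \<le> (\<integral>h. riesz_kernel \<alpha> L h * D2 h \<partial>lborel)"
    and "ennreal (\<integral>h. riesz_kernel \<alpha> L h * D2 h \<partial>lborel) \<le> ennreal ((\<alpha> - 1) * L powr (- \<alpha>) * D L)
      + ennreal (\<alpha> * (\<alpha> - 1)) * (\<integral>\<^sup>+h. ennreal (indicator {0<..} h * h powr (- 1 - \<alpha>) * D h) \<partial>lborel)"
proof -
  \<comment> \<open>\<open>G\<close> is an antiderivative of the difference of both integrands; it vanishes at 0 as \<open>0 powr r = 0\<close>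
      and is continuous there because \<open>D\<close> vanishes to second order.\<close>
  define G where "G h = h powr (1 - \<alpha>) * D1 h + (\<alpha> - 1) * (h powr (- \<alpha>) * D h)" for h
  define E where "E h = \<alpha> * (\<alpha> - 1) * (h powr (- 1 - \<alpha>) * D h)" for h
  have C: "C \<ge> 0" using D2(1)[of 0] by linarith
  have D1b: "\<bar>D1 h\<bar> \<le> C * \<bar>h\<bar>" for h
    using field_differentiable_bound[of UNIV D1 D2 C h 0] D(2) D2(1) z by simp
  have Db: "\<bar>D h\<bar> \<le> C * h\<^sup>2" for h
    using taylor_bound[OF D D2(1), of h 0] z by simp
  have contD: "isCont D h" "isCont D1 h" for h using D DERIV_isCont by blast+
  have "((\<lambda>h. h powr (1 - \<alpha>) * D2 h - E h) has_integral (G L - G 0)) {0..L}"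
  proof (rule fundamental_theorem_of_calculus_interior)
    show "continuous_on {0..L} G"
      unfolding continuous_on_eq_continuous_within
    proof
      fix h assume h: "h \<in> {0..L}"
      show "continuous (at h within {0..L}) G"
      proof (cases "h = 0")
        case True
        have "(G \<longlongrightarrow> 0) (at 0 within {0..L})"
        proof (rule Lim_null_comparison)
          show "((\<lambda>h. \<alpha> * C * h powr (2 - \<alpha>)) \<longlongrightarrow> 0) (at 0 within {0..L})"
          proof -
            have "((\<lambda>h::real. h powr (2 - \<alpha>)) \<longlongrightarrow> 0 powr (2 - \<alpha>)) (at 0 within {0..L})"
              using \<alpha> by (intro tendsto_powr2 tendsto_intros) (auto simp: eventually_at_filter)
            from tendsto_mult_left[OF this, of "\<alpha> * C"] show ?thesis by simp
          qed
          \<comment> \<open>The two terms of \<open>G\<close> contribute \<open>C\<close> and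
            \<open>(\<alpha> - 1) * C\<close>, each times \<open>h powr (2 - \<alpha>)\<close>, by
            the linear bound on \<open>D1\<close> and the quadratic bound on
            \<open>D\<close>.\<close>
          have "norm (G h) \<le> \<alpha> * C * h powr (2 - \<alpha>)" if "h > 0" for h
          proof -
            have "norm (G h) \<le> h powr (1 - \<alpha>) * \<bar>D1 h\<bar> + (\<alpha> - 1) * (h powr (- \<alpha>) * \<bar>D h\<bar>)"
              unfolding G_def using \<alpha> by (intro order_trans[OF norm_triangle_ineq]) (simp add: abs_mult)
            also have "\<dots> \<le> h powr (1 - \<alpha>) * (C * h) + (\<alpha> - 1) * (h powr (- \<alpha>) * (C * h\<^sup>2))"
              using D1b[of h] Db[of h] that \<alpha> by (intro add_mono mult_left_mono) auto
            also have "h powr (1 - \<alpha>) * (C * h) = C * h powr (2 - \<alpha>)"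
              using that by (simp add: powr_diff power2_eq_square field_simps)
            also have "h powr (- \<alpha>) * (C * h\<^sup>2) = C * h powr (2 - \<alpha>)"
              using that by (simp add: powr_diff powr_minus power2_eq_square field_simps)
            finally show ?thesis by (simp add: algebra_simps)
          qed
          then show "\<forall>\<^sub>F h in at 0 within {0..L}. norm (G h) \<le> \<alpha> * C * h powr (2 - \<alpha>)"
            by (auto simp: eventually_at_filter)
        qed
        moreover have "G 0 = 0" by (simp add: G_def)
        ultimately show ?thesis by (simp add: continuous_within True)
      next
        case False
        then have "isCont G h"
          using h unfolding G_def by (intro continuous_intros contD) auto
        then show ?thesis by (rule continuous_at_imp_continuous_at_within)
      qed
    qed
    fix h assume "h \<in> {0<..<L}"
    then have h: "h > 0" by simp
    have "(G has_real_derivative ((1 - \<alpha>) * h powr (1 - \<alpha> - 1) * D1 h + D2 h * h powr (1 - \<alpha>)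
       + (\<alpha> - 1) * (- \<alpha> * h powr (- \<alpha> - 1) * D h + D1 h * h powr (- \<alpha>)))) (at h)"
      unfolding G_def
      by (intro DERIV_add DERIV_cmult DERIV_mult' DERIV_mult has_real_derivative_powr h D)
    also have "(1 - \<alpha>) * h powr (1 - \<alpha> - 1) * D1 h + D2 h * h powr (1 - \<alpha>)
       + (\<alpha> - 1) * (- \<alpha> * h powr (- \<alpha> - 1) * D h + D1 h * h powr (- \<alpha>)) = h powr (1 - \<alpha>) * D2 h - E h"
    proof -
      have "1 - \<alpha> - 1 = - \<alpha>" "- \<alpha> - 1 = - 1 - \<alpha>" by simp_all
      then show ?thesis unfolding E_def by (simp only:) (simp add: algebra_simps)
    qed
    finally show "(G has_vector_derivative h powr (1 - \<alpha>) * D2 h - E h) (at h)"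
      by (simp add: has_real_derivative_iff_has_vector_derivative)
  qed (use L in simp)
  moreover have "G 0 = 0" "G L = (\<alpha> - 1) * (L powr (- \<alpha>) * D L)" by (simp_all add: G_def z)
  ultimately have 1: "((\<lambda>h. h powr (1 - \<alpha>) * D2 h - E h) has_integral (\<alpha> - 1) * (L powr (- \<alpha>) * D L)) {0..L}"
    by simp
  let ?I = "\<integral>h. riesz_kernel \<alpha> L h * D2 h \<partial>lborel"
  have int: "integrable lborel (\<lambda>h. riesz_kernel \<alpha> L h * D2 h)"
    using integrable_mult_bounded[OF riesz_kernel_integrable[OF \<alpha>(2)] _ D2(1)] D2(2) by simp
  have "(\<lambda>h. riesz_kernel \<alpha> L h * D2 h) = (\<lambda>h. if h \<in> {0..L} then h powr (1 - \<alpha>) * D2 h else 0)"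
    by (auto simp: riesz_kernel_def fun_eq_iff indicator_def)
  then have 2: "((\<lambda>h. h powr (1 - \<alpha>) * D2 h) has_integral ?I) {0..L}"
    using has_integral_integral_lborel[OF int] has_integral_restrict_UNIV by metis
  from has_integral_diff[OF 2 1]
  have E: "(E has_integral (?I - (\<alpha> - 1) * (L powr (- \<alpha>) * D L))) {0..L}" by simp
  have Enn: "E h \<ge> 0" for h using \<alpha> nn by (simp add: E_def)
  have pos: "(\<alpha> - 1) * (L powr (- \<alpha>) * D L) \<ge> 0" using \<alpha> nn by simp
  have "0 \<le> ?I - (\<alpha> - 1) * (L powr (- \<alpha>) * D L)"
    by (rule has_integral_nonneg[OF E]) (simp add: Enn)
  with pos show "0 \<le> ?I" by linarith
  have [measurable]: "D \<in> borel_measurable borel"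
    by (intro borel_measurable_continuous_onI continuous_at_imp_continuous_on) (simp add: contD)
  have Em: "(\<lambda>h. indicator {0..L} h * E h) \<in> borel_measurable borel" unfolding E_def by measurable
  have "(\<lambda>h. indicator {0..L} h * E h) = (\<lambda>h. if h \<in> {0..L} then E h else 0)"
    by (auto simp: fun_eq_iff)
  with E have EU: "((\<lambda>h. indicator {0..L} h * E h) has_integral (?I - (\<alpha> - 1) * (L powr (- \<alpha>) * D L))) UNIV"
    using has_integral_restrict_UNIV by metis
  have "ennreal (?I - (\<alpha> - 1) * (L powr (- \<alpha>) * D L)) = (\<integral>\<^sup>+h. indicator {0..L} h * E h \<partial>lborel)"
    by (rule nn_integral_has_integral_lborel[symmetric, OF Em _ EU]) (simp add: Enn)
  also have "\<dots> \<le> (\<integral>\<^sup>+h. ennreal (\<alpha> * (\<alpha> - 1)) * ennreal (indicator {0<..} h * h powr (- 1 - \<alpha>) * D h) \<partial>lborel)"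
  proof (rule nn_integral_mono)
    fix h
    show "ennreal (indicator {0..L} h * E h) \<le> ennreal (\<alpha> * (\<alpha> - 1)) * ennreal (indicator {0<..} h * h powr (- 1 - \<alpha>) * D h)"
      using \<alpha> nn[of h] by (auto simp: E_def indicator_def ennreal_mult[symmetric] mult_ac)
  qed
  also have "\<dots> = ennreal (\<alpha> * (\<alpha> - 1)) * (\<integral>\<^sup>+h. ennreal (indicator {0<..} h * h powr (- 1 - \<alpha>) * D h) \<partial>lborel)"
    by (rule nn_integral_cmult) measurable
  finally have "ennreal ((\<alpha> - 1) * L powr (- \<alpha>) * D L) + ennreal (?I - (\<alpha> - 1) * (L powr (- \<alpha>) * D L))
     \<le> ennreal ((\<alpha> - 1) * L powr (- \<alpha>) * D L)
      + ennreal (\<alpha> * (\<alpha> - 1)) * (\<integral>\<^sup>+h. ennreal (indicator {0<..} h * h powr (- 1 - \<alpha>) * D h) \<partial>lborel)"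
    by (rule add_left_mono)
  also have "ennreal ((\<alpha> - 1) * L powr (- \<alpha>) * D L) + ennreal (?I - (\<alpha> - 1) * (L powr (- \<alpha>) * D L)) = ennreal ?I"
    using pos \<open>0 \<le> ?I - (\<alpha> - 1) * (L powr (- \<alpha>) * D L)\<close> by (subst ennreal_plus[symmetric]) (auto simp: mult.assoc)
  finally show "ennreal ?I \<le> ennreal ((\<alpha> - 1) * L powr (- \<alpha>) * D L)
      + ennreal (\<alpha> * (\<alpha> - 1)) * (\<integral>\<^sup>+h. ennreal (indicator {0<..} h * h powr (- 1 - \<alpha>) * D h) \<partial>lborel)" .
qed

text \<open>A shift by at least the width moves the open rectangle off itself. This removes
  \<open>D1 L\<close> from the boundary terms and makes \<open>D L\<close> a multiple of the squared
  L2 norm.\<close>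

lemma corr_eq_0:
  assumes "x_chain a b c d g" "x_chain a b c d f" "\<bar>h\<bar> \<ge> b - a"
  shows "corr (g m) (f n) h = 0"
proof -
  have "g m p * f n (p + (h, 0)) = 0" for p
  proof (cases "p \<in> Omega a b c d")
    case True
    then have "p + (h, 0) \<notin> Omega a b c d"
      using assms(3) by (cases p) (auto simp: Omega_def)
    then show ?thesis by (simp add: x_chainD(3)[OF assms(2)])
  qed (simp add: x_chainD(3)[OF assms(1)])
  then show ?thesis unfolding corr_def by (simp only: Bochner_Integration.integral_zero)
qed

text \<open>The even part in \<open>h\<close> of \<open>corr (g 0) (f 0)\<close> is unchanged when
  \<open>g\<close> and \<open>f\<close> are exchanged; both sides are its second derivative,
  computed for either order.\<close>

lemma corr_sum_symmetric:
  assumes "x_chain a b c d g" "x_chain a b c d f"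
  shows "corr (g 0) (f 2) h + corr (g 0) (f 2) (- h) = corr (f 0) (g 2) h + corr (f 0) (g 2) (- h)"
proof -
  \<comment> \<open>Differentiation flips the sign of the reflected term, so \<open>e = 1\<close>
    serves for the first derivative and \<open>e = -1\<close> for the second.\<close>
  have D: "((\<lambda>h. corr (g 0) (f n) h + e * corr (g 0) (f n) (- h)) has_real_derivative
      corr (g 0) (f (Suc n)) h - e * corr (g 0) (f (Suc n)) (- h)) (at h)"
    if "x_chain a b c d g" "x_chain a b c d f" for g f n h and e :: real
    using DERIV_add[OF DERIV_corr[OF x_chain_integrable[OF that(1)] that(2)]
      DERIV_cmult[OF DERIV_mirror[THEN iffD1, OF DERIV_corr[OF x_chain_integrable[OF that(1)] that(2), of 0 _ "- h"]], of e]]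
    by simp
  have eq0: "(\<lambda>h. corr (g 0) (f 0) h + 1 * corr (g 0) (f 0) (- h)) = (\<lambda>h. corr (f 0) (g 0) h + 1 * corr (f 0) (g 0) (- h))"
    using corr_commute[OF x_chain_measurable[OF assms(1)] x_chain_measurable[OF assms(2)], of 0 0] by (simp add: add.commute)
  have "corr (g 0) (f (Suc 0)) h - 1 * corr (g 0) (f (Suc 0)) (- h) = corr (f 0) (g (Suc 0)) h - 1 * corr (f 0) (g (Suc 0)) (- h)" for h
    using DERIV_unique[OF D[OF assms, of 0 1 h] D[OF assms(2,1), of 0 1 h, folded eq0]] .
  then have eq1: "(\<lambda>h. corr (g 0) (f (Suc 0)) h + (-1) * corr (g 0) (f (Suc 0)) (- h))
      = (\<lambda>h. corr (f 0) (g (Suc 0)) h + (-1) * corr (f 0) (g (Suc 0)) (- h))"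
    by simp
  show ?thesis
    using DERIV_unique[OF D[OF assms, of "Suc 0" "-1" h] D[OF assms(2,1), of "Suc 0" "-1" h, folded eq1]]
    by (simp add: numeral_2_eq_2)
qed

text \<open>The correlation of \<open>g\<close> and the first derivative of \<open>f\<close> is
  differentiated at shift 0 in two ways: directly, and after \<open>corr_commute\<close>, where the
  derivative falls on \<open>g\<close> with a minus sign.\<close>

lemma x_chain_by_parts:
  assumes "x_chain a b c d g" "x_chain a b c d f"
  shows "(\<integral>p. g 0 p * f 2 p \<partial>lborel) = - (\<integral>p. g 1 p * f 1 p \<partial>lborel)"
proof -
  have eq: "corr (g 0) (f 1) = (\<lambda>h. corr (f 1) (g 0) (- h))"
    using corr_commute[OF x_chain_measurable[OF assms(1)] x_chain_measurable[OF assms(2)], of 0 1] by auto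
  have "(corr (g 0) (f 1) has_real_derivative corr (g 0) (f (Suc 1)) 0) (at 0)"
    by (rule DERIV_corr[OF x_chain_integrable[OF assms(1)] assms(2)])
  moreover have "((\<lambda>h. corr (f 1) (g 0) (- h)) has_real_derivative - corr (f 1) (g (Suc 0)) 0) (at 0)"
    using DERIV_mirror[THEN iffD1, OF DERIV_corr[OF x_chain_integrable[OF assms(2)] assms(1)], of 1 0 0] by simp
  ultimately have "corr (g 0) (f (Suc 1)) 0 = - corr (f 1) (g (Suc 0)) 0"
    unfolding eq by (rule DERIV_unique)
  then show ?thesis
    by (simp add: corr_def zero_prod_def[symmetric] mult.commute numeral_2_eq_2)
qed

lemma riesz_form_eq:
  assumes "x_chain a b c d g" "x_chain a b c d f" "\<alpha> < 2"
  shows "(\<integral>p. g 0 p * riesz \<alpha> L (f 2) p \<partial>lborel) = 1 / (2 * cos (pi * \<alpha> / 2) * Gamma (2 - \<alpha>))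
    * (\<integral>h. riesz_kernel \<alpha> L h * (corr (g 0) (f 2) h + corr (g 0) (f 2) (- h)) \<partial>lborel)"
proof -
  note gi = x_chain_integrable[OF assms(1), of 0]
  let ?K = "1 / (2 * cos (pi * \<alpha> / 2) * Gamma (2 - \<alpha>))"
  have i: "integrable lborel (\<lambda>p. g 0 p * riesz_part \<alpha> L s (f 2) p)" for s
  proof -
    obtain B where B: "\<And>p. \<bar>riesz_part \<alpha> L s (f 2) p\<bar> \<le> B" using riesz_part_bounded[OF assms(2,3)] by metis
    show ?thesis
      by (rule integrable_mult_bounded[OF gi _ B]) (simp add: riesz_part_measurable[OF x_chain_measurable[OF assms(2)]])
  qed
  have j: "integrable lborel (\<lambda>h. riesz_kernel \<alpha> L h * corr (g 0) (f 2) (s * h))" for s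
  proof -
    obtain B where B: "\<And>h. \<bar>corr (g 0) (f 2) h\<bar> \<le> B" using corr_bounded[OF gi assms(2)] by metis
    have "continuous_on UNIV (corr (g 0) (f 2))"
      by (intro continuous_at_imp_continuous_on ballI DERIV_isCont[OF DERIV_corr[OF gi assms(2)]])
    then have [measurable]: "corr (g 0) (f 2) \<in> borel_measurable borel"
      by (rule borel_measurable_continuous_onI)
    show ?thesis
      by (rule integrable_mult_bounded[OF riesz_kernel_integrable[OF assms(3)] _ B]) measurable
  qed
  have "(\<integral>p. g 0 p * riesz \<alpha> L (f 2) p \<partial>lborel)
      = (\<integral>p. ?K * (g 0 p * riesz_part \<alpha> L (-1) (f 2) p + g 0 p * riesz_part \<alpha> L 1 (f 2) p) \<partial>lborel)"
    using assms(3) by (intro Bochner_Integration.integral_cong) (auto simp: riesz_def distrib_left mult_ac add_divide_distrib)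
  also have "\<dots> = ?K * ((\<integral>p. g 0 p * riesz_part \<alpha> L (-1) (f 2) p \<partial>lborel) + (\<integral>p. g 0 p * riesz_part \<alpha> L 1 (f 2) p \<partial>lborel))"
    using i by simp
  also have "\<dots> = ?K * (\<integral>h. riesz_kernel \<alpha> L h * corr (g 0) (f 2) (- 1 * h) + riesz_kernel \<alpha> L h * corr (g 0) (f 2) (1 * h) \<partial>lborel)"
    using j[of "-1"] j[of 1] by (simp only: integral_mult_riesz_part[OF gi assms(2,3)] Bochner_Integration.integral_add)
  finally show ?thesis by (simp add: distrib_left add.commute)
qed

lemma riesz_form_symmetric:
  assumes "x_chain a b c d g" "x_chain a b c d f" "\<alpha> \<le> 2"
  shows "(\<integral>p. g 0 p * riesz \<alpha> L (f 2) p \<partial>lborel) = (\<integral>p. f 0 p * riesz \<alpha> L (g 2) p \<partial>lborel)"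
proof (cases "\<alpha> = 2")
  case True
  then show ?thesis
    using x_chain_by_parts[OF assms(1,2)] x_chain_by_parts[OF assms(2,1)] by (simp add: riesz_def mult.commute)
next
  case False
  with assms(3) have "\<alpha> < 2" by simp
  then show ?thesis
    by (simp only: riesz_form_eq[OF assms(1,2)] riesz_form_eq[OF assms(2,1)] corr_sum_symmetric[OF assms(1,2)])
qed

text \<open>The part of the squared H^{alpha/2} norm that sees only differences in the x-direction.
  Being \<open>ennreal\<close>-valued, it shows divergence as infinity and not as a default
  integral.\<close>

definition xenergy :: "real \<Rightarrow> (nat \<Rightarrow> fn2) \<Rightarrow> ennreal" where
  "xenergy \<alpha> f = (\<integral>\<^sup>+p. ennreal ((f 0 p)\<^sup>2) \<partial>lborel) +
     (if \<alpha> = 2 then \<integral>\<^sup>+p. ennreal ((f 1 p)\<^sup>2) \<partial>lborel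
      else \<integral>\<^sup>+h. ennreal (indicator {0<..} h * h powr (- 1 - \<alpha>))
        * (\<integral>\<^sup>+p. ennreal ((f 0 (p + (h, 0)) - f 0 p)\<^sup>2) \<partial>lborel) \<partial>lborel)"

lemma x_chain_integrable_square:
  assumes "x_chain a b c d f"
  shows "integrable lborel (\<lambda>p. (f n p)\<^sup>2)"
  using corr_integrable[OF x_chain_integrable[OF assms, of n] assms, of n 0] by (simp add: power2_eq_square)

lemma x_chain_square_difference:
  assumes "x_chain a b c d f"
  shows "integrable lborel (\<lambda>p. (f 0 (p + (h, 0)) - f 0 p)\<^sup>2)"
    and "(\<integral>p. (f 0 (p + (h, 0)) - f 0 p)\<^sup>2 \<partial>lborel)
      = 2 * (\<integral>p. (f 0 p)\<^sup>2 \<partial>lborel) - corr (f 0) (f 0) h - corr (f 0) (f 0) (- h)"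
proof -
  note m [measurable] = x_chain_measurable[OF assms, of 0]
  have sq: "(\<lambda>p. (f 0 (p + (h, 0)) - f 0 p)\<^sup>2)
     = (\<lambda>p. (f 0 (p + (h, 0)))\<^sup>2 + (f 0 p)\<^sup>2 - 2 * (f 0 p * f 0 (p + (h, 0))))"
    by (simp add: fun_eq_iff power2_diff)
  \<comment> \<open>The translate is again a chain, for the translated rectangle, and so inherits
    square integrability.\<close>
  have "x_chain (a - h) (b - h) c d (\<lambda>n p. f n (p + (h, 0)))"
    unfolding x_chain_def
  proof (intro conjI allI impI)
    fix n
    show "continuous_on UNIV (\<lambda>p. f n (p + (h, 0)))"
      by (rule continuous_on_compose2[OF x_chainD(1)[OF assms]]) (auto intro!: continuous_intros)
    fix x y
    show "((\<lambda>s. f n ((s, y) + (h, 0))) has_real_derivative f (Suc n) ((x, y) + (h, 0))) (at x)"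
      using DERIV_shift[of "\<lambda>s. f n (s, y)" "f (Suc n) (x + h, y)" x h] x_chainD(2)[OF assms, of n y "x + h"] by simp
  next
    fix n p assume "p \<notin> Omega (a - h) (b - h) c d"
    then show "f n (p + (h, 0)) = 0"
      by (intro x_chainD(3)[OF assms]) (cases p, auto simp: Omega_def)
  qed
  from x_chain_integrable_square[OF this, of 0]
  have i: "integrable lborel (\<lambda>p. (f 0 (p + (h, 0)))\<^sup>2)" .
  note j = x_chain_integrable_square[OF assms, of 0] corr_integrable[OF x_chain_integrable[OF assms, of 0] assms, of 0 "(h, 0)"]
  show "integrable lborel (\<lambda>p. (f 0 (p + (h, 0)) - f 0 p)\<^sup>2)"
    unfolding sq using i j by simp
  have "(\<integral>p. (f 0 (p + (h, 0)))\<^sup>2 \<partial>lborel) = (\<integral>p. (f 0 p)\<^sup>2 \<partial>lborel)"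
    by (rule lborel_integral_shift) measurable
  then show "(\<integral>p. (f 0 (p + (h, 0)) - f 0 p)\<^sup>2 \<partial>lborel)
      = 2 * (\<integral>p. (f 0 p)\<^sup>2 \<partial>lborel) - corr (f 0) (f 0) h - corr (f 0) (f 0) (- h)"
    unfolding sq using i j corr_commute[OF m m, of h] by (simp add: corr_def)
qed

text \<open>Apart from a constant, the form is the kernel integral of the second derivative of
  \<open>D h = 2 * c0 - corr (f 0) (f 0) h - corr (f 0) (f 0) (- h)\<close>, to which
  \<open>riesz_FTC\<close> applies. The constant is fixed before \<open>f\<close>, since it is later
  applied to all differences of approximants.\<close>

lemma riesz_form_bound:
  assumes "1 < \<alpha>" "\<alpha> \<le> 2" "a < b"
  obtains C where "\<And>f. x_chain a b c d f \<Longrightarrow> 0 \<le> (\<integral>p. f 0 p * riesz \<alpha> (b - a) (f 2) p \<partial>lborel)"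
    and "\<And>f. x_chain a b c d f \<Longrightarrow>
      ennreal (\<integral>p. f 0 p * riesz \<alpha> (b - a) (f 2) p \<partial>lborel) \<le> ennreal C * xenergy \<alpha> f"
proof (cases "\<alpha> = 2")
  case True
  have eq: "(\<integral>p. f 0 p * riesz \<alpha> (b - a) (f 2) p \<partial>lborel) = (\<integral>p. (f 1 p)\<^sup>2 \<partial>lborel)" if "x_chain a b c d f" for f
    using x_chain_by_parts[OF that that] True by (simp add: riesz_def power2_eq_square)
  have "ennreal (\<integral>p. (f 1 p)\<^sup>2 \<partial>lborel) \<le> ennreal 1 * xenergy \<alpha> f" if "x_chain a b c d f" for f
  proof -
    have "ennreal (\<integral>p. (f 1 p)\<^sup>2 \<partial>lborel) = (\<integral>\<^sup>+p. ennreal ((f 1 p)\<^sup>2) \<partial>lborel)"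
      using x_chain_integrable_square[OF that] by (intro nn_integral_eq_integral[symmetric]) auto
    then show ?thesis using True by (simp add: xenergy_def)
  qed
  with eq that[of 1] show ?thesis by simp
next
  case False
  then have lt: "\<alpha> < 2" using assms(2) by simp
  let ?L = "b - a"
  have L: "?L > 0" using assms(3) by simp
  \<comment> \<open>For 1 < \<alpha> < 2 the cosine is negative, which compensates the minus sign in
    front of the correlations in \<open>D\<close>; this is where the positivity of the operator
    comes from.\<close>
  define K where "K = - (1 / (2 * cos (pi * \<alpha> / 2) * Gamma (2 - \<alpha>)))"
  have "cos (pi * \<alpha> / 2) < 0"
    using assms(1) lt by (intro cos_lt_zero_pi) (auto simp: field_simps)
  moreover have "Gamma (2 - \<alpha>) > 0" using lt by (intro Gamma_real_pos) auto
  ultimately have K: "K > 0" by (simp add: K_def mult_neg_pos divide_pos_neg)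
  let ?I = "\<lambda>f. \<integral>h. riesz_kernel \<alpha> ?L h * - (corr (f 0) (f 2) h + corr (f 0) (f 2) (- h)) \<partial>lborel"
  have eq: "(\<integral>p. f 0 p * riesz \<alpha> ?L (f 2) p \<partial>lborel) = K * ?I f" if "x_chain a b c d f" for f
    unfolding riesz_form_eq[OF that that lt] K_def
    by (simp only: mult_minus_right mult_minus_left minus_minus Bochner_Integration.integral_minus)
  \<comment> \<open>\<open>C1\<close> belongs to the boundary term at \<open>L\<close>: there both
    correlations vanish and \<open>D\<close> equals twice the squared L2 norm. \<open>C2\<close>
    belongs to the remaining integral.\<close>
  define C1 where "C1 = (\<alpha> - 1) * ?L powr (- \<alpha>) * 2"
  define C2 where "C2 = \<alpha> * (\<alpha> - 1)"
  have C: "C1 \<ge> 0" "C2 \<ge> 0" using assms(1) by (simp_all add: C1_def C2_def)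
  have main: "0 \<le> ?I f \<and> ennreal (?I f) \<le> ennreal (C1 + C2) * xenergy \<alpha> f" if f: "x_chain a b c d f" for f
  proof -
    define D where "D h = (\<integral>p. (f 0 (p + (h, 0)) - f 0 p)\<^sup>2 \<partial>lborel)" for h
    note D_eq = x_chain_square_difference(2)[OF f, folded D_def]
    define c0 where "c0 = (\<integral>p. (f 0 p)\<^sup>2 \<partial>lborel)"
    define D1 where "D1 h = - (corr (f 0) (f 1) h - corr (f 0) (f 1) (- h))" for h
    define D2 where "D2 h = - (corr (f 0) (f 2) h + corr (f 0) (f 2) (- h))" for h
    note fi = x_chain_integrable[OF f, of 0]
    have dc: "(corr (f 0) (f n) has_real_derivative corr (f 0) (f (Suc n)) h) (at h)"
      "((\<lambda>h. corr (f 0) (f n) (- h)) has_real_derivative - corr (f 0) (f (Suc n)) (- h)) (at h)" for n h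
      using DERIV_corr[OF fi f] DERIV_mirror[THEN iffD1, OF DERIV_corr[OF fi f]] by auto
    have dD: "(D has_real_derivative D1 h) (at h)" for h
      using DERIV_diff[OF DERIV_diff[OF DERIV_const[of "2 * c0"] dc(1)[of 0 h]] dc(2)[of 0 h]]
      by (simp add: D_eq[abs_def] D1_def c0_def)
    have dD1: "(D1 has_real_derivative D2 h) (at h)" for h
      using DERIV_minus[OF DERIV_diff[OF dc(1)[of "Suc 0" h] dc(2)[of "Suc 0" h]]]
      by (simp add: D1_def[abs_def] D2_def numeral_2_eq_2)
    obtain B where B: "\<And>h. \<bar>corr (f 0) (f 2) h\<bar> \<le> B" using corr_bounded[OF fi f] by metis
    have D2b: "\<bar>D2 h\<bar> \<le> 2 * B" for h using B[of h] B[of "- h"] by (simp add: D2_def)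
    have "continuous_on UNIV (corr (f 0) (f 2))"
      by (intro continuous_at_imp_continuous_on ballI DERIV_isCont[OF dc(1)])
    then have [measurable]: "corr (f 0) (f 2) \<in> borel_measurable borel"
      by (rule borel_measurable_continuous_onI)
    have D2m: "D2 \<in> borel_measurable borel" unfolding D2_def by measurable
    have z4: "D ?L = 2 * c0"
      using L corr_eq_0[OF f f, of ?L 0 0] corr_eq_0[OF f f, of "- ?L" 0 0] by (simp add: D_eq c0_def)
    have z: "D 0 = 0" "D1 0 = 0" "D1 ?L = 0"
      using L corr_eq_0[OF f f, of ?L 0 1] corr_eq_0[OF f f, of "- ?L" 0 1]
      by (simp_all add: D_def D1_def zero_prod_def[symmetric])
    have nn: "D h \<ge> 0" for h by (simp add: D_def)
    note R = riesz_FTC[OF assms(1) lt L dD dD1 D2b D2m z nn, unfolded z4]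
    have c0: "ennreal c0 = (\<integral>\<^sup>+p. ennreal ((f 0 p)\<^sup>2) \<partial>lborel)"
      unfolding c0_def using x_chain_integrable_square[OF f] by (intro nn_integral_eq_integral[symmetric]) auto
    have Dn: "ennreal (D h) = (\<integral>\<^sup>+p. ennreal ((f 0 (p + (h, 0)) - f 0 p)\<^sup>2) \<partial>lborel)" for h
      unfolding D_def using x_chain_square_difference(1)[OF f] by (intro nn_integral_eq_integral[symmetric]) auto
    let ?X = "\<integral>\<^sup>+h. ennreal (indicator {0<..} h * h powr (- 1 - \<alpha>) * D h) \<partial>lborel"
    have X: "xenergy \<alpha> f = ennreal c0 + ?X"
      using False by (simp add: xenergy_def c0 Dn[symmetric] ennreal_mult nn)
    have "ennreal ((\<alpha> - 1) * ?L powr (- \<alpha>) * (2 * c0)) + ennreal C2 * ?X \<le> ennreal (C1 + C2) * xenergy \<alpha> f"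
    proof -
      have "(\<alpha> - 1) * ?L powr (- \<alpha>) * (2 * c0) = C1 * c0" by (simp add: C1_def)
      moreover have "c0 \<ge> 0" by (simp add: c0_def)
      ultimately have "ennreal ((\<alpha> - 1) * ?L powr (- \<alpha>) * (2 * c0)) = ennreal C1 * ennreal c0"
        using C by (simp only: ennreal_mult)
      also have "\<dots> \<le> ennreal (C1 + C2) * ennreal c0"
        using C by (intro mult_right_mono ennreal_leI) auto
      finally have 1: "ennreal ((\<alpha> - 1) * ?L powr (- \<alpha>) * (2 * c0)) \<le> ennreal (C1 + C2) * ennreal c0" .
      have 2: "ennreal C2 * ?X \<le> ennreal (C1 + C2) * ?X"
        using C by (intro mult_right_mono ennreal_leI) auto
      show ?thesis unfolding X distrib_left by (rule add_mono[OF 1 2])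
    qed
    with R show ?thesis unfolding C2_def D2_def by (auto intro: order_trans)
  qed
  show ?thesis
  proof (rule that[of "K * (C1 + C2)"])
    fix f assume f: "x_chain a b c d f"
    show "0 \<le> (\<integral>p. f 0 p * riesz \<alpha> ?L (f 2) p \<partial>lborel)"
      unfolding eq[OF f] using main[OF f] K by simp
    have "ennreal (K * ?I f) = ennreal K * ennreal (?I f)"
      using main[OF f] K by (intro ennreal_mult) auto
    also have "\<dots> \<le> ennreal K * (ennreal (C1 + C2) * xenergy \<alpha> f)"
      using main[OF f] by (intro mult_left_mono) auto
    also have "\<dots> = ennreal (K * (C1 + C2)) * xenergy \<alpha> f"
      using K C by (simp add: ennreal_mult mult.assoc)
    finally show "ennreal (\<integral>p. f 0 p * riesz \<alpha> ?L (f 2) p \<partial>lborel) \<le> ennreal (K * (C1 + C2)) * xenergy \<alpha> f"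
      unfolding eq[OF f] .
  qed
qed

section \<open>Comparison with the Gagliardo seminorm\<close>

lemma lborel_integral_swap:
  fixes F :: "real \<times> real \<Rightarrow> real"
  assumes [measurable]: "F \<in> borel_measurable borel"
  shows "(\<integral>p. F (prod.swap p) \<partial>lborel) = (\<integral>p. F p \<partial>lborel)"
proof -
  have "(\<lambda>(x, y). (y, x)) = (prod.swap :: real \<times> real \<Rightarrow> _)" by (auto simp: fun_eq_iff)
  then have d: "distr lborel lborel (prod.swap :: real \<times> real \<Rightarrow> _) = lborel"
    using lborel_pair.distr_pair_swap[where 'a=real and 'b=real] by (simp add: lborel_prod)
  have [measurable]: "(prod.swap :: real \<times> real \<Rightarrow> _) \<in> borel_measurable borel"
    by (intro borel_measurable_continuous_onI continuous_on_swap)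
  have "(\<integral>p. F p \<partial>lborel) = (\<integral>p. F p \<partial>distr lborel lborel prod.swap)" by (simp only: d)
  also have "\<dots> = (\<integral>p. F (prod.swap p) \<partial>lborel)" by (rule integral_distr) auto
  finally show ?thesis by simp
qed

lemma nn_integral_lborel_swap:
  fixes F :: "real \<times> real \<Rightarrow> ennreal"
  assumes [measurable]: "F \<in> borel_measurable borel"
  shows "(\<integral>\<^sup>+p. F (prod.swap p) \<partial>lborel) = (\<integral>\<^sup>+p. F p \<partial>lborel)"
proof -
  have "(\<lambda>(x, y). (y, x)) = (prod.swap :: real \<times> real \<Rightarrow> _)" by (auto simp: fun_eq_iff)
  then have d: "distr lborel lborel (prod.swap :: real \<times> real \<Rightarrow> _) = lborel"
    using lborel_pair.distr_pair_swap[where 'a=real and 'b=real] by (simp add: lborel_prod)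
  have [measurable]: "(prod.swap :: real \<times> real \<Rightarrow> _) \<in> borel_measurable borel"
    by (intro borel_measurable_continuous_onI continuous_on_swap)
  have "(\<integral>\<^sup>+p. F p \<partial>lborel) = (\<integral>\<^sup>+p. F p \<partial>distr lborel lborel prod.swap)" by (simp only: d)
  also have "\<dots> = (\<integral>\<^sup>+p. F (prod.swap p) \<partial>lborel)" by (rule nn_integral_distr) auto
  finally show ?thesis by simp
qed

lemma nn_integral_lborel_uminus:
  fixes F :: "'a::euclidean_space \<Rightarrow> ennreal"
  assumes [measurable]: "F \<in> borel_measurable borel"
  shows "(\<integral>\<^sup>+p. F (- p) \<partial>lborel) = (\<integral>\<^sup>+p. F p \<partial>lborel)"
proof -
  have "lborel = density (distr lborel borel (\<lambda>x::'a. 0 + (-1) *\<^sub>R x)) (\<lambda>_. ennreal (\<bar>-1\<bar> ^ DIM('a)))"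
    by (rule lborel_affine) simp
  then have d: "lborel = distr lborel borel (uminus :: 'a \<Rightarrow> 'a)"
    by (simp add: density_1)
  have "(\<integral>\<^sup>+p. F p \<partial>lborel) = (\<integral>\<^sup>+p. F p \<partial>distr lborel borel uminus)" by (simp only: d[symmetric])
  also have "\<dots> = (\<integral>\<^sup>+p. F (- p) \<partial>lborel)" by (rule nn_integral_distr) auto
  finally show ?thesis by simp
qed

definition diff2 :: "fn2 \<Rightarrow> real \<times> real \<Rightarrow> ennreal" where
  "diff2 f w = (\<integral>\<^sup>+p. ennreal ((f (p + w) - f p)\<^sup>2) \<partial>lborel)"

lemma measurable_pair_shift:
  fixes f :: "'a::euclidean_space \<Rightarrow> 'b::topological_space"
  assumes "f \<in> borel_measurable borel"
  shows "(\<lambda>q. f (fst q + snd q)) \<in> borel_measurable (borel \<Otimes>\<^sub>M borel)"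
  by (rule measurable_compose[OF _ assms]) (intro borel_measurable_add, simp_all)

lemma diff2_measurable:
  assumes [measurable]: "f \<in> borel_measurable borel"
  shows "diff2 f \<in> borel_measurable borel"
proof -
  note [measurable] = measurable_pair_shift[OF assms]
  have "(\<lambda>(w, p). ennreal ((f (p + w) - f p)\<^sup>2)) \<in> borel_measurable (borel \<Otimes>\<^sub>M lborel)"
    unfolding case_prod_beta' add.commute[of "snd _"] by measurable
  then show ?thesis
    unfolding diff2_def by (rule lborel.borel_measurable_nn_integral)
qed

lemma diff2_swap:
  assumes [measurable]: "f \<in> borel_measurable borel"
  shows "diff2 (f \<circ> prod.swap) w = diff2 f (prod.swap w)"
proof -
  have "diff2 (f \<circ> prod.swap) w = (\<integral>\<^sup>+p. (\<lambda>q. ennreal ((f (q + prod.swap w) - f q)\<^sup>2)) (prod.swap p) \<partial>lborel)"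
    unfolding diff2_def by (intro nn_integral_cong) (auto simp: prod.swap_def plus_prod_def)
  also have "\<dots> = diff2 f (prod.swap w)"
    unfolding diff2_def by (rule nn_integral_lborel_swap) measurable
  finally show ?thesis .
qed

lemma diff2_triangle:
  assumes [measurable]: "f \<in> borel_measurable borel"
  shows "diff2 f (u + v) \<le> 2 * diff2 f u + 2 * diff2 f v"
proof -
  have "diff2 f (u + v) \<le> (\<integral>\<^sup>+p. 2 * ennreal ((f (p + u) - f p)\<^sup>2) + 2 * ennreal ((f (p + u + v) - f (p + u))\<^sup>2) \<partial>lborel)"
    unfolding diff2_def
  proof (rule nn_integral_mono)
    fix p
    have "(f (p + (u + v)) - f p)\<^sup>2 \<le> 2 * (f (p + u) - f p)\<^sup>2 + 2 * (f (p + u + v) - f (p + u))\<^sup>2"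
      using sum_squares_bound[of "f (p + u) - f p" "f (p + u + v) - f (p + u)"]
      by (simp add: add.assoc power2_eq_square algebra_simps)
    then have "ennreal ((f (p + (u + v)) - f p)\<^sup>2) \<le> ennreal (2 * (f (p + u) - f p)\<^sup>2 + 2 * (f (p + u + v) - f (p + u))\<^sup>2)"
      by (rule ennreal_leI)
    also have "\<dots> = 2 * ennreal ((f (p + u) - f p)\<^sup>2) + 2 * ennreal ((f (p + u + v) - f (p + u))\<^sup>2)"
      by (simp add: ennreal_mult)
    finally show "ennreal ((f (p + (u + v)) - f p)\<^sup>2) \<le> 2 * ennreal ((f (p + u) - f p)\<^sup>2) + 2 * ennreal ((f (p + u + v) - f (p + u))\<^sup>2)" .
  qed
  also have "\<dots> = 2 * diff2 f u + 2 * (\<integral>\<^sup>+p. ennreal ((f (p + u + v) - f (p + u))\<^sup>2) \<partial>lborel)"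
    unfolding diff2_def by (simp add: nn_integral_add nn_integral_cmult)
  also have "(\<integral>\<^sup>+p. ennreal ((f (p + u + v) - f (p + u))\<^sup>2) \<partial>lborel) = diff2 f v"
    unfolding diff2_def by (rule nn_integral_lborel_shift[of "\<lambda>p. ennreal ((f (p + v) - f p)\<^sup>2)"]) measurable
  finally show ?thesis .
qed

text \<open>The Gagliardo double integral after the substitution \<open>q = p + w\<close>, which
  groups it by shifts so that it can be compared with shifts along one axis.\<close>

definition gagliardo :: "real \<Rightarrow> fn2 \<Rightarrow> ennreal" where
  "gagliardo \<alpha> f = (\<integral>\<^sup>+w. diff2 f w * ennreal (norm w powr (- 2 - \<alpha>)) \<partial>lborel)"

lemma gagliardo_swap:
  assumes [measurable]: "f \<in> borel_measurable borel"
  shows "gagliardo \<alpha> (f \<circ> prod.swap) = gagliardo \<alpha> f"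
proof -
  note [measurable] = diff2_measurable[OF assms]
  have "gagliardo \<alpha> (f \<circ> prod.swap) = (\<integral>\<^sup>+w. (\<lambda>w. diff2 f w * ennreal (norm w powr (- 2 - \<alpha>))) (prod.swap w) \<partial>lborel)"
    unfolding gagliardo_def diff2_swap[OF assms]
    by (intro nn_integral_cong) (auto simp: norm_prod_def add.commute)
  also have "\<dots> = gagliardo \<alpha> f"
    unfolding gagliardo_def by (rule nn_integral_lborel_swap) measurable
  finally show ?thesis .
qed

lemma nn_integral_Gagliardo:
  assumes [measurable]: "f \<in> borel_measurable borel"
  shows "(\<integral>\<^sup>+pq. ennreal ((f (fst pq) - f (snd pq))\<^sup>2 / (dist (fst pq) (snd pq)) powr (2 + \<alpha>)) \<partial>lborel) = gagliardo \<alpha> f"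
proof -
  note [measurable] = measurable_pair_shift[OF assms]
  let ?F = "\<lambda>pq :: (real \<times> real) \<times> (real \<times> real). ennreal ((f (fst pq) - f (snd pq))\<^sup>2 / (dist (fst pq) (snd pq)) powr (2 + \<alpha>))"
  have [measurable]: "?F \<in> borel_measurable (lborel \<Otimes>\<^sub>M lborel)"
    by measurable
  have F1: "(\<lambda>q. ?F (p, q)) \<in> borel_measurable borel" for p by measurable
  have "(\<integral>\<^sup>+pq. ?F pq \<partial>lborel) = (\<integral>\<^sup>+pq. ?F pq \<partial>(lborel \<Otimes>\<^sub>M lborel))"
    by (simp only: lborel_prod)
  also have "\<dots> = (\<integral>\<^sup>+p. \<integral>\<^sup>+q. ?F (p, q) \<partial>lborel \<partial>lborel)"
    by (rule lborel.nn_integral_fst[symmetric]) measurable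
  also have "\<dots> = (\<integral>\<^sup>+p. \<integral>\<^sup>+w. ?F (p, w + p) \<partial>lborel \<partial>lborel)"
    by (rule nn_integral_cong, rule nn_integral_lborel_shift[OF F1, symmetric])
  also have "\<dots> = (\<integral>\<^sup>+p. \<integral>\<^sup>+w. ennreal ((f (p + w) - f p)\<^sup>2) * ennreal (norm w powr (- 2 - \<alpha>)) \<partial>lborel \<partial>lborel)"
  proof (intro nn_integral_cong)
    fix p w :: "real \<times> real"
    have "dist p (w + p) = norm w" by (simp add: dist_norm)
    moreover have "inverse (norm w powr (2 + \<alpha>)) = norm w powr (- 2 - \<alpha>)"
      using powr_minus[of "norm w" "2 + \<alpha>"] by simp
    moreover have "(f p - f (w + p))\<^sup>2 = (f (p + w) - f p)\<^sup>2"
      by (simp add: power2_commute add.commute)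
    ultimately show "?F (p, w + p) = ennreal ((f (p + w) - f p)\<^sup>2) * ennreal (norm w powr (- 2 - \<alpha>))"
      by (simp add: ennreal_mult[symmetric] divide_inverse)
  qed
  also have "\<dots> = (\<integral>\<^sup>+w. \<integral>\<^sup>+p. ennreal ((f (p + w) - f p)\<^sup>2) * ennreal (norm w powr (- 2 - \<alpha>)) \<partial>lborel \<partial>lborel)"
    by (rule lborel_pair.Fubini') (simp add: case_prod_beta', measurable)
  also have "\<dots> = gagliardo \<alpha> f"
    unfolding gagliardo_def diff2_def by (intro nn_integral_cong nn_integral_multc) measurable
  finally show ?thesis .
qed

lemma nn_integral_powr_tail:
  assumes "a > 0" "s > 0"
  shows "(\<integral>\<^sup>+h. ennreal (indicator {a..} h * h powr (- 1 - s)) \<partial>lborel) = ennreal (a powr (- s) / s)"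
proof -
  have "((\<lambda>h. h powr (- 1 - s)) has_integral - (a powr ((- 1 - s) + 1)) / ((- 1 - s) + 1)) {a..}"
    using assms by (intro has_integral_powr_to_inf) auto
  then have "((\<lambda>h. h powr (- 1 - s)) has_integral (a powr (- s) / s)) {a..}"
    using assms by simp
  moreover have "(\<lambda>h. indicator {a..} h * h powr (- 1 - s)) = (\<lambda>h. if h \<in> {a..} then h powr (- 1 - s) else 0)"
    by (auto simp: fun_eq_iff)
  ultimately have "((\<lambda>h. indicator {a..} h * h powr (- 1 - s)) has_integral (a powr (- s) / s)) UNIV"
    using has_integral_restrict_UNIV by metis
  then show ?thesis by (intro nn_integral_has_integral_lborel) auto
qed

definition xbox :: "real \<Rightarrow> (real \<times> real) set" where
  "xbox h = {0<..<h} \<times> {- h<..<h}"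

text \<open>
  The triangle inequality is averaged over \<open>w\<close> in a box that is invariant under
  \<open>w \<mapsto> (h, 0) - w\<close>. Only \<open>norm w \<le> 2 * h\<close> is needed there, so the box may touch the origin.
\<close>

lemma diff2_le_box_average:
  assumes [measurable]: "f \<in> borel_measurable borel" and h: "h > 0"
  shows "diff2 f (h, 0) \<le> ennreal (2 / h\<^sup>2) * (\<integral>\<^sup>+w. indicator (xbox h) w * diff2 f w \<partial>lborel)"
proof -
  note [measurable] = diff2_measurable[OF assms(1)]
  have box: "xbox h = box (0, - h) (h, h)" by (auto simp: xbox_def box_prod box_real)
  have [measurable]: "xbox h \<in> sets borel" unfolding box by simp
  have tri: "diff2 f (h, 0) \<le> 2 * diff2 f w + 2 * diff2 f ((h, 0) - w)" for w
    using diff2_triangle[OF assms(1), of w "(h, 0) - w"] by simp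
  let ?J = "\<integral>\<^sup>+w. indicator (xbox h) w * diff2 f w \<partial>lborel"
  \<comment> \<open>The two halves of the triangle inequality together give 4 times the integral
    over the box; divided by the area \<open>2 * h\<^sup>2\<close> this is the constant
    \<open>2 / h\<^sup>2\<close>.\<close>
  have "emeasure lborel (xbox h) = ennreal (2 * h\<^sup>2)"
    unfolding box using h by (subst emeasure_lborel_box) (auto simp: Basis_prod_def power2_eq_square inner_prod_def)
  then have "ennreal (2 * h\<^sup>2) * diff2 f (h, 0) = (\<integral>\<^sup>+w. indicator (xbox h) w * diff2 f (h, 0) \<partial>lborel)"
    by (simp add: nn_integral_multc)
  also have "\<dots> \<le> (\<integral>\<^sup>+w. 2 * (indicator (xbox h) w * diff2 f w) + 2 * (indicator (xbox h) w * diff2 f ((h, 0) - w)) \<partial>lborel)"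
    using tri by (intro nn_integral_mono) (auto simp: indicator_def)
  also have "\<dots> = 2 * ?J + 2 * (\<integral>\<^sup>+w. indicator (xbox h) w * diff2 f ((h, 0) - w) \<partial>lborel)"
    by (simp add: nn_integral_add nn_integral_cmult)
  also have "(\<integral>\<^sup>+w. indicator (xbox h) w * diff2 f ((h, 0) - w) \<partial>lborel)
     = (\<integral>\<^sup>+w. (\<lambda>w. indicator (xbox h) w * diff2 f w) (- w + (h, 0)) \<partial>lborel)"
    by (intro nn_integral_cong) (auto simp: indicator_def xbox_def algebra_simps)
  also have "\<dots> = (\<integral>\<^sup>+w. (\<lambda>w. indicator (xbox h) w * diff2 f w) (w + (h, 0)) \<partial>lborel)"
    by (rule nn_integral_lborel_uminus) measurable
  also have "\<dots> = ?J" by (rule nn_integral_lborel_shift) measurable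
  also have "2 * ?J + 2 * ?J = 4 * ?J"
    by (metis (no_types, lifting) distrib_right numeral_Bit0)
  finally have le: "ennreal (2 * h\<^sup>2) * diff2 f (h, 0) \<le> 4 * ?J" .
  have "diff2 f (h, 0) = ennreal (1 / (2 * h\<^sup>2)) * (ennreal (2 * h\<^sup>2) * diff2 f (h, 0))"
    using h by (simp add: mult.assoc[symmetric] ennreal_mult[symmetric])
  also have "\<dots> \<le> ennreal (1 / (2 * h\<^sup>2)) * (4 * ?J)" by (intro mult_left_mono le) simp
  also have "\<dots> = ennreal (1 / (2 * h\<^sup>2) * 4) * ?J"
    by (subst ennreal_mult) (simp_all add: mult.assoc)
  also have "1 / (2 * h\<^sup>2) * 4 = 2 / h\<^sup>2" by simp
  finally show ?thesis .
qed

text \<open>The box average adds \<open>h powr (- 2)\<close> to the weight. After exchanging the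
  integrals, a fixed \<open>w\<close> only meets shifts \<open>h\<close> of size at least
  \<open>norm w / 2\<close>, and the tail integral of \<open>h powr (- 3 - \<alpha>)\<close> is a
  multiple of \<open>norm w powr (- 2 - \<alpha>)\<close>, the Gagliardo weight in the
  plane.\<close>

lemma directional_le_gagliardo:
  assumes [measurable]: "f \<in> borel_measurable borel" and \<alpha>: "1 < \<alpha>"
  shows "(\<integral>\<^sup>+h. ennreal (indicator {0<..} h * h powr (- 1 - \<alpha>)) * diff2 f (h, 0) \<partial>lborel)
     \<le> ennreal (2 * 2 powr (2 + \<alpha>)) * gagliardo \<alpha> f"
proof -
  note [measurable] = diff2_measurable[OF assms(1)]
  have [measurable]: "(fst :: real \<times> real \<Rightarrow> real) \<in> borel_measurable borel" "(snd :: real \<times> real \<Rightarrow> real) \<in> borel_measurable borel"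
    by (intro borel_measurable_continuous_onI continuous_intros)+
  have ind: "(\<lambda>q. indicator (xbox (fst q)) (snd q) :: ennreal) = (\<lambda>q. if 0 < fst (snd q) \<and> fst (snd q) < fst q
      \<and> - fst q < snd (snd q) \<and> snd (snd q) < fst q then 1 else 0)"
    by (auto simp: fun_eq_iff xbox_def)
  have [measurable]: "(\<lambda>q. indicator (xbox (fst q)) (snd q) :: ennreal) \<in> borel_measurable (borel \<Otimes>\<^sub>M borel)"
    unfolding ind by measurable
  let ?k = "\<lambda>h. ennreal (indicator {0<..} h * h powr (- 1 - \<alpha>))"
  have "(\<integral>\<^sup>+h. ?k h * diff2 f (h, 0) \<partial>lborel)
    \<le> (\<integral>\<^sup>+h. \<integral>\<^sup>+w. 2 * ennreal (indicator {0<..} h * h powr (- 1 - (2 + \<alpha>))) * (indicator (xbox h) w * diff2 f w) \<partial>lborel \<partial>lborel)"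
  proof (rule nn_integral_mono)
    fix h :: real
    show "?k h * diff2 f (h, 0) \<le> (\<integral>\<^sup>+w. 2 * ennreal (indicator {0<..} h * h powr (- 1 - (2 + \<alpha>))) * (indicator (xbox h) w * diff2 f w) \<partial>lborel)"
    proof (cases "h > 0")
      case True
      have p: "h powr (- 1 - \<alpha>) * (2 / h\<^sup>2) = 2 * h powr (- 1 - (2 + \<alpha>))"
      proof -
        have "- 1 - (2 + \<alpha>) = (- 1 - \<alpha>) - 2" by simp
        then have "h powr (- 1 - (2 + \<alpha>)) = h powr (- 1 - \<alpha>) / h powr 2" by (simp only: powr_diff)
        then show ?thesis using True by simp
      qed
      have [measurable]: "xbox h \<in> sets borel"
        unfolding xbox_def by (intro borel_open open_Times) auto
      have "?k h * diff2 f (h, 0) \<le> ?k h * (ennreal (2 / h\<^sup>2) * (\<integral>\<^sup>+w. indicator (xbox h) w * diff2 f w \<partial>lborel))"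
        by (intro mult_left_mono diff2_le_box_average[OF assms(1) True]) simp
      also have "\<dots> = ennreal (h powr (- 1 - \<alpha>) * (2 / h\<^sup>2)) * (\<integral>\<^sup>+w. indicator (xbox h) w * diff2 f w \<partial>lborel)"
        using True by (subst ennreal_mult) (simp_all add: mult.assoc)
      also have "\<dots> = ennreal (2 * h powr (- 1 - (2 + \<alpha>))) * (\<integral>\<^sup>+w. indicator (xbox h) w * diff2 f w \<partial>lborel)"
        by (simp only: p)
      also have "\<dots> = (\<integral>\<^sup>+w. 2 * ennreal (indicator {0<..} h * h powr (- 1 - (2 + \<alpha>))) * (indicator (xbox h) w * diff2 f w) \<partial>lborel)"
        using True by (subst nn_integral_cmult) (simp_all add: ennreal_mult)
      finally show ?thesis .
    qed simp
  qed
  also have "\<dots> = (\<integral>\<^sup>+w. \<integral>\<^sup>+h. 2 * ennreal (indicator {0<..} h * h powr (- 1 - (2 + \<alpha>))) * (indicator (xbox h) w * diff2 f w) \<partial>lborel \<partial>lborel)"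
    by (rule lborel_pair.Fubini'[symmetric]) (simp add: case_prod_beta', measurable)
  also have "\<dots> \<le> (\<integral>\<^sup>+w. ennreal (2 * 2 powr (2 + \<alpha>)) * (diff2 f w * ennreal (norm w powr (- 2 - \<alpha>))) \<partial>lborel)"
  proof (rule nn_integral_mono)
    fix w :: "real \<times> real"
    let ?r = "norm w / 2"
    show "(\<integral>\<^sup>+h. 2 * ennreal (indicator {0<..} h * h powr (- 1 - (2 + \<alpha>))) * (indicator (xbox h) w * diff2 f w) \<partial>lborel)
      \<le> ennreal (2 * 2 powr (2 + \<alpha>)) * (diff2 f w * ennreal (norm w powr (- 2 - \<alpha>)))"
    proof (cases "fst w > 0")
      case True
      then have "w \<noteq> 0" by auto
      then have r: "?r > 0" by simp
      have "(\<integral>\<^sup>+h. 2 * ennreal (indicator {0<..} h * h powr (- 1 - (2 + \<alpha>))) * (indicator (xbox h) w * diff2 f w) \<partial>lborel)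
        \<le> (\<integral>\<^sup>+h. (2 * diff2 f w) * ennreal (indicator {?r..} h * h powr (- 1 - (2 + \<alpha>))) \<partial>lborel)"
      proof (rule nn_integral_mono)
        fix h :: real
        \<comment> \<open>In the box both coordinates are smaller than \<open>h\<close> in absolute
          value, and the norm is at most their sum.\<close>
        have "w \<in> xbox h \<Longrightarrow> ?r \<le> h"
          using norm_fst_le[of "fst w" "snd w"] norm_Pair_le[of "fst w" "snd w"]
          by (cases w) (auto simp: xbox_def)
        then show "2 * ennreal (indicator {0<..} h * h powr (- 1 - (2 + \<alpha>))) * (indicator (xbox h) w * diff2 f w)
          \<le> (2 * diff2 f w) * ennreal (indicator {?r..} h * h powr (- 1 - (2 + \<alpha>)))"
          by (auto simp: indicator_def mult_ac)
      qed
      also have "\<dots> = (2 * diff2 f w) * ennreal (?r powr (- (2 + \<alpha>)) / (2 + \<alpha>))"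
        using nn_integral_powr_tail[OF r, of "2 + \<alpha>"] \<alpha> by (subst nn_integral_cmult) auto
      also have "?r powr (- (2 + \<alpha>)) / (2 + \<alpha>) \<le> 2 powr (2 + \<alpha>) * norm w powr (- 2 - \<alpha>)"
      proof -
        have "?r powr (- (2 + \<alpha>)) = 2 powr (2 + \<alpha>) * norm w powr (- 2 - \<alpha>)"
        proof -
          have "?r powr (- (2 + \<alpha>)) = norm w powr (- (2 + \<alpha>)) / 2 powr (- (2 + \<alpha>))"
            by (rule powr_divide)
          also have "2 powr (- (2 + \<alpha>)) = 1 / 2 powr (2 + \<alpha>)" by (rule powr_minus_divide)
          finally show ?thesis by simp
        qed
        moreover have "x / (2 + \<alpha>) \<le> x" if "x \<ge> 0" for x :: real
          using \<alpha> that by (simp add: divide_le_eq mult_le_cancel_left1 algebra_simps)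
        ultimately show ?thesis by simp
      qed
      then have "(2 * diff2 f w) * ennreal (?r powr (- (2 + \<alpha>)) / (2 + \<alpha>))
         \<le> (2 * diff2 f w) * ennreal (2 powr (2 + \<alpha>) * norm w powr (- 2 - \<alpha>))"
        by (intro mult_left_mono ennreal_leI) auto
      also have "\<dots> = ennreal (2 * 2 powr (2 + \<alpha>)) * (diff2 f w * ennreal (norm w powr (- 2 - \<alpha>)))"
        by (simp add: ennreal_mult mult_ac)
      finally show ?thesis .
    next
      case False
      then have "w \<notin> xbox h" for h by (auto simp: xbox_def)
      then show ?thesis by simp
    qed
  qed
  also have "\<dots> = ennreal (2 * 2 powr (2 + \<alpha>)) * gagliardo \<alpha> f"
    unfolding gagliardo_def by (rule nn_integral_cmult) measurable
  finally show ?thesis .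
qed

section \<open>Finiteness of the Gagliardo seminorm of test functions\<close>

lemma Cc_inf_chain:
  assumes "f \<in> Cc_inf (Omega a b c d)"
  shows "f \<in> borel_measurable borel" "p \<notin> Omega a b c d \<Longrightarrow> f p = 0" "integrable lborel (\<lambda>p. (f p)\<^sup>2)"
  using x_chain_measurable[OF x_chain_dx[OF assms], of 0] x_chainD(3)[OF x_chain_dx[OF assms], of p 0]
    x_chain_integrable_square[OF x_chain_dx[OF assms], of 0] by simp_all

lemma Cc_inf_lipschitz:
  assumes f: "f \<in> Cc_inf (Omega a b c d)"
  obtains B where "B \<ge> 0" "\<And>p w. \<bar>f (p + w) - f p\<bar> \<le> B * norm w"
proof -
  obtain B1 where B1: "B1 \<ge> 0" "\<And>p. \<bar>dx (Suc 0) f p\<bar> \<le> B1" using x_chain_bounded[OF x_chain_dx[OF f]] by metis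
  obtain B2 where B2: "B2 \<ge> 0" "\<And>p. \<bar>dy (Suc 0) f p\<bar> \<le> B2" using x_chain_bounded[OF x_chain_dy[OF f]] by metis
  have "\<bar>f (p + w) - f p\<bar> \<le> (B1 + B2) * norm w" for p w
  proof -
    obtain x y u v where pw: "p = (x, y)" "w = (u, v)" by fastforce
    have 1: "norm (f (x + u, y + v) - f (x, y + v)) \<le> B1 * norm (x + u - x)"
      by (rule field_differentiable_bound[of UNIV "\<lambda>s. f (s, y + v)" "\<lambda>s. dx (Suc 0) f (s, y + v)"])
        (use x_chainD(2)[OF x_chain_dx[OF f], of 0] B1 in auto)
    have 2: "norm (f (x, y + v) - f (x, y)) \<le> B2 * norm (y + v - y)"
      by (rule field_differentiable_bound[of UNIV "\<lambda>s. f (x, s)" "\<lambda>s. dy (Suc 0) f (s, x)"])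
        (use x_chainD(2)[OF x_chain_dy[OF f], of 0] B2 in \<open>auto simp: dy_0\<close>)
    have "B1 * \<bar>u\<bar> + B2 * \<bar>v\<bar> \<le> B1 * norm w + B2 * norm w"
      using B1(1) B2(1) norm_fst_le[of u v] norm_snd_le[of v u] by (intro add_mono mult_left_mono) (auto simp: pw)
    with 1 2 show ?thesis by (simp add: pw algebra_simps)
  qed
  then show ?thesis using that[of "B1 + B2"] B1 B2 by simp
qed

text \<open>The sup bound serves for large shifts and the Lipschitz bound for small ones; the
  difference lives on the rectangle and its translate, hence the factor
  \<open>2 * m\<close>.\<close>

lemma diff2_le_min:
  assumes f: "f \<in> Cc_inf (Omega a b c d)"
  obtains K where "K \<ge> 0" "\<And>w. diff2 f w \<le> ennreal (K * min 1 ((norm w)\<^sup>2))"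
proof -
  obtain A where A: "A \<ge> 0" "\<And>p. \<bar>f p\<bar> \<le> A" using x_chain_bounded[OF x_chain_dx[OF f], of 0] by auto
  obtain B where B: "B \<ge> 0" "\<And>p w. \<bar>f (p + w) - f p\<bar> \<le> B * norm w" using Cc_inf_lipschitz[OF f] by metis
  let ?\<Omega> = "Omega a b c d"
  define m where "m = measure lborel ?\<Omega>"
  have em: "emeasure lborel ?\<Omega> = ennreal m"
    unfolding m_def by (rule emeasure_eq_ennreal_measure) (use emeasure_Omega_finite[of a b c d] in auto)
  have m0: "m \<ge> 0" by (simp add: m_def)
  have bound: "diff2 f w \<le> ennreal (((2 * A)\<^sup>2 + B\<^sup>2) * (2 * m) * min 1 ((norm w)\<^sup>2))" for w
  proof -
    let ?M = "((2 * A)\<^sup>2 + B\<^sup>2) * min 1 ((norm w)\<^sup>2)"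
    have M0: "?M \<ge> 0" by simp
    have sq: "(f (p + w) - f p)\<^sup>2 \<le> ?M" for p
    proof -
      have "\<bar>f (p + w) - f p\<bar> \<le> 2 * A" using A(2)[of p] A(2)[of "p + w"] by linarith
      then have 1: "(f (p + w) - f p)\<^sup>2 \<le> (2 * A)\<^sup>2" by (metis abs_ge_zero power2_abs power_mono)
      have 2: "(f (p + w) - f p)\<^sup>2 \<le> (B * norm w)\<^sup>2" using B(2)[of p w] by (metis abs_ge_zero power2_abs power_mono)
      show ?thesis
      proof (cases "1 \<le> (norm w)\<^sup>2")
        case True
        have "B\<^sup>2 \<ge> 0" by simp
        with 1 have "(f (p + w) - f p)\<^sup>2 \<le> (2 * A)\<^sup>2 + B\<^sup>2" by linarith
        with True show ?thesis by (simp add: min_def)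
      next
        case False
        have "(2 * A)\<^sup>2 * (norm w)\<^sup>2 \<ge> 0" by simp
        with 2 have "(f (p + w) - f p)\<^sup>2 \<le> (2 * A)\<^sup>2 * (norm w)\<^sup>2 + B\<^sup>2 * (norm w)\<^sup>2"
          unfolding power_mult_distrib[of B] by linarith
        with False show ?thesis by (simp add: min_def distrib_right)
      qed
    qed
    have "diff2 f w \<le> (\<integral>\<^sup>+p. ennreal ?M * (indicator ?\<Omega> p + indicator ?\<Omega> (p + w)) \<partial>lborel)"
      unfolding diff2_def
    proof (rule nn_integral_mono)
      fix p
      show "ennreal ((f (p + w) - f p)\<^sup>2) \<le> ennreal ?M * (indicator ?\<Omega> p + indicator ?\<Omega> (p + w))"
      proof (cases "p \<in> ?\<Omega> \<or> p + w \<in> ?\<Omega>")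
        case True
        have "ennreal ((f (p + w) - f p)\<^sup>2) \<le> ennreal ?M * 1" using ennreal_leI[OF sq[of p]] by simp
        also have "\<dots> \<le> ennreal ?M * (indicator ?\<Omega> p + indicator ?\<Omega> (p + w))"
          using True by (intro mult_left_mono) (auto simp: indicator_def)
        finally show ?thesis .
      next
        case False
        then show ?thesis using Cc_inf_chain(2)[OF f] by simp
      qed
    qed
    also have "\<dots> = ennreal ?M * (ennreal m + (\<integral>\<^sup>+p. indicator ?\<Omega> (p + w) \<partial>lborel))"
      by (simp add: nn_integral_cmult nn_integral_add em)
    also have "(\<integral>\<^sup>+p. indicator ?\<Omega> (p + w) \<partial>lborel) = (\<integral>\<^sup>+p. indicator ?\<Omega> p \<partial>lborel)"
      by (rule nn_integral_lborel_shift) measurable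
    also have "ennreal ?M * (ennreal m + (\<integral>\<^sup>+p. indicator ?\<Omega> p \<partial>lborel)) = ennreal (?M * (2 * m))"
      using M0 m0 by (simp add: em ennreal_mult[symmetric] ennreal_plus[symmetric] del: ennreal_plus)
    finally show ?thesis by (simp only: mult_ac)
  qed
  show ?thesis by (rule that[OF _ bound]) (use m0 in auto)
qed

lemma nn_integral_lborel_pair_prod:
  fixes \<phi> \<psi> :: "real \<Rightarrow> ennreal"
  assumes [measurable]: "\<phi> \<in> borel_measurable borel" "\<psi> \<in> borel_measurable borel"
  shows "(\<integral>\<^sup>+w. \<phi> (fst w) * \<psi> (snd w) \<partial>lborel) = (\<integral>\<^sup>+x. \<phi> x \<partial>lborel) * (\<integral>\<^sup>+y. \<psi> y \<partial>lborel)"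
proof -
  have "(\<integral>\<^sup>+w. \<phi> (fst w) * \<psi> (snd w) \<partial>lborel) = (\<integral>\<^sup>+w. \<phi> (fst w) * \<psi> (snd w) \<partial>(lborel \<Otimes>\<^sub>M lborel))"
    by (simp only: lborel_prod)
  also have "\<dots> = (\<integral>\<^sup>+x. \<integral>\<^sup>+y. \<phi> x * \<psi> y \<partial>lborel \<partial>lborel)"
    by (subst lborel.nn_integral_fst[symmetric]) simp_all
  also have "\<dots> = (\<integral>\<^sup>+x. \<phi> x \<partial>lborel) * (\<integral>\<^sup>+y. \<psi> y \<partial>lborel)"
    by (simp add: nn_integral_cmult nn_integral_multc)
  finally show ?thesis .
qed

lemma nn_integral_min_powr_finite:
  assumes \<alpha>: "0 < \<alpha>" "\<alpha> < 2"
  shows "(\<integral>\<^sup>+w. ennreal (min 1 ((norm w)\<^sup>2) * norm (w :: real \<times> real) powr (- 2 - \<alpha>)) \<partial>lborel) < \<infinity>"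
proof -
  \<comment> \<open>A radial bound by a product of one-dimensional functions replaces polar coordinates; the value
      \<open>\<infinity>\<close> at 0 makes it hold on the axes too.\<close>
  define \<psi> where "\<psi> t = min (t powr (- 1 - \<alpha> / 2)) (t powr (- (\<alpha> / 2)))" for t :: real
  define \<phi> where "\<phi> t = (if t = 0 then \<infinity> else ennreal (\<psi> \<bar>t\<bar>))" for t :: real
  have [measurable]: "\<phi> \<in> borel_measurable borel" unfolding \<phi>_def \<psi>_def by measurable
  have \<psi>_pos: "\<psi> t > 0" if "t > 0" for t using that by (simp add: \<psi>_def)
  have \<psi>_anti: "\<psi> r \<le> \<psi> t" if "0 < t" "t \<le> r" for r t
    unfolding \<psi>_def using that \<alpha> by (intro min.mono powr_mono2') auto
  \<comment> \<open>\<open>\<psi>\<close> is the square root of the radial integrand. As it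
    decreases, one of its two factors can be evaluated at each coordinate instead of at the
    norm.\<close>
  have \<psi>_sq: "min 1 (r\<^sup>2) * r powr (- 2 - \<alpha>) \<le> \<psi> r * \<psi> r" if "r > 0" for r
  proof -
    have a: "r powr (- 1 - \<alpha> / 2) * r powr (- 1 - \<alpha> / 2) = r powr (- 2 - \<alpha>)"
      by (simp add: powr_add[symmetric])
    have b: "r powr (- (\<alpha> / 2)) * r powr (- (\<alpha> / 2)) = r\<^sup>2 * r powr (- 2 - \<alpha>)"
    proof -
      have "r powr (- (\<alpha> / 2)) * r powr (- (\<alpha> / 2)) = r powr (2 + (- 2 - \<alpha>))"
        by (simp add: powr_add[symmetric])
      also have "\<dots> = r powr 2 * r powr (- 2 - \<alpha>)" by (rule powr_add)
      finally show ?thesis using that by simp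
    qed
    have "min 1 (r\<^sup>2) * r powr (- 2 - \<alpha>) \<le> 1 * r powr (- 2 - \<alpha>)"
      "min 1 (r\<^sup>2) * r powr (- 2 - \<alpha>) \<le> r\<^sup>2 * r powr (- 2 - \<alpha>)"
      by (intro mult_right_mono; simp)+
    then show ?thesis using a b unfolding \<psi>_def by (auto simp: min_def)
  qed
  have le: "ennreal (min 1 ((norm w)\<^sup>2) * norm w powr (- 2 - \<alpha>)) \<le> \<phi> (fst w) * \<phi> (snd w)" for w :: "real \<times> real"
  proof -
    obtain x y where w: "w = (x, y)" by fastforce
    consider "x = 0" "y = 0" | "x = 0" "y \<noteq> 0" | "x \<noteq> 0" "y = 0" | "x \<noteq> 0" "y \<noteq> 0" by blast
    then show ?thesis
    proof cases
      case 4
      then have pos: "norm w > 0" by (simp add: w zero_prod_def)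
      have "min 1 ((norm w)\<^sup>2) * norm w powr (- 2 - \<alpha>) \<le> \<psi> (norm w) * \<psi> (norm w)" by (rule \<psi>_sq[OF pos])
      also have "\<dots> \<le> \<psi> \<bar>x\<bar> * \<psi> \<bar>y\<bar>"
        using 4 norm_fst_le[of x y] norm_snd_le[of y x] \<psi>_pos[of "norm w"] \<psi>_pos[of "\<bar>x\<bar>"] pos
        by (intro mult_mono \<psi>_anti) (auto simp: w)
      finally show ?thesis
        using 4 \<psi>_pos[of "\<bar>x\<bar>"] \<psi>_pos[of "\<bar>y\<bar>"] by (simp add: w \<phi>_def ennreal_mult[symmetric] ennreal_leI)
    qed (use \<psi>_pos[of "\<bar>x\<bar>"] \<psi>_pos[of "\<bar>y\<bar>"] in \<open>auto simp: w \<phi>_def ennreal_top_mult ennreal_mult_top\<close>)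
  qed
  \<comment> \<open>An integrable majorant of \<open>\<psi>\<close> on the positive half-line: the
    first summand is \<open>t powr (- (\<alpha> / 2))\<close> near 0, integrable as \<alpha> < 2,
    and the second is the tail, integrable as \<alpha> > 0.\<close>
  define k where "k t = ennreal (riesz_kernel (1 + \<alpha> / 2) 1 t) + ennreal (indicator {1..} t * t powr (- 1 - \<alpha> / 2))" for t
  have [measurable]: "k \<in> borel_measurable borel" unfolding k_def by measurable
  have "(\<integral>\<^sup>+t. ennreal (riesz_kernel (1 + \<alpha> / 2) 1 t) \<partial>lborel) < \<infinity>"
    using riesz_kernel_integrable[of "1 + \<alpha> / 2" 1] \<alpha> by (simp add: integrable_iff_bounded riesz_kernel_nonneg abs_of_nonneg)
  moreover have "(\<integral>\<^sup>+t. ennreal (indicator {1..} t * t powr (- 1 - \<alpha> / 2)) \<partial>lborel) < \<infinity>"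
    using \<alpha> by (simp add: nn_integral_powr_tail)
  ultimately have kfin: "(\<integral>\<^sup>+t. k t \<partial>lborel) < \<infinity>"
    unfolding k_def by (subst nn_integral_add) auto
  have "(\<integral>\<^sup>+t. \<phi> t \<partial>lborel) \<le> (\<integral>\<^sup>+t. k t + k (- t) \<partial>lborel)"
  proof (rule nn_integral_mono_AE)
    have pos: "ennreal (\<psi> t) \<le> k t" if "t > 0" for t
    proof (cases "t \<le> 1")
      case True
      then have "\<psi> t \<le> riesz_kernel (1 + \<alpha> / 2) 1 t" using that by (simp add: \<psi>_def riesz_kernel_def)
      then show ?thesis unfolding k_def by (meson add_increasing2 ennreal_leI zero_le order_trans)
    next
      case False
      then have "\<psi> t \<le> indicator {1..} t * t powr (- 1 - \<alpha> / 2)" using that by (simp add: \<psi>_def)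
      then show ?thesis unfolding k_def by (meson add_increasing ennreal_leI zero_le order_trans)
    qed
    \<comment> \<open>Only almost everywhere: at 0 the left side is infinite by definition.\<close>
    show "AE t in lborel. \<phi> t \<le> k t + k (- t)"
      using AE_lborel_singleton[of "0 :: real"]
    proof eventually_elim
      case (elim t)
      then consider "t > 0" | "t < 0" by linarith
      then show ?case
      proof cases
        case 1
        with pos[of t] have "\<phi> t \<le> k t" by (simp add: \<phi>_def)
        then show ?thesis by (simp add: add_increasing2)
      next
        case 2
        with pos[of "- t"] have "\<phi> t \<le> k (- t)" by (simp add: \<phi>_def)
        then show ?thesis by (simp add: add_increasing)
      qed
    qed
  qed
  also have "\<dots> = (\<integral>\<^sup>+t. k t \<partial>lborel) + (\<integral>\<^sup>+t. k (- t) \<partial>lborel)" by (rule nn_integral_add) measurable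
  also have "(\<integral>\<^sup>+t. k (- t) \<partial>lborel) = (\<integral>\<^sup>+t. k t \<partial>lborel)" by (rule nn_integral_lborel_uminus) measurable
  also have "(\<integral>\<^sup>+t. k t \<partial>lborel) + (\<integral>\<^sup>+t. k t \<partial>lborel) < \<infinity>" using kfin by simp
  finally have \<phi>fin: "(\<integral>\<^sup>+t. \<phi> t \<partial>lborel) < \<infinity>" .
  have "(\<integral>\<^sup>+w. ennreal (min 1 ((norm w)\<^sup>2) * norm (w :: real \<times> real) powr (- 2 - \<alpha>)) \<partial>lborel)
    \<le> (\<integral>\<^sup>+w. \<phi> (fst w) * \<phi> (snd w) \<partial>lborel)"
    by (intro nn_integral_mono le)
  also have "\<dots> = (\<integral>\<^sup>+t. \<phi> t \<partial>lborel) * (\<integral>\<^sup>+t. \<phi> t \<partial>lborel)"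
    by (rule nn_integral_lborel_pair_prod) measurable
  also have "\<dots> < \<infinity>" using \<phi>fin by (simp add: ennreal_mult_less_top)
  finally show ?thesis .
qed

text \<open>Without this the Bochner integral in \<open>Hs_semi2\<close> could be the junk value 0.\<close>

lemma gagliardo_finite:
  assumes f: "f \<in> Cc_inf (Omega a b c d)" and \<alpha>: "0 < \<alpha>" "\<alpha> < 2"
  shows "gagliardo \<alpha> f < \<infinity>"
proof -
  obtain K where K: "K \<ge> 0" "\<And>w. diff2 f w \<le> ennreal (K * min 1 ((norm w)\<^sup>2))" using diff2_le_min[OF f] by metis
  have "gagliardo \<alpha> f \<le> (\<integral>\<^sup>+w. ennreal K * ennreal (min 1 ((norm w)\<^sup>2) * norm (w :: real \<times> real) powr (- 2 - \<alpha>)) \<partial>lborel)"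
    unfolding gagliardo_def
  proof (rule nn_integral_mono)
    fix w
    have "diff2 f w * ennreal (norm w powr (- 2 - \<alpha>)) \<le> ennreal (K * min 1 ((norm w)\<^sup>2)) * ennreal (norm w powr (- 2 - \<alpha>))"
      by (intro mult_right_mono K) simp
    then show "diff2 f w * ennreal (norm w powr (- 2 - \<alpha>)) \<le> ennreal K * ennreal (min 1 ((norm w)\<^sup>2) * norm w powr (- 2 - \<alpha>))"
      using K(1) by (simp add: ennreal_mult mult.assoc)
  qed
  also have "\<dots> = ennreal K * (\<integral>\<^sup>+w. ennreal (min 1 ((norm w)\<^sup>2) * norm (w :: real \<times> real) powr (- 2 - \<alpha>)) \<partial>lborel)"
    by (rule nn_integral_cmult) measurable
  also have "\<dots> < \<infinity>" using nn_integral_min_powr_finite[OF \<alpha>] by (simp add: ennreal_mult_less_top)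
  finally show ?thesis .
qed

lemma Hs_semi2_nonneg: "Hs_semi2 \<alpha> f \<ge> 0"
  by (simp add: Hs_semi2_def)

lemma Hs_semi2_eq_gagliardo:
  assumes f: "f \<in> Cc_inf (Omega a b c d)" and \<alpha>: "0 < \<alpha>" "\<alpha> < 2"
  shows "ennreal (Hs_semi2 \<alpha> f) = gagliardo \<alpha> f"
proof -
  note [measurable] = Cc_inf_chain(1)[OF f]
  let ?F = "\<lambda>pq :: (real \<times> real) \<times> (real \<times> real). (f (fst pq) - f (snd pq))\<^sup>2 / (dist (fst pq) (snd pq)) powr (2 + \<alpha>)"
  have "?F \<in> borel_measurable (lborel \<Otimes>\<^sub>M lborel)" by measurable
  then have m: "?F \<in> borel_measurable lborel" by (simp only: lborel_prod)
  note eq = nn_integral_Gagliardo[OF Cc_inf_chain(1)[OF f], of \<alpha>]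
  have "integrable lborel ?F"
    using m eq gagliardo_finite[OF f \<alpha>] by (intro integrableI_nonneg) auto
  then have "(\<integral>\<^sup>+pq. ennreal (?F pq) \<partial>lborel) = ennreal (\<integral>pq. ?F pq \<partial>lborel)"
    by (rule nn_integral_eq_integral) auto
  with eq \<alpha> show ?thesis by (simp add: Hs_semi2_def)
qed

text \<open>In both directions the seminorm controls the directional energy: for \<alpha> < 2 by
  averaging over shifts, with the swap invariance of \<open>gagliardo\<close> for y, and for
  \<open>\<alpha> = 2\<close> because each partial derivative is one summand of the Dirichlet
  integral. The 1 in \<open>C\<close> accounts for the L2 part.\<close>

lemma xenergy_le_Hs:
  assumes \<alpha>: "1 < \<alpha>" "\<alpha> \<le> 2"
  obtains C where "C \<ge> 0"
    and "\<And>f a b c d. f \<in> Cc_inf (Omega a b c d) \<Longrightarrow>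
      xenergy \<alpha> (\<lambda>n. dx n f) \<le> ennreal (C * (Hs_semi2 \<alpha> f + (\<integral>p. (f p)\<^sup>2 \<partial>lborel)))"
    and "\<And>f a b c d. f \<in> Cc_inf (Omega a b c d) \<Longrightarrow>
      xenergy \<alpha> (\<lambda>n. dy n f) \<le> ennreal (C * (Hs_semi2 \<alpha> f + (\<integral>p. (f p)\<^sup>2 \<partial>lborel)))"
proof -
  define C where "C = 1 + 2 * 2 powr (2 + \<alpha>)"
  have C: "C \<ge> 1" by (simp add: C_def)
  have L2: "(\<integral>\<^sup>+p. ennreal ((f p)\<^sup>2) \<partial>lborel) = ennreal (\<integral>p. (f p)\<^sup>2 \<partial>lborel)"
    "(\<integral>\<^sup>+p. ennreal ((f (prod.swap p))\<^sup>2) \<partial>lborel) = ennreal (\<integral>p. (f p)\<^sup>2 \<partial>lborel)"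
    if f: "f \<in> Cc_inf (Omega a b c d)" for f a b c d
  proof -
    note [measurable] = Cc_inf_chain(1)[OF f]
    show 1: "(\<integral>\<^sup>+p. ennreal ((f p)\<^sup>2) \<partial>lborel) = ennreal (\<integral>p. (f p)\<^sup>2 \<partial>lborel)"
      using Cc_inf_chain(3)[OF f] by (rule nn_integral_eq_integral) auto
    have "(\<integral>\<^sup>+p. ennreal ((f (prod.swap p))\<^sup>2) \<partial>lborel) = (\<integral>\<^sup>+p. ennreal ((f p)\<^sup>2) \<partial>lborel)"
      by (rule nn_integral_lborel_swap) measurable
    with 1 show "(\<integral>\<^sup>+p. ennreal ((f (prod.swap p))\<^sup>2) \<partial>lborel) = ennreal (\<integral>p. (f p)\<^sup>2 \<partial>lborel)" by simp
  qed
  have comb: "ennreal l + X \<le> ennreal (C * (h + l))" if "X \<le> ennreal ((C - 1) * h) \<or> X \<le> ennreal h" "h \<ge> 0" "l \<ge> 0" for l h X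
  proof -
    have "X \<le> ennreal (C * h)"
    proof -
      have "(C - 1) * h \<le> C * h" "h \<le> C * h" using C that(2) by (simp_all add: mult_le_cancel_right1 algebra_simps)
      with that(1) show ?thesis by (meson ennreal_leI order_trans)
    qed
    moreover have "ennreal l \<le> ennreal (C * l)" using C that(3) by (intro ennreal_leI) (simp add: mult_le_cancel_right1)
    ultimately have "ennreal l + X \<le> ennreal (C * l) + ennreal (C * h)" by (intro add_mono)
    also have "\<dots> = ennreal (C * (h + l))" using C that by (simp add: ennreal_plus[symmetric] algebra_simps del: ennreal_plus)
    finally show ?thesis .
  qed
  show ?thesis
  proof (cases "\<alpha> = 2")
    case True
    have p: "(\<integral>\<^sup>+p. ennreal ((dx 1 f p)\<^sup>2) \<partial>lborel) \<le> ennreal (Hs_semi2 2 f) \<and> (\<integral>\<^sup>+p. ennreal ((dy 1 f p)\<^sup>2) \<partial>lborel) \<le> ennreal (Hs_semi2 2 f)"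
      if f: "f \<in> Cc_inf (Omega a b c d)" for f a b c d
    proof -
      have px: "dx 1 f = px f" and py: "dy 1 f = py f \<circ> prod.swap" by (simp_all add: dx_def dy_def iter_partial_Cons)
      have i1: "integrable lborel (\<lambda>p. (px f p)\<^sup>2)"
        using x_chain_integrable_square[OF x_chain_dx[OF f], of 1] unfolding px .
      have i2: "integrable lborel (\<lambda>p. (dy 1 f p)\<^sup>2)"
        using x_chain_integrable_square[OF x_chain_dy[OF f], of 1] by simp
      \<comment> \<open>Measurability and square integrability of \<open>py f\<close> are carried
        over from the swapped chain; they ensure that the Bochner integral in
        \<open>Hs_semi2\<close> is not the default value 0.\<close>
      have sw: "py f = dy 1 f \<circ> prod.swap" by (rule ext) (simp only: py o_apply swap_swap)
      have swm: "(prod.swap :: real \<times> real \<Rightarrow> _) \<in> borel_measurable borel"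
        by (intro borel_measurable_continuous_onI continuous_on_swap)
      have [measurable]: "dy 1 f \<in> borel_measurable borel" by (rule x_chain_measurable[OF x_chain_dy[OF f]])
      have [measurable]: "py f \<in> borel_measurable borel"
        unfolding sw comp_def by (rule measurable_compose[OF swm]) measurable
      have eq: "(\<integral>\<^sup>+p. ennreal ((py f p)\<^sup>2) \<partial>lborel) = (\<integral>\<^sup>+p. ennreal ((dy 1 f p)\<^sup>2) \<partial>lborel)"
        unfolding py comp_def by (rule nn_integral_lborel_swap[symmetric]) measurable
      have i3: "integrable lborel (\<lambda>p. (py f p)\<^sup>2)"
        using i2 eq by (simp add: integrable_iff_bounded)
      have H: "ennreal (Hs_semi2 2 f) = (\<integral>\<^sup>+p. ennreal ((px f p)\<^sup>2 + (py f p)\<^sup>2) \<partial>lborel)"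
        unfolding Hs_semi2_def using i1 i3 by (simp only: if_True refl) (intro nn_integral_eq_integral[symmetric], auto)
      show ?thesis unfolding H eq[symmetric] unfolding px by (intro conjI nn_integral_mono ennreal_leI) auto
    qed
    show ?thesis
    proof (rule that[of C])
      fix f a b c d assume f: "f \<in> Cc_inf (Omega a b c d)"
      show "xenergy \<alpha> (\<lambda>n. dx n f) \<le> ennreal (C * (Hs_semi2 \<alpha> f + (\<integral>p. (f p)\<^sup>2 \<partial>lborel)))"
        unfolding xenergy_def dx_0 L2(1)[OF f] using p[OF f] True by (intro comb) (auto simp: Hs_semi2_nonneg)
      show "xenergy \<alpha> (\<lambda>n. dy n f) \<le> ennreal (C * (Hs_semi2 \<alpha> f + (\<integral>p. (f p)\<^sup>2 \<partial>lborel)))"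
        unfolding xenergy_def dy_0 comp_def L2(2)[OF f] using p[OF f] True by (intro comb) (auto simp: Hs_semi2_nonneg)
    qed (use C in simp)
  next
    case False
    then have lt: "0 < \<alpha>" "\<alpha> < 2" using \<alpha> by auto
    have p: "(\<integral>\<^sup>+h. ennreal (indicator {0<..} h * h powr (- 1 - \<alpha>)) * (\<integral>\<^sup>+p. ennreal ((g (p + (h, 0)) - g p)\<^sup>2) \<partial>lborel) \<partial>lborel)
      \<le> ennreal ((C - 1) * Hs_semi2 \<alpha> f)"
      if f: "f \<in> Cc_inf (Omega a b c d)" and g: "g = f \<or> g = f \<circ> prod.swap" for f g a b c d
    proof -
      note fm = Cc_inf_chain(1)[OF f]
      have swm: "(prod.swap :: real \<times> real \<Rightarrow> _) \<in> borel_measurable borel"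
        by (intro borel_measurable_continuous_onI continuous_on_swap)
      have gm: "g \<in> borel_measurable borel"
        using g fm measurable_compose[OF swm fm] by (auto simp: comp_def)
      have "gagliardo \<alpha> g = gagliardo \<alpha> f" using g gagliardo_swap[OF fm] by auto
      with directional_le_gagliardo[OF gm \<alpha>(1)] show ?thesis
        by (simp add: diff2_def Hs_semi2_eq_gagliardo[OF f lt, symmetric] C_def ennreal_mult Hs_semi2_nonneg)
    qed
    show ?thesis
    proof (rule that[of C])
      fix f a b c d assume f: "f \<in> Cc_inf (Omega a b c d)"
      show "xenergy \<alpha> (\<lambda>n. dx n f) \<le> ennreal (C * (Hs_semi2 \<alpha> f + (\<integral>p. (f p)\<^sup>2 \<partial>lborel)))"
        unfolding xenergy_def dx_0 L2(1)[OF f] using p[OF f] False by (intro comb) (auto simp: Hs_semi2_nonneg)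
      show "xenergy \<alpha> (\<lambda>n. dy n f) \<le> ennreal (C * (Hs_semi2 \<alpha> f + (\<integral>p. (f p)\<^sup>2 \<partial>lborel)))"
        unfolding xenergy_def dy_0 using p[OF f, of "f \<circ> prod.swap"] L2(2)[OF f] False
        by (intro comb[of _ "Hs_semi2 \<alpha> f" "\<integral>p. (f p)\<^sup>2 \<partial>lborel", THEN order_trans[rotated]])
           (auto simp: Hs_semi2_nonneg comp_def)
    qed (use C in simp)
  qed
qed

section \<open>The L4 embedding\<close>

text \<open>The double integral dominates the derivative in \<open>\<rho>\<close> of the mean of \<open>f\<close> over \<open>{0..\<rho>}\<close>.\<close>

lemma average_bound:
  fixes f :: "real \<Rightarrow> real"
  assumes f: "continuous_on UNIV f"
  shows "ennreal \<bar>f 0\<bar> \<le> (\<integral>\<^sup>+t. ennreal (indicator {0..1} t * \<bar>f t\<bar>) \<partial>lborel)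
    + (\<integral>\<^sup>+\<rho>. \<integral>\<^sup>+t. ennreal (indicator {0<..1} \<rho> * indicator {0..\<rho>} t * (\<bar>f \<rho> - f t\<bar> / \<rho>\<^sup>2)) \<partial>lborel \<partial>lborel)"
    (is "_ \<le> ?P + ?Q")
proof -
  define I where "I \<rho> = integral {0..\<rho>} f" for \<rho>
  define F where "F \<rho> = I \<rho> / \<rho>" for \<rho>
  define F1 where "F1 \<rho> = (\<rho> * f \<rho> - I \<rho>) / \<rho>\<^sup>2" for \<rho>
  have fsub: "continuous_on S f" for S using f continuous_on_subset by blast
  have fc: "isCont f t" for t using f by (simp add: continuous_on_eq_continuous_at)
  have dI: "(I has_real_derivative f \<rho>) (at \<rho>)" if "\<rho> > 0" for \<rho>
  proof -
    have "((\<lambda>u. integral {0..u} f) has_real_derivative f \<rho>) (at \<rho> within {0..\<rho> + 1})"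
      using that by (intro integral_has_real_derivative fsub) auto
    then have "((\<lambda>u. integral {0..u} f) has_real_derivative f \<rho>) (at \<rho>)"
      using that by (subst (asm) at_within_interior) (auto simp: interior_atLeastAtMost_real)
    then show ?thesis by (simp add: I_def[abs_def])
  qed
  have dF: "(F has_real_derivative F1 \<rho>) (at \<rho>)" if "\<rho> > 0" for \<rho>
    using that dI[OF that] unfolding F_def[abs_def] F1_def
    by (auto intro!: derivative_eq_intros simp: field_simps power2_eq_square)
  have F1c: "isCont F1 \<rho>" if "\<rho> > 0" for \<rho>
    unfolding F1_def using that DERIV_isCont[OF dI[OF that]] fc by (intro continuous_intros) auto
  have fi: "set_integrable lborel {0..\<rho>} g" if "continuous_on UNIV g" for g :: "real \<Rightarrow> real" and \<rho>
    by (intro borel_integrable_atLeastAtMost' continuous_on_subset[OF that]) simp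
  have F1_le: "ennreal \<bar>F1 \<rho>\<bar> \<le> (\<integral>\<^sup>+t. ennreal (indicator {0..\<rho>} t * (\<bar>f \<rho> - f t\<bar> / \<rho>\<^sup>2)) \<partial>lborel)" if "\<rho> > 0" for \<rho>
  proof -
    let ?g = "\<lambda>t. (f \<rho> - f t) / \<rho>\<^sup>2"
    have gi: "set_integrable lborel {0..\<rho>} ?g" by (intro fi continuous_intros f) (use that in auto)
    have "integral {0..\<rho>} ?g = (integral {0..\<rho>} (\<lambda>t. f \<rho>) - integral {0..\<rho>} f) / \<rho>\<^sup>2"
      by (subst Henstock_Kurzweil_Integration.integral_diff[symmetric])
        (auto intro: integrable_continuous_interval fsub simp: integral_divide)
    then have "F1 \<rho> = integral {0..\<rho>} ?g" using that by (simp add: F1_def I_def mult.commute)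
    also have "\<dots> = (\<integral>t. indicator {0..\<rho>} t * ?g t \<partial>lborel)"
      using set_borel_integral_eq_integral(2)[OF gi, symmetric]
      by (simp only: set_lebesgue_integral_def real_scaleR_def)
    finally have "ennreal \<bar>F1 \<rho>\<bar> = ennreal (norm (\<integral>t. indicator {0..\<rho>} t * ?g t \<partial>lborel))" by simp
    also have "\<dots> \<le> (\<integral>\<^sup>+t. ennreal (norm (indicator {0..\<rho>} t * ?g t)) \<partial>lborel)"
      using gi by (intro integral_norm_bound_ennreal) (simp add: set_integrable_def)
    also have "\<dots> = (\<integral>\<^sup>+t. ennreal (indicator {0..\<rho>} t * (\<bar>f \<rho> - f t\<bar> / \<rho>\<^sup>2)) \<partial>lborel)"
      by (intro nn_integral_cong) (simp add: abs_mult)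
    finally show ?thesis .
  qed
  have F_1: "ennreal \<bar>F 1\<bar> \<le> ?P"
  proof -
    have "F 1 = (\<integral>t. indicator {0..1} t * f t \<partial>lborel)"
      using set_borel_integral_eq_integral(2)[OF fi[OF f, of 1]] by (simp add: F_def I_def set_lebesgue_integral_def)
    then have "ennreal \<bar>F 1\<bar> = ennreal (norm (\<integral>t. indicator {0..1} t * f t \<partial>lborel))" by simp
    also have "\<dots> \<le> (\<integral>\<^sup>+t. ennreal (norm (indicator {0..1} t * f t)) \<partial>lborel)"
      using fi[OF f, of 1] by (intro integral_norm_bound_ennreal) (simp add: set_integrable_def)
    also have "\<dots> = ?P" by (intro nn_integral_cong) (simp add: abs_mult)
    finally show ?thesis .
  qed
  have F_e: "ennreal \<bar>F \<epsilon>\<bar> \<le> ?P + ?Q" if e: "0 < \<epsilon>" "\<epsilon> < 1" for \<epsilon>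
  proof -
    have "has_bochner_integral lborel (\<lambda>x. F1 x * indicator {\<epsilon>..1} x) (F 1 - F \<epsilon>)"
      using e dF F1c by (intro has_bochner_integral_FTC_Icc_real) auto
    then have i: "integrable lborel (\<lambda>x. F1 x * indicator {\<epsilon>..1} x)" "(\<integral>x. F1 x * indicator {\<epsilon>..1} x \<partial>lborel) = F 1 - F \<epsilon>"
      by (auto simp: has_bochner_integral_iff)
    have "ennreal \<bar>F 1 - F \<epsilon>\<bar> \<le> (\<integral>\<^sup>+\<rho>. ennreal (norm (F1 \<rho> * indicator {\<epsilon>..1} \<rho>)) \<partial>lborel)"
      using integral_norm_bound_ennreal[OF i(1)] unfolding i(2) by simp
    also have "\<dots> \<le> ?Q"
    proof (rule nn_integral_mono)
      fix \<rho> :: real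
      show "ennreal (norm (F1 \<rho> * indicator {\<epsilon>..1} \<rho>))
        \<le> (\<integral>\<^sup>+t. ennreal (indicator {0<..1} \<rho> * indicator {0..\<rho>} t * (\<bar>f \<rho> - f t\<bar> / \<rho>\<^sup>2)) \<partial>lborel)"
        using F1_le[of \<rho>] e by (cases "\<rho> \<in> {\<epsilon>..1}") auto
    qed
    finally have "ennreal \<bar>F 1 - F \<epsilon>\<bar> \<le> ?Q" .
    have "ennreal \<bar>F \<epsilon>\<bar> \<le> ennreal (\<bar>F 1\<bar> + \<bar>F 1 - F \<epsilon>\<bar>)" by (intro ennreal_leI) linarith
    also have "\<dots> = ennreal \<bar>F 1\<bar> + ennreal \<bar>F 1 - F \<epsilon>\<bar>" by simp
    also have "\<dots> \<le> ?P + ?Q" by (intro add_mono F_1) fact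
    finally show ?thesis .
  qed
  \<comment> \<open>The bound on \<open>F \<epsilon>\<close> does not depend on \<epsilon>, and the
    means converge to \<open>f 0\<close>, as this is the right derivative of \<open>I\<close> at
    0.\<close>
  have "(I has_real_derivative f 0) (at 0 within {0..1})"
    unfolding I_def[abs_def] by (intro integral_has_real_derivative fsub) auto
  then have "((\<lambda>\<rho>. (I \<rho> - I 0) / (\<rho> - 0)) \<longlongrightarrow> f 0) (at 0 within {0..1})"
    by (simp only: has_field_derivative_iff)
  moreover have "I 0 = 0" by (simp add: I_def)
  ultimately have "(F \<longlongrightarrow> f 0) (at 0 within {0..1})" by (simp add: F_def[abs_def])
  then have lim: "((\<lambda>\<rho>. ennreal \<bar>F \<rho>\<bar>) \<longlongrightarrow> ennreal \<bar>f 0\<bar>) (at 0 within {0..1})"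
    by (intro tendsto_ennrealI tendsto_rabs)
  show ?thesis
  proof (rule tendsto_upperbound[OF lim])
    show "\<forall>\<^sub>F \<rho> in at 0 within {0..1}. ennreal \<bar>F \<rho>\<bar> \<le> ?P + ?Q"
      unfolding eventually_at
    proof (intro exI[of _ 1] conjI ballI impI)
      fix \<rho> :: real assume "\<rho> \<in> {0..1}" "\<rho> \<noteq> 0 \<and> dist \<rho> 0 < 1"
      then show "ennreal \<bar>F \<rho>\<bar> \<le> ?P + ?Q" by (intro F_e) auto
    qed simp
    show "at (0::real) within {0..1} \<noteq> bot"
      using islimpt_Icc[of 0 1 "0::real"] by (simp add: trivial_limit_within)
  qed
qed

lemma ennreal_sum_square_le:
  fixes x y :: ennreal
  shows "(x + y)\<^sup>2 \<le> 2 * x\<^sup>2 + 2 * y\<^sup>2"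
proof (cases "x = \<infinity> \<or> y = \<infinity>")
  case True
  then show ?thesis by (auto simp: power2_eq_square ennreal_mult_top ennreal_top_mult)
next
  case False
  then obtain a b where ab: "x = ennreal a" "y = ennreal b" "a \<ge> 0" "b \<ge> 0"
    by (metis ennreal_cases infinity_ennreal_def)
  have "(a + b)\<^sup>2 \<le> 2 * a\<^sup>2 + 2 * b\<^sup>2"
    using sum_squares_bound[of a b] by (simp add: power2_sum)
  then have "ennreal ((a + b)\<^sup>2) \<le> ennreal (2 * a\<^sup>2 + 2 * b\<^sup>2)" by (rule ennreal_leI)
  with ab show ?thesis by (simp add: ennreal_power[symmetric] ennreal_mult)
qed

text \<open>\<open>average_bound\<close> leaves the integral of
  \<open>\<bar>f \<rho> - f t\<bar> / \<rho>\<^sup>2\<close> over a triangle. Cauchy--Schwarz,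
  weighted by a power of \<open>\<rho> - t\<close>, separates from it the energy and an integral
  bounded by that of \<open>\<rho> powr (\<alpha> - 2)\<close> over \<open>{0<..1}\<close>, which is
  \<open>1 / (\<alpha> - 1)\<close>: here \<alpha> > 1 enters.\<close>

lemma sobolev_1d_fractional:
  fixes f :: "real \<Rightarrow> real"
  assumes f: "continuous_on UNIV f" and \<alpha>: "1 < \<alpha>"
  shows "ennreal ((f 0)\<^sup>2) \<le> 2 * (\<integral>\<^sup>+t. ennreal ((f t)\<^sup>2) \<partial>lborel)
    + ennreal (2 / (\<alpha> - 1)) * (\<integral>\<^sup>+h. ennreal (indicator {0<..} h * h powr (- 1 - \<alpha>))
        * (\<integral>\<^sup>+t. ennreal ((f (t + h) - f t)\<^sup>2) \<partial>lborel) \<partial>lborel)"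
proof -
  have fm [measurable]: "f \<in> borel_measurable borel" by (rule borel_measurable_continuous_onI[OF f])
  let ?P = "\<integral>\<^sup>+t. ennreal (indicator {0..1} t * \<bar>f t\<bar>) \<partial>lborel"
  let ?Q = "\<integral>\<^sup>+\<rho>. \<integral>\<^sup>+t. ennreal (indicator {0<..1} \<rho> * indicator {0..\<rho>} t * (\<bar>f \<rho> - f t\<bar> / \<rho>\<^sup>2)) \<partial>lborel \<partial>lborel"
  let ?S = "\<integral>\<^sup>+h. ennreal (indicator {0<..} h * h powr (- 1 - \<alpha>))
        * (\<integral>\<^sup>+t. ennreal ((f (t + h) - f t)\<^sup>2) \<partial>lborel) \<partial>lborel"
  have "?P\<^sup>2 = (\<integral>\<^sup>+t. indicator {0..1} t * ennreal \<bar>f t\<bar> \<partial>lborel)\<^sup>2"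
    by (intro arg_cong[where f="\<lambda>x. x\<^sup>2"] nn_integral_cong) (auto simp: indicator_def)
  also have "\<dots> \<le> (\<integral>\<^sup>+t. (indicator {0..1::real} t)\<^sup>2 \<partial>lborel) * (\<integral>\<^sup>+t. (ennreal \<bar>f t\<bar>)\<^sup>2 \<partial>lborel)"
    by (rule Cauchy_Schwarz_nn_integral) measurable
  also have "(\<integral>\<^sup>+t. (indicator {0..1::real} t :: ennreal)\<^sup>2 \<partial>lborel) = (\<integral>\<^sup>+t. indicator {0..1::real} t \<partial>lborel)"
    by (intro nn_integral_cong) (auto simp: indicator_def)
  also have "\<dots> = 1" by simp
  also have "(\<integral>\<^sup>+t. (ennreal \<bar>f t\<bar>)\<^sup>2 \<partial>lborel) = (\<integral>\<^sup>+t. ennreal ((f t)\<^sup>2) \<partial>lborel)"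
    by (simp add: ennreal_power)
  finally have P: "?P\<^sup>2 \<le> (\<integral>\<^sup>+t. ennreal ((f t)\<^sup>2) \<partial>lborel)" by simp
  \<comment> \<open>The exponent is half of the \<open>1 + \<alpha>\<close> in the energy, so that
    the square of \<open>?b\<close> is the energy integrand at the shift
    \<open>\<rho> - t\<close>.\<close>
  let ?a = "\<lambda>\<rho> t. ennreal (indicator {0<..1} \<rho> * indicator {0..\<rho>} t * ((\<rho> - t) powr ((1 + \<alpha>) / 2) / \<rho>\<^sup>2))"
  let ?b = "\<lambda>\<rho> t. ennreal (indicator {0<..} (\<rho> - t) * ((\<rho> - t) powr (- ((1 + \<alpha>) / 2)) * \<bar>f \<rho> - f t\<bar>))"
  have [measurable]: "(\<lambda>q :: real \<times> real. indicator {0..fst q} (snd q) :: real) \<in> borel_measurable (borel \<Otimes>\<^sub>M borel)"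
    unfolding indicator_def atLeastAtMost_iff by measurable
  have [measurable]: "(\<lambda>q. ?a (fst q) (snd q)) \<in> borel_measurable (lborel \<Otimes>\<^sub>M lborel)"
    "(\<lambda>q. ?b (fst q) (snd q)) \<in> borel_measurable (lborel \<Otimes>\<^sub>M lborel)"
    by measurable
  have ab: "ennreal (indicator {0<..1} \<rho> * indicator {0..\<rho>} t * (\<bar>f \<rho> - f t\<bar> / \<rho>\<^sup>2)) = ?a \<rho> t * ?b \<rho> t" for \<rho> t
  proof (cases "\<rho> \<in> {0<..1} \<and> t \<in> {0..\<rho>} \<and> t \<noteq> \<rho>")
    case True
    then have "(\<rho> - t) powr ((1 + \<alpha>) / 2) * (\<rho> - t) powr (- ((1 + \<alpha>) / 2)) = 1"
      by (simp add: powr_add[symmetric])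
    then have "(\<rho> - t) powr ((1 + \<alpha>) / 2) / \<rho>\<^sup>2 * ((\<rho> - t) powr (- ((1 + \<alpha>) / 2)) * \<bar>f \<rho> - f t\<bar>) = \<bar>f \<rho> - f t\<bar> / \<rho>\<^sup>2"
      by (simp add: mult.assoc[symmetric])
    with True show ?thesis by (subst ennreal_mult[symmetric]) auto
  qed (auto simp: indicator_def)
  have "?Q = (\<integral>\<^sup>+q. ?a (fst q) (snd q) * ?b (fst q) (snd q) \<partial>(lborel \<Otimes>\<^sub>M lborel))"
    unfolding ab by (subst lborel.nn_integral_fst[symmetric]) simp_all
  then have "?Q\<^sup>2 \<le> (\<integral>\<^sup>+q. (?a (fst q) (snd q))\<^sup>2 \<partial>(lborel \<Otimes>\<^sub>M lborel)) * (\<integral>\<^sup>+q. (?b (fst q) (snd q))\<^sup>2 \<partial>(lborel \<Otimes>\<^sub>M lborel))"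
    by (simp only:) (rule Cauchy_Schwarz_nn_integral; measurable)
  also have "\<dots> \<le> ennreal (1 / (\<alpha> - 1)) * ?S"
  proof (rule mult_mono)
    have "(\<integral>\<^sup>+q. (?a (fst q) (snd q))\<^sup>2 \<partial>(lborel \<Otimes>\<^sub>M lborel)) = (\<integral>\<^sup>+\<rho>. \<integral>\<^sup>+t. (?a \<rho> t)\<^sup>2 \<partial>lborel \<partial>lborel)"
      by (subst lborel.nn_integral_fst[symmetric]) simp_all
    also have "\<dots> \<le> (\<integral>\<^sup>+\<rho>. ennreal (riesz_kernel (3 - \<alpha>) 1 \<rho>) \<partial>lborel)"
    proof (rule nn_integral_mono)
      fix \<rho> :: real
      show "(\<integral>\<^sup>+t. (?a \<rho> t)\<^sup>2 \<partial>lborel) \<le> ennreal (riesz_kernel (3 - \<alpha>) 1 \<rho>)"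
      proof (cases "\<rho> \<in> {0<..1}")
        case True
        \<comment> \<open>Replacing \<open>\<rho> - t\<close> by \<open>\<rho>\<close> gives the
          power \<open>(1 + \<alpha>) - 4\<close>. The length of \<open>{0..\<rho>}\<close> adds 1,
          and \<open>\<alpha> - 2\<close> is the exponent in
          \<open>riesz_kernel (3 - \<alpha>)\<close>.\<close>
        have "(\<integral>\<^sup>+t. (?a \<rho> t)\<^sup>2 \<partial>lborel) \<le> (\<integral>\<^sup>+t. ennreal (\<rho> powr (\<alpha> - 3)) * indicator {0..\<rho>} t \<partial>lborel)"
        proof (rule nn_integral_mono)
          fix t :: real
          show "(?a \<rho> t)\<^sup>2 \<le> ennreal (\<rho> powr (\<alpha> - 3)) * indicator {0..\<rho>} t"
          proof (cases "t \<in> {0..\<rho>}")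
            case t: True
            have "((\<rho> - t) powr ((1 + \<alpha>) / 2) / \<rho>\<^sup>2)\<^sup>2 \<le> (\<rho> powr ((1 + \<alpha>) / 2) / \<rho>\<^sup>2)\<^sup>2"
              using t True \<alpha> by (intro power_mono divide_right_mono powr_mono2) auto
            also have "\<dots> = \<rho> powr (\<alpha> - 3)"
            proof -
              have "(\<rho> powr ((1 + \<alpha>) / 2))\<^sup>2 = \<rho> powr (1 + \<alpha>)"
                by (simp add: power2_eq_square powr_add[symmetric])
              moreover have "\<rho> powr ((1 + \<alpha>) - 4) = \<rho> powr (1 + \<alpha>) / \<rho> powr 4" by (rule powr_diff)
              moreover have "(1 + \<alpha>) - 4 = \<alpha> - 3" by simp
              moreover have "(\<rho>\<^sup>2)\<^sup>2 = \<rho> powr 4" using True by (simp add: power_mult[symmetric])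
              ultimately show ?thesis by (simp add: power_divide)
            qed
            finally have "ennreal (((\<rho> - t) powr ((1 + \<alpha>) / 2) / \<rho>\<^sup>2)\<^sup>2) \<le> ennreal (\<rho> powr (\<alpha> - 3))" by (rule ennreal_leI)
            with t True show ?thesis by (simp add: ennreal_power)
          qed simp
        qed
        also have "\<dots> = ennreal (\<rho> powr (\<alpha> - 3)) * ennreal \<rho>"
          using True by (simp add: nn_integral_cmult)
        also have "\<dots> = ennreal (\<rho> powr (\<alpha> - 3) * \<rho>)" using True by (simp add: ennreal_mult)
        also have "\<rho> powr (\<alpha> - 3) * \<rho> = \<rho> powr (1 - (3 - \<alpha>))"
        proof -
          have "\<rho> powr (1 + (\<alpha> - 3)) = \<rho> powr 1 * \<rho> powr (\<alpha> - 3)" by (rule powr_add)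
          then show ?thesis using True by (simp add: algebra_simps)
        qed
        finally show ?thesis using True by (simp add: riesz_kernel_def)
      qed simp
    qed
    also have "\<dots> = ennreal (1 / (\<alpha> - 1))"
    proof (rule nn_integral_has_integral_lborel)
      have "((\<lambda>x. x powr (\<alpha> - 2)) has_integral (1 powr (\<alpha> - 2 + 1) / (\<alpha> - 2 + 1))) {0..1}"
        using \<alpha> by (intro has_integral_powr_from_0) auto
      moreover have "1 powr (\<alpha> - 2 + 1) / (\<alpha> - 2 + 1) = 1 / (\<alpha> - 1)" by simp
      ultimately have "((\<lambda>x. x powr (\<alpha> - 2)) has_integral 1 / (\<alpha> - 1)) {0..1}" by (simp only:)
      moreover have "riesz_kernel (3 - \<alpha>) 1 = (\<lambda>x. if x \<in> {0..1} then x powr (\<alpha> - 2) else 0)"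
        by (auto simp: riesz_kernel_def fun_eq_iff indicator_def)
      ultimately show "(riesz_kernel (3 - \<alpha>) 1 has_integral 1 / (\<alpha> - 1)) UNIV"
        by (simp only: has_integral_restrict_UNIV)
    qed (auto simp: riesz_kernel_nonneg)
    finally show "(\<integral>\<^sup>+q. (?a (fst q) (snd q))\<^sup>2 \<partial>(lborel \<Otimes>\<^sub>M lborel)) \<le> ennreal (1 / (\<alpha> - 1))" .
  next
    let ?c = "\<lambda>h t. ennreal (indicator {0<..} h * h powr (- 1 - \<alpha>)) * ennreal ((f (t + h) - f t)\<^sup>2)"
    have b2: "(?b \<rho> t)\<^sup>2 = ?c (\<rho> - t) t" for \<rho> t
    proof (cases "\<rho> - t > 0")
      case True
      have "((\<rho> - t) powr (- ((1 + \<alpha>) / 2)))\<^sup>2 = (\<rho> - t) powr (- ((1 + \<alpha>) / 2) + - ((1 + \<alpha>) / 2))"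
        by (simp only: power2_eq_square powr_add)
      also have "- ((1 + \<alpha>) / 2) + - ((1 + \<alpha>) / 2) = - 1 - \<alpha>" by (simp add: field_simps)
      finally have "((\<rho> - t) powr (- ((1 + \<alpha>) / 2)))\<^sup>2 = (\<rho> - t) powr (- 1 - \<alpha>)" .
      with True show ?thesis by (simp add: ennreal_power power_mult_distrib ennreal_mult)
    qed simp
    have "(\<integral>\<^sup>+q. (?b (fst q) (snd q))\<^sup>2 \<partial>(lborel \<Otimes>\<^sub>M lborel)) = (\<integral>\<^sup>+t. \<integral>\<^sup>+\<rho>. ?c (\<rho> - t) t \<partial>lborel \<partial>lborel)"
      unfolding b2[symmetric] by (subst lborel_pair.nn_integral_snd[symmetric]) (simp_all add: case_prod_beta')
    also have "\<dots> = (\<integral>\<^sup>+t. \<integral>\<^sup>+h. ?c h t \<partial>lborel \<partial>lborel)"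
    proof (rule nn_integral_cong)
      fix t :: real
      have "(\<integral>\<^sup>+\<rho>. ?c (\<rho> + (- t)) t \<partial>lborel) = (\<integral>\<^sup>+h. ?c h t \<partial>lborel)"
        by (rule nn_integral_lborel_shift) measurable
      then show "(\<integral>\<^sup>+\<rho>. ?c (\<rho> - t) t \<partial>lborel) = (\<integral>\<^sup>+h. ?c h t \<partial>lborel)" by simp
    qed
    also have "\<dots> = (\<integral>\<^sup>+h. \<integral>\<^sup>+t. ?c h t \<partial>lborel \<partial>lborel)"
      by (rule lborel_pair.Fubini') (simp add: case_prod_beta')
    also have "\<dots> = ?S"
      by (intro nn_integral_cong nn_integral_cmult) measurable
    finally show "(\<integral>\<^sup>+q. (?b (fst q) (snd q))\<^sup>2 \<partial>(lborel \<Otimes>\<^sub>M lborel)) \<le> ?S" by simp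
  qed auto
  finally have Q: "?Q\<^sup>2 \<le> ennreal (1 / (\<alpha> - 1)) * ?S" .
  have "ennreal ((f 0)\<^sup>2) = (ennreal \<bar>f 0\<bar>)\<^sup>2" by (simp add: ennreal_power)
  also have "\<dots> \<le> (?P + ?Q)\<^sup>2" by (intro power_mono average_bound f) auto
  also have "\<dots> \<le> 2 * ?P\<^sup>2 + 2 * ?Q\<^sup>2" by (rule ennreal_sum_square_le)
  also have "\<dots> \<le> 2 * (\<integral>\<^sup>+t. ennreal ((f t)\<^sup>2) \<partial>lborel) + 2 * (ennreal (1 / (\<alpha> - 1)) * ?S)"
    by (intro add_mono mult_left_mono P Q) auto
  also have "2 * (ennreal (1 / (\<alpha> - 1)) * ?S) = ennreal (2 / (\<alpha> - 1)) * ?S"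
  proof -
    have "ennreal (2 / (\<alpha> - 1)) = ennreal (2 * (1 / (\<alpha> - 1)))" by simp
    also have "\<dots> = 2 * ennreal (1 / (\<alpha> - 1))" using \<alpha> by (subst ennreal_mult) auto
    finally show ?thesis by (simp add: mult.assoc)
  qed
  finally show ?thesis .
qed

text \<open>\<open>f\<close> vanishes at \<open>a\<close>, so its square at \<open>x\<close> is the
  integral of \<open>2 * f t * f1 t\<close> from \<open>a\<close> to \<open>x\<close>, which is at
  most the sum of both squares' integrals.\<close>

lemma sobolev_1d_derivative:
  fixes f f1 :: "real \<Rightarrow> real"
  assumes d: "\<And>x. (f has_real_derivative f1 x) (at x)" and c: "continuous_on UNIV f1" and z: "\<And>x. x \<le> a \<Longrightarrow> f x = 0"
  shows "ennreal ((f x)\<^sup>2) \<le> (\<integral>\<^sup>+t. ennreal ((f t)\<^sup>2) \<partial>lborel) + (\<integral>\<^sup>+t. ennreal ((f1 t)\<^sup>2) \<partial>lborel)"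
proof (cases "x \<le> a")
  case True
  then show ?thesis by (simp add: z)
next
  case False
  have fc: "isCont f t" for t using d DERIV_isCont by blast
  have f1c: "isCont f1 t" for t using c by (simp add: continuous_on_eq_continuous_at)
  have [measurable]: "f \<in> borel_measurable borel" "f1 \<in> borel_measurable borel"
    by (intro borel_measurable_continuous_onI continuous_at_imp_continuous_on ballI fc f1c)+
  have "has_bochner_integral lborel (\<lambda>t. (2 * f t * f1 t) * indicator {a..x} t) ((f x)\<^sup>2 - (f a)\<^sup>2)"
  proof (rule has_bochner_integral_FTC_Icc_real)
    show "DERIV (\<lambda>t. (f t)\<^sup>2) t :> 2 * f t * f1 t" for t
      using d[of t] by (auto intro!: derivative_eq_intros)
  qed (use False fc f1c in \<open>auto intro!: continuous_intros\<close>)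
  then have i: "integrable lborel (\<lambda>t. (2 * f t * f1 t) * indicator {a..x} t)"
    "(\<integral>t. (2 * f t * f1 t) * indicator {a..x} t \<partial>lborel) = (f x)\<^sup>2"
    by (auto simp: has_bochner_integral_iff z)
  have "ennreal ((f x)\<^sup>2) \<le> (\<integral>\<^sup>+t. ennreal (norm ((2 * f t * f1 t) * indicator {a..x} t)) \<partial>lborel)"
    using integral_norm_bound_ennreal[OF i(1)] unfolding i(2) by simp
  also have "\<dots> \<le> (\<integral>\<^sup>+t. ennreal ((f t)\<^sup>2) + ennreal ((f1 t)\<^sup>2) \<partial>lborel)"
  proof (rule nn_integral_mono)
    fix t
    have "norm ((2 * f t * f1 t) * indicator {a..x} t) \<le> 2 * \<bar>f t\<bar> * \<bar>f1 t\<bar>"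
      by (auto simp: indicator_def abs_mult)
    also have "\<dots> \<le> (f t)\<^sup>2 + (f1 t)\<^sup>2"
      using sum_squares_bound[of "\<bar>f t\<bar>" "\<bar>f1 t\<bar>"] by simp
    finally show "ennreal (norm ((2 * f t * f1 t) * indicator {a..x} t)) \<le> ennreal ((f t)\<^sup>2) + ennreal ((f1 t)\<^sup>2)"
      by (simp add: ennreal_plus[symmetric] ennreal_leI del: ennreal_plus)
  qed
  also have "\<dots> = (\<integral>\<^sup>+t. ennreal ((f t)\<^sup>2) \<partial>lborel) + (\<integral>\<^sup>+t. ennreal ((f1 t)\<^sup>2) \<partial>lborel)"
    by (rule nn_integral_add) measurable
  finally show ?thesis .
qed

definition slice_energy :: "real \<Rightarrow> (nat \<Rightarrow> fn2) \<Rightarrow> real \<Rightarrow> ennreal" where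
  "slice_energy \<alpha> f y = (\<integral>\<^sup>+s. ennreal ((f 0 (s, y))\<^sup>2) \<partial>lborel) +
     (if \<alpha> = 2 then \<integral>\<^sup>+s. ennreal ((f 1 (s, y))\<^sup>2) \<partial>lborel
      else \<integral>\<^sup>+h. ennreal (indicator {0<..} h * h powr (- 1 - \<alpha>))
        * (\<integral>\<^sup>+s. ennreal ((f 0 (s + h, y) - f 0 (s, y))\<^sup>2) \<partial>lborel) \<partial>lborel)"

lemma x_chain_slice_continuous:
  assumes "x_chain a b c d f"
  shows "continuous_on UNIV (\<lambda>s. f n (s, y))"
  by (rule continuous_on_compose2[OF x_chainD(1)[OF assms]]) (auto intro!: continuous_intros)

lemma square_le_slice_energy:
  assumes \<alpha>: "1 < \<alpha>" "\<alpha> \<le> 2"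
  obtains C where "C \<ge> 0"
    "\<And>f a b c d x y. x_chain a b c d f \<Longrightarrow> ennreal ((f 0 (x, y))\<^sup>2) \<le> ennreal C * slice_energy \<alpha> f y"
proof (cases "\<alpha> = 2")
  case True
  have "ennreal ((f 0 (x, y))\<^sup>2) \<le> ennreal 1 * slice_energy \<alpha> f y" if f: "x_chain a b c d f" for f a b c d x y
  proof -
    have "ennreal ((f 0 (x, y))\<^sup>2) \<le> (\<integral>\<^sup>+s. ennreal ((f 0 (s, y))\<^sup>2) \<partial>lborel) + (\<integral>\<^sup>+s. ennreal ((f (Suc 0) (s, y))\<^sup>2) \<partial>lborel)"
      by (rule sobolev_1d_derivative[OF x_chainD(2)[OF f] x_chain_slice_continuous[OF f], of a])
        (simp add: x_chainD(3)[OF f] Omega_def)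
    then show ?thesis using True by (simp add: slice_energy_def)
  qed
  then show ?thesis using that[of 1] by simp
next
  case False
  define C where "C = 2 + 2 / (\<alpha> - 1)"
  have "2 / (\<alpha> - 1) \<ge> 0" using \<alpha> by simp
  then have C: "C \<ge> 2" "C \<ge> 2 / (\<alpha> - 1)" by (simp_all add: C_def)
  have "ennreal ((f 0 (x, y))\<^sup>2) \<le> ennreal C * slice_energy \<alpha> f y" if f: "x_chain a b c d f" for f a b c d x y
  proof -
    let ?g = "\<lambda>s. f 0 (s, y)"
    let ?S = "\<integral>\<^sup>+h. ennreal (indicator {0<..} h * h powr (- 1 - \<alpha>)) * (\<integral>\<^sup>+t. ennreal ((?g (t + h) - ?g t)\<^sup>2) \<partial>lborel) \<partial>lborel"
    have gc: "continuous_on UNIV ?g" by (rule x_chain_slice_continuous[OF f])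
    then have [measurable]: "?g \<in> borel_measurable borel" by (rule borel_measurable_continuous_onI)
    have gc': "continuous_on UNIV (\<lambda>t. ?g (t + x))"
      by (rule continuous_on_compose2[OF gc]) (auto intro!: continuous_intros)
    have sh0: "(\<integral>\<^sup>+t. ennreal ((?g (t + x))\<^sup>2) \<partial>lborel) = (\<integral>\<^sup>+t. ennreal ((?g t)\<^sup>2) \<partial>lborel)"
      by (rule nn_integral_lborel_shift) measurable
    have sh: "(\<integral>\<^sup>+t. ennreal ((?g (t + h + x) - ?g (t + x))\<^sup>2) \<partial>lborel) = (\<integral>\<^sup>+t. ennreal ((?g (t + h) - ?g t)\<^sup>2) \<partial>lborel)" for h
    proof -
      have "(\<integral>\<^sup>+t. ennreal ((?g (t + x + h) - ?g (t + x))\<^sup>2) \<partial>lborel) = (\<integral>\<^sup>+t. ennreal ((?g (t + h) - ?g t)\<^sup>2) \<partial>lborel)"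
        by (rule nn_integral_lborel_shift) measurable
      moreover have "t + x + h = t + h + x" for t by simp
      ultimately show ?thesis by simp
    qed
    \<comment> \<open>The one-dimensional bound at 0 is applied to the translated slice; translation
      leaves its energy unchanged.\<close>
    have "ennreal ((?g (0 + x))\<^sup>2) \<le> 2 * (\<integral>\<^sup>+t. ennreal ((?g t)\<^sup>2) \<partial>lborel) + ennreal (2 / (\<alpha> - 1)) * ?S"
      using sobolev_1d_fractional[OF gc' \<alpha>(1)] unfolding sh0 sh .
    also have "2 * (\<integral>\<^sup>+t. ennreal ((?g t)\<^sup>2) \<partial>lborel) + ennreal (2 / (\<alpha> - 1)) * ?S
      \<le> ennreal C * (\<integral>\<^sup>+t. ennreal ((?g t)\<^sup>2) \<partial>lborel) + ennreal C * ?S"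
      using C ennreal_leI[OF C(1)] by (intro add_mono mult_right_mono ennreal_leI) auto
    also have "\<dots> = ennreal C * slice_energy \<alpha> f y"
      using False by (simp add: slice_energy_def distrib_left)
    finally show ?thesis by simp
  qed
  then show ?thesis using that[of C] C(1) by simp
qed

section \<open>From slices to the plane\<close>

lemma x_chain_pair_measurable:
  assumes "x_chain a b c d f" "g \<in> borel_measurable M" "h \<in> borel_measurable M"
  shows "(\<lambda>q. f n (g q, h q)) \<in> borel_measurable M"
  by (rule measurable_compose[OF borel_measurable_Pair[OF assms(2,3)] x_chain_measurable[OF assms(1)]])

lemma slice_energy_measurable:
  assumes f: "x_chain a b c d f"
  shows "slice_energy \<alpha> f \<in> borel_measurable borel"
proof -
  note [measurable] = x_chain_pair_measurable[OF f]
  show ?thesis unfolding slice_energy_def by measurable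
qed

lemma nn_integral_slice_energy:
  assumes f: "x_chain a b c d f"
  shows "(\<integral>\<^sup>+y. slice_energy \<alpha> f y \<partial>lborel) = xenergy \<alpha> f"
proof -
  note [measurable] = x_chain_pair_measurable[OF f]
  have fub: "(\<integral>\<^sup>+y. \<integral>\<^sup>+s. F (s, y) \<partial>lborel \<partial>lborel) = (\<integral>\<^sup>+p. F p \<partial>lborel)"
    if [measurable]: "F \<in> borel_measurable borel" for F :: "real \<times> real \<Rightarrow> ennreal"
  proof -
    have "F \<in> borel_measurable (lborel \<Otimes>\<^sub>M lborel)" by (simp add: lborel_prod)
    then have "(\<integral>\<^sup>+y. \<integral>\<^sup>+s. F (s, y) \<partial>lborel \<partial>lborel) = (\<integral>\<^sup>+p. F p \<partial>(lborel \<Otimes>\<^sub>M lborel))"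
      by (subst lborel_pair.nn_integral_snd[symmetric]) (simp_all add: case_prod_beta')
    then show ?thesis by (simp add: lborel_prod)
  qed
  note m [measurable] = x_chain_measurable[OF f]
  have e0: "(\<integral>\<^sup>+y. \<integral>\<^sup>+s. ennreal ((f n (s, y))\<^sup>2) \<partial>lborel \<partial>lborel) = (\<integral>\<^sup>+p. ennreal ((f n p)\<^sup>2) \<partial>lborel)" for n
    by (rule fub[of "\<lambda>p. ennreal ((f n p)\<^sup>2)"]) measurable
  have "(\<integral>\<^sup>+y. \<integral>\<^sup>+h. ennreal (indicator {0<..} h * h powr (- 1 - \<alpha>)) * (\<integral>\<^sup>+s. ennreal ((f 0 (s + h, y) - f 0 (s, y))\<^sup>2) \<partial>lborel) \<partial>lborel \<partial>lborel)
    = (\<integral>\<^sup>+h. \<integral>\<^sup>+y. ennreal (indicator {0<..} h * h powr (- 1 - \<alpha>)) * (\<integral>\<^sup>+s. ennreal ((f 0 (s + h, y) - f 0 (s, y))\<^sup>2) \<partial>lborel) \<partial>lborel \<partial>lborel)"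
    by (rule lborel_pair.Fubini') measurable
  also have "\<dots> = (\<integral>\<^sup>+h. ennreal (indicator {0<..} h * h powr (- 1 - \<alpha>)) * (\<integral>\<^sup>+p. ennreal ((f 0 (p + (h, 0)) - f 0 p)\<^sup>2) \<partial>lborel) \<partial>lborel)"
  proof (rule nn_integral_cong)
    fix h :: real
    note [measurable] = x_chain_shift_measurable[OF f]
    have "(\<integral>\<^sup>+y. \<integral>\<^sup>+s. ennreal ((f 0 (s + h, y) - f 0 (s, y))\<^sup>2) \<partial>lborel \<partial>lborel)
      = (\<integral>\<^sup>+p. ennreal ((f 0 (p + (h, 0)) - f 0 p)\<^sup>2) \<partial>lborel)"
      using fub[of "\<lambda>p. ennreal ((f 0 (p + (h, 0)) - f 0 p)\<^sup>2)"] by simp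
    then show "(\<integral>\<^sup>+y. ennreal (indicator {0<..} h * h powr (- 1 - \<alpha>)) * (\<integral>\<^sup>+s. ennreal ((f 0 (s + h, y) - f 0 (s, y))\<^sup>2) \<partial>lborel) \<partial>lborel)
      = ennreal (indicator {0<..} h * h powr (- 1 - \<alpha>)) * (\<integral>\<^sup>+p. ennreal ((f 0 (p + (h, 0)) - f 0 p)\<^sup>2) \<partial>lborel)"
      by (subst nn_integral_cmult) auto
  qed
  finally have e1: "(\<integral>\<^sup>+y. \<integral>\<^sup>+h. ennreal (indicator {0<..} h * h powr (- 1 - \<alpha>)) * (\<integral>\<^sup>+s. ennreal ((f 0 (s + h, y) - f 0 (s, y))\<^sup>2) \<partial>lborel) \<partial>lborel \<partial>lborel)
    = (\<integral>\<^sup>+h. ennreal (indicator {0<..} h * h powr (- 1 - \<alpha>)) * (\<integral>\<^sup>+p. ennreal ((f 0 (p + (h, 0)) - f 0 p)\<^sup>2) \<partial>lborel) \<partial>lborel)" .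
  show ?thesis
    unfolding slice_energy_def xenergy_def
    by (subst nn_integral_add) (auto simp: e0 e1)
qed

text \<open>A Ladyzhenskaya-type argument: the fourth power is at most a product of a function of
  \<open>x\<close> and a function of \<open>y\<close>, so its integral factorizes into two
  one-dimensional integrals, the directional energies.\<close>

lemma L4_le_energy:
  assumes \<alpha>: "1 < \<alpha>" "\<alpha> \<le> 2"
  obtains C where "C \<ge> 0"
    "\<And>f a b c d. f \<in> Cc_inf (Omega a b c d) \<Longrightarrow>
      (\<integral>\<^sup>+p. ennreal ((f p)^4) \<partial>lborel) \<le> ennreal C * (xenergy \<alpha> (\<lambda>n. dx n f) * xenergy \<alpha> (\<lambda>n. dy n f))"
proof -
  obtain C where C: "C \<ge> 0"
    "\<And>f a b c d x y. x_chain a b c d f \<Longrightarrow> ennreal ((f 0 (x, y))\<^sup>2) \<le> ennreal C * slice_energy \<alpha> f y"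
    using square_le_slice_energy[OF \<alpha>] by metis
  show ?thesis
  proof (rule that[of "C * C"])
    fix f a b c d assume f: "f \<in> Cc_inf (Omega a b c d)"
    let ?X = "slice_energy \<alpha> (\<lambda>n. dx n f)" and ?Y = "slice_energy \<alpha> (\<lambda>n. dy n f)"
    note [measurable] = slice_energy_measurable[OF x_chain_dx[OF f]] slice_energy_measurable[OF x_chain_dy[OF f]]
    have "(\<integral>\<^sup>+p. ennreal ((f p)^4) \<partial>lborel) \<le> (\<integral>\<^sup>+p. (ennreal C * ?Y (fst p)) * (ennreal C * ?X (snd p)) \<partial>lborel)"
    proof (rule nn_integral_mono)
      fix p :: "real \<times> real"
      obtain x y where p: "p = (x, y)" by fastforce
      have 1: "ennreal ((f p)\<^sup>2) \<le> ennreal C * ?X y" using C(2)[OF x_chain_dx[OF f], of x y] by (simp add: p)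
      have 2: "ennreal ((f p)\<^sup>2) \<le> ennreal C * ?Y x" using C(2)[OF x_chain_dy[OF f], of y x] by (simp add: p dy_0)
      have "ennreal ((f p)^4) = ennreal ((f p)\<^sup>2) * ennreal ((f p)\<^sup>2)"
        by (simp add: ennreal_mult[symmetric] power_add[symmetric])
      also have "\<dots> \<le> (ennreal C * ?Y x) * (ennreal C * ?X y)" by (intro mult_mono 1 2) auto
      finally show "ennreal ((f p)^4) \<le> (ennreal C * ?Y (fst p)) * (ennreal C * ?X (snd p))" by (simp add: p)
    qed
    also have "\<dots> = (\<integral>\<^sup>+x. ennreal C * ?Y x \<partial>lborel) * (\<integral>\<^sup>+y. ennreal C * ?X y \<partial>lborel)"
      by (rule nn_integral_lborel_pair_prod) measurable
    also have "\<dots> = (ennreal C * xenergy \<alpha> (\<lambda>n. dy n f)) * (ennreal C * xenergy \<alpha> (\<lambda>n. dx n f))"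
      by (simp add: nn_integral_cmult nn_integral_slice_energy[OF x_chain_dx[OF f]] nn_integral_slice_energy[OF x_chain_dy[OF f]])
    also have "\<dots> = ennreal (C * C) * (xenergy \<alpha> (\<lambda>n. dx n f) * xenergy \<alpha> (\<lambda>n. dy n f))"
      using C(1) by (simp add: ennreal_mult mult_ac)
    finally show "(\<integral>\<^sup>+p. ennreal ((f p)^4) \<partial>lborel) \<le> ennreal (C * C) * (xenergy \<alpha> (\<lambda>n. dx n f) * xenergy \<alpha> (\<lambda>n. dy n f))" .
  qed (use C in simp)
qed

section \<open>Limits in L2 and L4\<close>

text \<open>Measurability is relative to \<open>M\<close>: on the rectangle, \<open>frac_lap\<close>
  of a test function is controlled only at interior points, where the formula by
  \<open>riesz\<close> holds.\<close>

definition sqint :: "'a measure \<Rightarrow> ('a \<Rightarrow> real) \<Rightarrow> bool" where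
  "sqint M u \<longleftrightarrow> u \<in> borel_measurable M \<and> integrable M (\<lambda>p. (u p)\<^sup>2)"

lemma sqint_measurable: "sqint M u \<Longrightarrow> u \<in> borel_measurable M"
  and sqint_integrable: "sqint M u \<Longrightarrow> integrable M (\<lambda>p. (u p)\<^sup>2)"
  by (simp_all add: sqint_def)

lemma sqint_mult:
  assumes "sqint M u" "sqint M v"
  shows "integrable M (\<lambda>p. u p * v p)"
proof (rule Bochner_Integration.integrable_bound)
  show "integrable M (\<lambda>p. (u p)\<^sup>2 + (v p)\<^sup>2)" using assms by (simp add: sqint_def)
  show "(\<lambda>p. u p * v p) \<in> borel_measurable M"
    by (intro borel_measurable_times assms[THEN sqint_measurable])
  have "\<bar>u p * v p\<bar> \<le> (u p)\<^sup>2 + (v p)\<^sup>2" for p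
    using sum_squares_bound[of "\<bar>u p\<bar>" "\<bar>v p\<bar>"] abs_ge_zero[of "u p * v p"] unfolding abs_mult power2_abs by linarith
  then show "AE p in M. norm (u p * v p) \<le> norm ((u p)\<^sup>2 + (v p)\<^sup>2)"
    by (intro AE_I2) (simp add: order_trans[OF _ abs_ge_self])
qed

lemma sqint_lincomb:
  assumes "sqint M u" "sqint M v"
  shows "sqint M (\<lambda>p. r * u p + s * v p)"
proof -
  have "(\<lambda>p. (r * u p + s * v p)\<^sup>2) = (\<lambda>p. r\<^sup>2 * (u p)\<^sup>2 + 2 * r * s * (u p * v p) + s\<^sup>2 * (v p)\<^sup>2)"
    by (simp add: fun_eq_iff power2_eq_square algebra_simps)
  moreover have "(\<lambda>p. r * u p + s * v p) \<in> borel_measurable M"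
    by (intro borel_measurable_times borel_measurable_add borel_measurable_const assms[THEN sqint_measurable])
  ultimately show ?thesis using assms sqint_mult[OF assms] by (simp add: sqint_def)
qed

lemma sqint_diff: "sqint M u \<Longrightarrow> sqint M v \<Longrightarrow> sqint M (\<lambda>p. u p - v p)"
  using sqint_lincomb[of M u v 1 "-1"] by simp

lemma integral_Cauchy_Schwarz:
  assumes "sqint M u" "sqint M v"
  shows "(\<integral>p. \<bar>u p * v p\<bar> \<partial>M)\<^sup>2 \<le> (\<integral>p. (u p)\<^sup>2 \<partial>M) * (\<integral>p. (v p)\<^sup>2 \<partial>M)"
proof -
  note [measurable] = assms[THEN sqint_measurable]
  have "(\<integral>\<^sup>+p. ennreal \<bar>u p\<bar> * ennreal \<bar>v p\<bar> \<partial>M)\<^sup>2 \<le> (\<integral>\<^sup>+p. (ennreal \<bar>u p\<bar>)\<^sup>2 \<partial>M) * (\<integral>\<^sup>+p. (ennreal \<bar>v p\<bar>)\<^sup>2 \<partial>M)"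
    by (rule Cauchy_Schwarz_nn_integral) measurable
  moreover have "(\<integral>\<^sup>+p. ennreal \<bar>u p\<bar> * ennreal \<bar>v p\<bar> \<partial>M) = ennreal (\<integral>p. \<bar>u p * v p\<bar> \<partial>M)"
    by (subst nn_integral_eq_integral[symmetric, OF integrable_abs[OF sqint_mult[OF assms]]]) (auto simp: abs_mult ennreal_mult)
  moreover have "(\<integral>\<^sup>+p. (ennreal \<bar>w p\<bar>)\<^sup>2 \<partial>M) = ennreal (\<integral>p. (w p)\<^sup>2 \<partial>M)" if "sqint M w" for w
    using that by (subst nn_integral_eq_integral[symmetric]) (auto simp: ennreal_power sqint_def)
  ultimately have "ennreal ((\<integral>p. \<bar>u p * v p\<bar> \<partial>M)\<^sup>2) \<le> ennreal ((\<integral>p. (u p)\<^sup>2 \<partial>M) * (\<integral>p. (v p)\<^sup>2 \<partial>M))"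
    using assms by (simp add: ennreal_power ennreal_mult)
  then show ?thesis by (simp add: ennreal_le_iff)
qed

lemma integral_mult_tendsto:
  assumes w: "sqint M w" and u: "sqint M u" "\<And>k. sqint M (us k)"
    and lim: "(\<lambda>k. \<integral>p. (us k p - u p)\<^sup>2 \<partial>M) \<longlonglongrightarrow> 0"
  shows "(\<lambda>k. \<integral>p. w p * us k p \<partial>M) \<longlonglongrightarrow> (\<integral>p. w p * u p \<partial>M)"
proof -
  let ?W = "\<integral>p. (w p)\<^sup>2 \<partial>M"
  have le: "norm ((\<integral>p. w p * us k p \<partial>M) - (\<integral>p. w p * u p \<partial>M)) \<le> sqrt (?W * (\<integral>p. (us k p - u p)\<^sup>2 \<partial>M))" for k
  proof -
    have "(\<integral>p. w p * us k p \<partial>M) - (\<integral>p. w p * u p \<partial>M) = (\<integral>p. w p * (us k p - u p) \<partial>M)"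
      using sqint_mult[OF w u(1)] sqint_mult[OF w u(2)[of k]] by (simp add: right_diff_distrib)
    also have "norm \<dots> \<le> (\<integral>p. \<bar>w p * (us k p - u p)\<bar> \<partial>M)" by simp
    also have "\<dots> \<le> sqrt (?W * (\<integral>p. (us k p - u p)\<^sup>2 \<partial>M))"
      by (rule real_le_rsqrt[OF integral_Cauchy_Schwarz[OF w sqint_diff[OF u(2) u(1)]]])
    finally show ?thesis .
  qed
  have L0: "(\<lambda>k. sqrt (?W * (\<integral>p. (us k p - u p)\<^sup>2 \<partial>M))) \<longlonglongrightarrow> 0"
    using tendsto_real_sqrt[OF tendsto_mult_left[OF lim, of ?W]] by simp
  have "(\<lambda>k. (\<integral>p. w p * us k p \<partial>M) - (\<integral>p. w p * u p \<partial>M)) \<longlonglongrightarrow> 0"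
    by (rule Lim_null_comparison[OF _ L0], rule always_eventually, rule allI, rule le)
  then show ?thesis using Lim_null by blast
qed

lemma fourth_integrable_imp_sqint_square:
  assumes "u \<in> borel_measurable M" "(\<integral>\<^sup>+p. ennreal ((u p)^4) \<partial>M) < \<infinity>"
  shows "sqint M (\<lambda>p. (u p)\<^sup>2)"
  unfolding sqint_def using assms
  by (auto simp: integrable_iff_bounded power_mult[symmetric])

lemma power4_diff_le: "(x - y :: real)^4 \<le> 8 * x^4 + 8 * y^4"
proof -
  have sq: "(p + q)\<^sup>2 \<le> 2 * p\<^sup>2 + 2 * q\<^sup>2" for p q :: real
    using sum_squares_bound[of p q] by (simp add: power2_sum)
  have "(x - y)\<^sup>2 \<le> 2 * x\<^sup>2 + 2 * y\<^sup>2" using sq[of x "- y"] by simp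
  then have "((x - y)\<^sup>2)\<^sup>2 \<le> (2 * x\<^sup>2 + 2 * y\<^sup>2)\<^sup>2" by (intro power_mono) auto
  also have "\<dots> \<le> 2 * (2 * x\<^sup>2)\<^sup>2 + 2 * (2 * y\<^sup>2)\<^sup>2" by (rule sq)
  finally show ?thesis by (simp add: power_mult_distrib power_mult[symmetric])
qed

text \<open>A Cauchy sequence in L4 must be shown to converge to the L2 limit that is already given.
  An almost everywhere convergent subsequence of the L2 convergence and Fatou's lemma identify the
  two.\<close>

lemma L4_limit:
  fixes us :: "nat \<Rightarrow> 'a \<Rightarrow> real"
  assumes u: "sqint M u" "\<And>k. sqint M (us k)"
    and lim: "(\<lambda>k. \<integral>p. (us k p - u p)\<^sup>2 \<partial>M) \<longlonglongrightarrow> 0"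
    and cau: "\<And>e. e > 0 \<Longrightarrow> \<exists>N. \<forall>m\<ge>N. \<forall>n\<ge>N. (\<integral>\<^sup>+p. ennreal ((us m p - us n p)^4) \<partial>M) < ennreal e"
    and e: "e > 0"
  shows "\<exists>N. \<forall>m\<ge>N. (\<integral>\<^sup>+p. ennreal ((us m p - u p)^4) \<partial>M) \<le> ennreal e"
proof -
  note [measurable] = sqint_measurable[OF u(1)] sqint_measurable[OF u(2)]
  obtain N where N: "\<And>m n. m \<ge> N \<Longrightarrow> n \<ge> N \<Longrightarrow> (\<integral>\<^sup>+p. ennreal ((us m p - us n p)^4) \<partial>M) < ennreal e"
    using cau[OF e] by blast
  \<comment> \<open>L1 convergence of the squared differences yields pointwise convergence along a
    subsequence; \<open>m\<close> stays fixed while \<open>r n\<close> tends to infinity.\<close>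
  obtain r where r: "strict_mono r" "AE p in M. (\<lambda>n. (us (r n) p - u p)\<^sup>2) \<longlonglongrightarrow> 0"
    using tendsto_L1_AE_subseq[of M "\<lambda>k p. (us k p - u p)\<^sup>2"] sqint_integrable[OF sqint_diff[OF u(2) u(1)]] lim
    by auto
  have "(\<integral>\<^sup>+p. ennreal ((us m p - u p)^4) \<partial>M) \<le> ennreal e" if m: "m \<ge> N" for m
  proof -
    have "(\<integral>\<^sup>+p. ennreal ((us m p - u p)^4) \<partial>M) = (\<integral>\<^sup>+p. liminf (\<lambda>n. ennreal ((us m p - us (r n) p)^4)) \<partial>M)"
    proof (rule nn_integral_cong_AE)
      show "AE p in M. ennreal ((us m p - u p)^4) = liminf (\<lambda>n. ennreal ((us m p - us (r n) p)^4))"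
        using r(2)
      proof eventually_elim
        case (elim p)
        have "(\<lambda>n. sqrt ((us (r n) p - u p)\<^sup>2)) \<longlonglongrightarrow> sqrt 0" by (intro tendsto_real_sqrt elim)
        then have "(\<lambda>n. us (r n) p - u p) \<longlonglongrightarrow> 0" by (simp add: tendsto_rabs_zero_iff)
        then have "(\<lambda>n. us (r n) p) \<longlonglongrightarrow> u p" using Lim_null by blast
        then have "(\<lambda>n. ennreal ((us m p - us (r n) p)^4)) \<longlonglongrightarrow> ennreal ((us m p - u p)^4)"
          by (intro tendsto_ennrealI tendsto_intros)
        then show ?case by (intro lim_imp_Liminf[symmetric]) auto
      qed
    qed
    also have "\<dots> \<le> liminf (\<lambda>n. \<integral>\<^sup>+p. ennreal ((us m p - us (r n) p)^4) \<partial>M)"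
      by (rule nn_integral_liminf) measurable
    also have "\<dots> \<le> ennreal e"
    proof -
      have "\<forall>\<^sub>F n in sequentially. (\<integral>\<^sup>+p. ennreal ((us m p - us (r n) p)^4) \<partial>M) \<le> ennreal e"
        unfolding eventually_sequentially
      proof (intro exI[of _ N] allI impI)
        fix n assume "n \<ge> N"
        then have "r n \<ge> N" using seq_suble[OF r(1), of n] by simp
        then show "(\<integral>\<^sup>+p. ennreal ((us m p - us (r n) p)^4) \<partial>M) \<le> ennreal e" using N[OF m] by (simp add: less_imp_le)
      qed
      then have "liminf (\<lambda>n. \<integral>\<^sup>+p. ennreal ((us m p - us (r n) p)^4) \<partial>M) \<le> liminf (\<lambda>n::nat. ennreal e)"
        by (rule Liminf_mono)
      then show ?thesis by (simp add: Liminf_const)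
    qed
    finally show ?thesis .
  qed
  then show ?thesis by blast
qed

lemma fourth_finite_of_diff:
  assumes [measurable]: "u \<in> borel_measurable M" "v \<in> borel_measurable M"
    and "(\<integral>\<^sup>+p. ennreal ((v p)^4) \<partial>M) < \<infinity>" "(\<integral>\<^sup>+p. ennreal ((v p - u p)^4) \<partial>M) < \<infinity>"
  shows "(\<integral>\<^sup>+p. ennreal ((u p)^4) \<partial>M) < \<infinity>"
proof -
  have "(\<integral>\<^sup>+p. ennreal ((u p)^4) \<partial>M) \<le> (\<integral>\<^sup>+p. 8 * ennreal ((v p)^4) + 8 * ennreal ((v p - u p)^4) \<partial>M)"
  proof (rule nn_integral_mono)
    fix p
    have "(u p)^4 \<le> 8 * (v p)^4 + 8 * (v p - u p)^4" using power4_diff_le[of "v p" "v p - u p"] by simp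
    then have "ennreal ((u p)^4) \<le> ennreal (8 * (v p)^4 + 8 * (v p - u p)^4)" by (rule ennreal_leI)
    then show "ennreal ((u p)^4) \<le> 8 * ennreal ((v p)^4) + 8 * ennreal ((v p - u p)^4)" by (simp add: ennreal_mult)
  qed
  also have "\<dots> = 8 * (\<integral>\<^sup>+p. ennreal ((v p)^4) \<partial>M) + 8 * (\<integral>\<^sup>+p. ennreal ((v p - u p)^4) \<partial>M)"
    by (simp add: nn_integral_add nn_integral_cmult)
  also have "\<dots> < \<infinity>" using assms(3,4) by (simp add: ennreal_mult_less_top)
  finally show ?thesis .
qed

text \<open>This lets the test function in the cubic term tend to \<open>u\<close>. The integrand is
  regrouped as \<open>(q p)\<^sup>2\<close>, which is in L2, times \<open>u p * us k p\<close>,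
  which converges in L2 by Cauchy--Schwarz applied to L4 factors.\<close>

lemma L4_product_tendsto:
  assumes u: "sqint M u" "\<And>k. sqint M (us k)" "(\<integral>\<^sup>+p. ennreal ((u p)^4) \<partial>M) < \<infinity>"
    and q: "q \<in> borel_measurable M" "(\<integral>\<^sup>+p. ennreal ((q p)^4) \<partial>M) < \<infinity>"
    and us4: "\<And>k. (\<integral>\<^sup>+p. ennreal ((us k p)^4) \<partial>M) < \<infinity>"
    and lim: "\<And>e. e > 0 \<Longrightarrow> \<exists>N. \<forall>m\<ge>N. (\<integral>\<^sup>+p. ennreal ((us m p - u p)^4) \<partial>M) \<le> ennreal e"
  shows "(\<lambda>k. \<integral>p. u p * (q p)\<^sup>2 * us k p \<partial>M) \<longlonglongrightarrow> (\<integral>p. (u p)\<^sup>2 * (q p)\<^sup>2 \<partial>M)"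
proof -
  note um [measurable] = sqint_measurable[OF u(1)] sqint_measurable[OF u(2)]
  have prod: "sqint M (\<lambda>p. f p * g p)" if "sqint M (\<lambda>p. (f p)\<^sup>2)" "sqint M (\<lambda>p. (g p)\<^sup>2)"
    "f \<in> borel_measurable M" "g \<in> borel_measurable M" for f g :: "'a \<Rightarrow> real"
    using that sqint_mult[OF that(1,2)] by (simp add: sqint_def power_mult_distrib)
  have u2: "sqint M (\<lambda>p. (u p)\<^sup>2)" by (rule fourth_integrable_imp_sqint_square[OF um(1) u(3)])
  have us2: "sqint M (\<lambda>p. (us k p)\<^sup>2)" for k by (rule fourth_integrable_imp_sqint_square[OF um(2) us4])
  have q2: "sqint M (\<lambda>p. (q p)\<^sup>2)" by (rule fourth_integrable_imp_sqint_square[OF q])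
  have uus: "sqint M (\<lambda>p. u p * us k p)" for k by (rule prod[OF u2 us2 um])
  have uu: "sqint M (\<lambda>p. u p * u p)" using u2 by (simp add: power2_eq_square)
  have d4: "(\<integral>\<^sup>+p. ennreal ((us k p - u p)^4) \<partial>M) < \<infinity>" for k
  proof -
    have "(\<integral>\<^sup>+p. ennreal ((us k p - u p)^4) \<partial>M) < \<infinity>"
      by (rule fourth_finite_of_diff[OF _ um(2)[of k] us4[of k]]) (use u(3) in auto)
    then show ?thesis .
  qed
  have d2: "sqint M (\<lambda>p. (us k p - u p)\<^sup>2)" for k
    by (rule fourth_integrable_imp_sqint_square[OF _ d4]) measurable
  define K where "K = (\<integral>p. ((u p)\<^sup>2)\<^sup>2 \<partial>M)"
  have le: "(\<integral>p. (u p * us k p - u p * u p)\<^sup>2 \<partial>M) \<le> sqrt (K * (\<integral>p. ((us k p - u p)\<^sup>2)\<^sup>2 \<partial>M))" for k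
  proof -
    have "(\<integral>p. (u p * us k p - u p * u p)\<^sup>2 \<partial>M) = (\<integral>p. \<bar>(u p)\<^sup>2 * (us k p - u p)\<^sup>2\<bar> \<partial>M)"
      by (simp add: right_diff_distrib[symmetric] power_mult_distrib)
    also have "\<dots> \<le> sqrt (K * (\<integral>p. ((us k p - u p)\<^sup>2)\<^sup>2 \<partial>M))"
      unfolding K_def by (rule real_le_rsqrt[OF integral_Cauchy_Schwarz[OF u2 d2]])
    finally show ?thesis .
  qed
  have lim4: "(\<lambda>k. \<integral>p. ((us k p - u p)\<^sup>2)\<^sup>2 \<partial>M) \<longlonglongrightarrow> 0"
  proof (rule LIMSEQ_I)
    fix e :: real assume "e > 0"
    then obtain N where N: "\<And>m. m \<ge> N \<Longrightarrow> (\<integral>\<^sup>+p. ennreal ((us m p - u p)^4) \<partial>M) \<le> ennreal (e / 2)"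
      using lim[of "e / 2"] by auto
    have "norm ((\<integral>p. ((us m p - u p)\<^sup>2)\<^sup>2 \<partial>M) - 0) < e" if "m \<ge> N" for m
    proof -
      have "ennreal (\<integral>p. ((us m p - u p)\<^sup>2)\<^sup>2 \<partial>M) = (\<integral>\<^sup>+p. ennreal ((us m p - u p)^4) \<partial>M)"
        using sqint_integrable[OF d2[of m]] by (subst nn_integral_eq_integral[symmetric]) (auto simp: power_mult[symmetric])
      with N[OF that] have "ennreal (\<integral>p. ((us m p - u p)\<^sup>2)\<^sup>2 \<partial>M) \<le> ennreal (e / 2)" by simp
      then have "(\<integral>p. ((us m p - u p)\<^sup>2)\<^sup>2 \<partial>M) \<le> e / 2" using \<open>e > 0\<close> by (simp add: ennreal_le_iff)
      with \<open>e > 0\<close> show ?thesis by simp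
    qed
    then show "\<exists>N. \<forall>m\<ge>N. norm ((\<integral>p. ((us m p - u p)\<^sup>2)\<^sup>2 \<partial>M) - 0) < e" by blast
  qed
  have L0: "(\<lambda>k. sqrt (K * (\<integral>p. ((us k p - u p)\<^sup>2)\<^sup>2 \<partial>M))) \<longlonglongrightarrow> 0"
    using tendsto_real_sqrt[OF tendsto_mult_left[OF lim4, of K]] by simp
  have nrm: "norm (\<integral>p. (u p * us k p - u p * u p)\<^sup>2 \<partial>M) \<le> sqrt (K * (\<integral>p. ((us k p - u p)\<^sup>2)\<^sup>2 \<partial>M))" for k
    using le[of k] by simp
  have "(\<lambda>k. \<integral>p. (u p * us k p - u p * u p)\<^sup>2 \<partial>M) \<longlonglongrightarrow> 0"
    by (rule Lim_null_comparison[OF _ L0], rule always_eventually, rule allI, rule nrm)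
  from integral_mult_tendsto[OF q2 uu uus this]
  have "(\<lambda>k. \<integral>p. (q p)\<^sup>2 * (u p * us k p) \<partial>M) \<longlonglongrightarrow> (\<integral>p. (q p)\<^sup>2 * (u p * u p) \<partial>M)" .
  then show ?thesis by (simp add: mult_ac power2_eq_square)
qed

section \<open>The fractional Laplacian as a quadratic form\<close>

abbreviation lebO :: "real \<Rightarrow> real \<Rightarrow> real \<Rightarrow> real \<Rightarrow> (real \<times> real) measure" where
  "lebO a b c d \<equiv> restrict_space lborel (Omega a b c d)"

lemma set_integral_eq_lebO: "(LINT p:Omega a b c d|lborel. F p) = (\<integral>p. (F p :: real) \<partial>lebO a b c d)"
  unfolding set_lebesgue_integral_def by (rule integral_restrict_space[symmetric]) simp

lemma integrable_lebO_bounded: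
  fixes F :: fn2
  assumes "F \<in> borel_measurable borel" "\<And>p. \<bar>F p\<bar> \<le> C"
  shows "integrable (lebO a b c d) F"
proof -
  have "C \<ge> 0" using assms(2)[of "(0, 0)"] by linarith
  then have "integrable lborel (\<lambda>p. indicator (Omega a b c d) p * F p)"
    using assms by (intro integrable_supported[where C = C and a = a and b = b and c = c and d = d])
      (auto simp: indicator_def)
  then show ?thesis by (subst integrable_restrict_space) auto
qed

lemma integral_lebO_eq_lborel:
  fixes F :: fn2
  assumes "\<And>p. p \<notin> Omega a b c d \<Longrightarrow> F p = 0"
  shows "(\<integral>p. F p \<partial>lebO a b c d) = (\<integral>p. F p \<partial>lborel)"
proof -
  have "(\<integral>p. F p \<partial>lebO a b c d) = (\<integral>p. indicator (Omega a b c d) p *\<^sub>R F p \<partial>lborel)"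
    by (rule integral_restrict_space) simp
  also have "(\<lambda>p. indicator (Omega a b c d) p *\<^sub>R F p) = F"
    using assms by (auto simp: fun_eq_iff indicator_def)
  finally show ?thesis .
qed

lemma inL2_sqint:
  assumes "inL2 (Omega a b c d) u"
  shows "sqint (lebO a b c d) u"
proof -
  have "u \<in> borel_measurable lborel" "set_integrable lborel (Omega a b c d) (\<lambda>p. (u p)\<^sup>2)"
    using assms by (auto simp: inL2_def)
  then show ?thesis
    unfolding sqint_def set_integrable_def by (auto intro: measurable_restrict_space1 simp: integrable_restrict_space)
qed

lemma L2norm_square: "(L2norm (Omega a b c d) u)\<^sup>2 = (\<integral>p. (u p)\<^sup>2 \<partial>lebO a b c d)"
  unfolding L2norm_def set_integral_eq_lebO by simp

lemma sqint_const: "sqint (lebO a b c d) (\<lambda>p. r)"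
  unfolding sqint_def by (auto intro: integrable_lebO_bounded[of _ "r\<^sup>2"])

lemma integral_lebO_const: "(\<integral>p. r \<partial>lebO a b c d) = r * measure lborel (Omega a b c d)"
  by (simp add: measure_restrict_space space_restrict_space mult.commute)

lemma Cc_inf_sqint:
  assumes "f \<in> Cc_inf (Omega a b c d)"
  shows "sqint (lebO a b c d) f" "integrable (lebO a b c d) (\<lambda>p. (f p)^n)"
proof -
  obtain C where C: "C \<ge> 0" "\<And>p. \<bar>f p\<bar> \<le> C" using x_chain_bounded[OF x_chain_dx[OF assms], of 0] by auto
  note [measurable] = Cc_inf_chain(1)[OF assms]
  have i: "integrable (lebO a b c d) (\<lambda>p. (f p)^k)" for k
  proof (rule integrable_lebO_bounded)
    show "\<bar>(f p)^k\<bar> \<le> C^k" for p using C power_mono[of "\<bar>f p\<bar>" C k] by (simp add: power_abs)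
  qed measurable
  show "integrable (lebO a b c d) (\<lambda>p. (f p)^n)" by (rule i)
  show "sqint (lebO a b c d) f"
    unfolding sqint_def using i[of 2] by (auto intro: measurable_restrict_space1)
qed

lemma integrable_supported_mult:
  assumes "f \<in> Cc_inf (Omega a b c d)" "F \<in> borel_measurable borel" "\<And>p. \<bar>F p\<bar> \<le> C"
  shows "integrable lborel (\<lambda>p. f p * F p)"
  by (rule integrable_mult_bounded[OF x_chain_integrable[OF x_chain_dx[OF assms(1)], of 0, simplified] _ assms(3)])
    (simp add: assms(2))

lemma swap_measurable: "(prod.swap :: real \<times> real \<Rightarrow> real \<times> real) \<in> borel_measurable borel"
  by (intro borel_measurable_continuous_onI continuous_on_swap)

lemma riesz_swap_bounded:
  assumes "f \<in> Cc_inf (Omega a b c d)" "\<alpha> \<le> 2"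
  obtains C where "\<And>p. \<bar>riesz \<alpha> (b - a) (dx 2 f) p\<bar> \<le> C" "\<And>p. \<bar>riesz \<alpha> (d - c) (dy 2 f) (prod.swap p)\<bar> \<le> C"
    "riesz \<alpha> (b - a) (dx 2 f) \<in> borel_measurable borel"
    "(\<lambda>p. riesz \<alpha> (d - c) (dy 2 f) (prod.swap p)) \<in> borel_measurable borel"
proof -
  obtain C1 where C1: "\<And>p. \<bar>riesz \<alpha> (b - a) (dx 2 f) p\<bar> \<le> C1" using riesz_bounded[OF x_chain_dx[OF assms(1)] assms(2)] by metis
  obtain C2 where C2: "\<And>p. \<bar>riesz \<alpha> (d - c) (dy 2 f) p\<bar> \<le> C2" using riesz_bounded[OF x_chain_dy[OF assms(1)] assms(2)] by metis
  show ?thesis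
  proof (rule that[of "max C1 C2"])
    show "\<bar>riesz \<alpha> (b - a) (dx 2 f) p\<bar> \<le> max C1 C2" for p using C1[of p] by simp
    show "\<bar>riesz \<alpha> (d - c) (dy 2 f) (prod.swap p)\<bar> \<le> max C1 C2" for p using C2[of "prod.swap p"] by simp
    show "riesz \<alpha> (b - a) (dx 2 f) \<in> borel_measurable borel" by (rule riesz_measurable[OF x_chain_dx[OF assms(1)]])
    show "(\<lambda>p. riesz \<alpha> (d - c) (dy 2 f) (prod.swap p)) \<in> borel_measurable borel"
      by (rule measurable_compose[OF swap_measurable riesz_measurable[OF x_chain_dy[OF assms(1)]]])
  qed
qed

text \<open>Makes the pairing of an L2 function with the Laplacian of a fixed test function a
  genuine integral, continuous in the L2 function.\<close>

lemma frac_lap_sqint: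
  assumes "f \<in> Cc_inf (Omega a b c d)" "\<alpha> \<le> 2"
  shows "sqint (lebO a b c d) (frac_lap \<alpha> a b c d f)"
proof -
  obtain C where C: "\<And>p. \<bar>riesz \<alpha> (b - a) (dx 2 f) p\<bar> \<le> C" "\<And>p. \<bar>riesz \<alpha> (d - c) (dy 2 f) (prod.swap p)\<bar> \<le> C"
    and m [measurable]: "riesz \<alpha> (b - a) (dx 2 f) \<in> borel_measurable borel"
    "(\<lambda>p. riesz \<alpha> (d - c) (dy 2 f) (prod.swap p)) \<in> borel_measurable borel"
    using riesz_swap_bounded[OF assms] by metis
  let ?F = "\<lambda>p. riesz \<alpha> (b - a) (dx 2 f) p + riesz \<alpha> (d - c) (dy 2 f) (prod.swap p)"
  have F: "frac_lap \<alpha> a b c d f p = ?F p" if "p \<in> space (lebO a b c d)" for p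
    using that frac_lap_eq_riesz[OF assms] by (simp add: space_restrict_space)
  have "?F \<in> borel_measurable borel" by measurable
  then have "?F \<in> borel_measurable (lebO a b c d)" by (intro measurable_restrict_space1) simp
  then have 1: "frac_lap \<alpha> a b c d f \<in> borel_measurable (lebO a b c d)"
    by (subst measurable_cong[OF F]) auto
  have "integrable (lebO a b c d) (\<lambda>p. (?F p)\<^sup>2)"
  proof (rule integrable_lebO_bounded)
    fix p
    have "\<bar>?F p\<bar> \<le> 2 * C" using C(1)[of p] C(2)[of p] by linarith
    then have "\<bar>?F p\<bar>\<^sup>2 \<le> (2 * C)\<^sup>2" by (intro power_mono) auto
    then show "\<bar>(?F p)\<^sup>2\<bar> \<le> (2 * C)\<^sup>2" by simp
  qed measurable
  then have "integrable (lebO a b c d) (\<lambda>p. (frac_lap \<alpha> a b c d f p)\<^sup>2)"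
    by (subst Bochner_Integration.integrable_cong[OF refl, where g = "\<lambda>p. (?F p)\<^sup>2"]) (simp_all add: F)
  with 1 show ?thesis by (simp add: sqint_def)
qed

text \<open>The weak form as it stands in the scheme: the operator acts on the second argument and
  the first needs only be in L2. Symmetry is therefore available between two test functions
  only.\<close>

definition form :: "real \<Rightarrow> real \<Rightarrow> real \<Rightarrow> real \<Rightarrow> real \<Rightarrow> fn2 \<Rightarrow> fn2 \<Rightarrow> real" where
  "form \<alpha> a b c d u f = (\<integral>p. u p * frac_lap \<alpha> a b c d f p \<partial>lebO a b c d)"

lemma form_eq_riesz:
  assumes g: "g \<in> Cc_inf (Omega a b c d)" and f: "f \<in> Cc_inf (Omega a b c d)" and "\<alpha> \<le> 2"
  shows "form \<alpha> a b c d g f = (\<integral>p. dx 0 g p * riesz \<alpha> (b - a) (dx 2 f) p \<partial>lborel)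
    + (\<integral>p. dy 0 g p * riesz \<alpha> (d - c) (dy 2 f) p \<partial>lborel)"
proof -
  obtain C where C: "\<And>p. \<bar>riesz \<alpha> (b - a) (dx 2 f) p\<bar> \<le> C" "\<And>p. \<bar>riesz \<alpha> (d - c) (dy 2 f) (prod.swap p)\<bar> \<le> C"
    and m: "riesz \<alpha> (b - a) (dx 2 f) \<in> borel_measurable borel"
    "(\<lambda>p. riesz \<alpha> (d - c) (dy 2 f) (prod.swap p)) \<in> borel_measurable borel"
    using riesz_swap_bounded[OF f assms(3)] by metis
  let ?F = "\<lambda>p. riesz \<alpha> (b - a) (dx 2 f) p + riesz \<alpha> (d - c) (dy 2 f) (prod.swap p)"
  have "form \<alpha> a b c d g f = (\<integral>p. g p * ?F p \<partial>lebO a b c d)"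
    unfolding form_def by (intro Bochner_Integration.integral_cong refl)
      (simp add: space_restrict_space frac_lap_eq_riesz[OF f assms(3)])
  also have "\<dots> = (\<integral>p. g p * ?F p \<partial>lborel)"
    by (rule integral_lebO_eq_lborel) (simp add: Cc_inf_chain(2)[OF g])
  also have "\<dots> = (\<integral>p. g p * riesz \<alpha> (b - a) (dx 2 f) p \<partial>lborel) + (\<integral>p. g p * riesz \<alpha> (d - c) (dy 2 f) (prod.swap p) \<partial>lborel)"
    unfolding distrib_left
    by (intro Bochner_Integration.integral_add integrable_supported_mult[OF g m(1) C(1)] integrable_supported_mult[OF g m(2) C(2)])
  also have "(\<integral>p. g p * riesz \<alpha> (d - c) (dy 2 f) (prod.swap p) \<partial>lborel) = (\<integral>p. dy 0 g p * riesz \<alpha> (d - c) (dy 2 f) p \<partial>lborel)"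
  proof -
    have "(\<lambda>p. dy 0 g p * riesz \<alpha> (d - c) (dy 2 f) p) \<in> borel_measurable borel"
      by (intro borel_measurable_times riesz_measurable[OF x_chain_dy[OF f]] x_chain_measurable[OF x_chain_dy[OF g]])
    from lborel_integral_swap[OF this] show ?thesis by (simp add: dy_0)
  qed
  finally show ?thesis by simp
qed

lemma form_commute:
  assumes "g \<in> Cc_inf (Omega a b c d)" "f \<in> Cc_inf (Omega a b c d)" "\<alpha> \<le> 2"
  shows "form \<alpha> a b c d g f = form \<alpha> a b c d f g"
  unfolding form_eq_riesz[OF assms] form_eq_riesz[OF assms(2,1,3)]
  by (intro arg_cong2[where f = "(+)"] riesz_form_symmetric[OF x_chain_dx[OF assms(1)] x_chain_dx[OF assms(2)] assms(3)]
      riesz_form_symmetric[OF x_chain_dy[OF assms(1)] x_chain_dy[OF assms(2)] assms(3)])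

lemma form_bounds:
  assumes \<alpha>: "1 < \<alpha>" "\<alpha> \<le> 2" and ab: "a < b" "c < d"
  obtains C where "C \<ge> 0" "\<And>f. f \<in> Cc_inf (Omega a b c d) \<Longrightarrow> 0 \<le> form \<alpha> a b c d f f"
    "\<And>f. f \<in> Cc_inf (Omega a b c d) \<Longrightarrow>
      form \<alpha> a b c d f f \<le> C * (Hs_semi2 \<alpha> f + (\<integral>p. (f p)\<^sup>2 \<partial>lebO a b c d))"
    "\<And>f. f \<in> Cc_inf (Omega a b c d) \<Longrightarrow>
      (\<integral>p. (f p)^4 \<partial>lebO a b c d) \<le> C * (Hs_semi2 \<alpha> f + (\<integral>p. (f p)\<^sup>2 \<partial>lebO a b c d))\<^sup>2"
proof -
  let ?\<Omega> = "Omega a b c d"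
  obtain C1 where C1: "\<And>f. x_chain a b c d f \<Longrightarrow> 0 \<le> (\<integral>p. f 0 p * riesz \<alpha> (b - a) (f 2) p \<partial>lborel)"
    "\<And>f. x_chain a b c d f \<Longrightarrow> ennreal (\<integral>p. f 0 p * riesz \<alpha> (b - a) (f 2) p \<partial>lborel) \<le> ennreal C1 * xenergy \<alpha> f"
    using riesz_form_bound[OF \<alpha> ab(1), where c = c and d = d] by metis
  obtain C2 where C2: "\<And>f. x_chain c d a b f \<Longrightarrow> 0 \<le> (\<integral>p. f 0 p * riesz \<alpha> (d - c) (f 2) p \<partial>lborel)"
    "\<And>f. x_chain c d a b f \<Longrightarrow> ennreal (\<integral>p. f 0 p * riesz \<alpha> (d - c) (f 2) p \<partial>lborel) \<le> ennreal C2 * xenergy \<alpha> f"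
    using riesz_form_bound[OF \<alpha> ab(2), where c = a and d = b] by metis
  obtain C3 where C3: "C3 \<ge> 0"
    "\<And>f. f \<in> Cc_inf ?\<Omega> \<Longrightarrow> xenergy \<alpha> (\<lambda>n. dx n f) \<le> ennreal (C3 * (Hs_semi2 \<alpha> f + (\<integral>p. (f p)\<^sup>2 \<partial>lborel)))"
    "\<And>f. f \<in> Cc_inf ?\<Omega> \<Longrightarrow> xenergy \<alpha> (\<lambda>n. dy n f) \<le> ennreal (C3 * (Hs_semi2 \<alpha> f + (\<integral>p. (f p)\<^sup>2 \<partial>lborel)))"
    using xenergy_le_Hs[OF \<alpha>] by metis
  obtain C4 where C4: "C4 \<ge> 0"
    "\<And>f. f \<in> Cc_inf ?\<Omega> \<Longrightarrow> (\<integral>\<^sup>+p. ennreal ((f p)^4) \<partial>lborel) \<le> ennreal C4 * (xenergy \<alpha> (\<lambda>n. dx n f) * xenergy \<alpha> (\<lambda>n. dy n f))"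
    using L4_le_energy[OF \<alpha>] by metis
  define D1 where "D1 = \<bar>C1\<bar> * C3 + \<bar>C2\<bar> * C3"
  define D2 where "D2 = C4 * C3\<^sup>2"
  have D: "D1 \<ge> 0" "D2 \<ge> 0" using C3(1) C4(1) by (simp_all add: D1_def D2_def)
  \<comment> \<open>The constants \<open>C1\<close> and \<open>C2\<close> come without a sign; the
    absolute value keeps \<open>ennreal\<close> from truncating a negative one to 0 when the bound
    is read back in the reals.\<close>
  have conv: "x \<le> \<bar>K\<bar> * C3 * G" if "ennreal x \<le> ennreal K * X" "X \<le> ennreal (C3 * G)" "G \<ge> 0" for x K X G
  proof -
    have "ennreal x \<le> ennreal \<bar>K\<bar> * ennreal (C3 * G)"
      using that by (intro order_trans[OF that(1)] mult_mono ennreal_leI) auto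
    also have "\<dots> = ennreal (\<bar>K\<bar> * C3 * G)" using that C3(1) by (simp add: ennreal_mult[symmetric] mult.assoc)
    finally show ?thesis using that(3) C3(1) by (simp add: ennreal_le_iff)
  qed
  show ?thesis
  proof (rule that[of "D1 + D2"])
    fix f assume f: "f \<in> Cc_inf ?\<Omega>"
    define G where "G = Hs_semi2 \<alpha> f + (\<integral>p. (f p)\<^sup>2 \<partial>lborel)"
    have G: "G \<ge> 0" by (simp add: G_def Hs_semi2_nonneg)
    have G_eq: "Hs_semi2 \<alpha> f + (\<integral>p. (f p)\<^sup>2 \<partial>lebO a b c d) = G"
      unfolding G_def by (subst integral_lebO_eq_lborel) (simp_all add: Cc_inf_chain(2)[OF f])
    note x = x_chain_dx[OF f] and y = x_chain_dy[OF f]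
    note feq = form_eq_riesz[OF f f \<alpha>(2)]
    show "0 \<le> form \<alpha> a b c d f f" unfolding feq using C1(1)[OF x] C2(1)[OF y] by simp
    have "form \<alpha> a b c d f f \<le> \<bar>C1\<bar> * C3 * G + \<bar>C2\<bar> * C3 * G"
      unfolding feq
      using conv[OF C1(2)[OF x] C3(2)[OF f, folded G_def] G] conv[OF C2(2)[OF y] C3(3)[OF f, folded G_def] G]
      by (intro add_mono)
    also have "\<dots> = D1 * G" by (simp add: D1_def distrib_right)
    also have "\<dots> \<le> (D1 + D2) * G" using D G by (intro mult_right_mono) auto
    finally show "form \<alpha> a b c d f f \<le> (D1 + D2) * (Hs_semi2 \<alpha> f + (\<integral>p. (f p)\<^sup>2 \<partial>lebO a b c d))"
      unfolding G_eq .
    have "ennreal (\<integral>p. (f p)^4 \<partial>lebO a b c d) = (\<integral>\<^sup>+p. ennreal ((f p)^4) \<partial>lebO a b c d)"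
      by (rule nn_integral_eq_integral[symmetric, OF Cc_inf_sqint(2)[OF f]]) auto
    also have "\<dots> = (\<integral>\<^sup>+p. ennreal ((f p)^4) * indicator ?\<Omega> p \<partial>lborel)"
      by (rule nn_integral_restrict_space) simp
    also have "\<dots> \<le> (\<integral>\<^sup>+p. ennreal ((f p)^4) \<partial>lborel)"
      by (intro nn_integral_mono) (auto simp: indicator_def)
    also have "\<dots> \<le> ennreal C4 * (ennreal (C3 * G) * ennreal (C3 * G))"
      using C3(2,3)[OF f, folded G_def] by (intro order_trans[OF C4(2)[OF f]] mult_left_mono mult_mono) auto
    also have "\<dots> = ennreal (D2 * G\<^sup>2)"
      using G C3(1) C4(1) by (simp add: D2_def ennreal_mult[symmetric] power2_eq_square mult_ac)
    finally have "(\<integral>p. (f p)^4 \<partial>lebO a b c d) \<le> D2 * G\<^sup>2" using D by (simp add: ennreal_le_iff)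
    also have "\<dots> \<le> (D1 + D2) * G\<^sup>2" using D by (intro mult_right_mono) auto
    finally show "(\<integral>p. (f p)^4 \<partial>lebO a b c d) \<le> (D1 + D2) * (Hs_semi2 \<alpha> f + (\<integral>p. (f p)\<^sup>2 \<partial>lebO a b c d))\<^sup>2"
      unfolding G_eq .
  qed (use D in simp)
qed

lemma form_lincomb_left:
  assumes "sqint (lebO a b c d) u" "sqint (lebO a b c d) v" "f \<in> Cc_inf (Omega a b c d)" "\<alpha> \<le> 2"
  shows "form \<alpha> a b c d (\<lambda>p. r * u p + s * v p) f = r * form \<alpha> a b c d u f + s * form \<alpha> a b c d v f"
proof -
  note i = sqint_mult[OF assms(1) frac_lap_sqint[OF assms(3,4)]] sqint_mult[OF assms(2) frac_lap_sqint[OF assms(3,4)]]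
  have "form \<alpha> a b c d (\<lambda>p. r * u p + s * v p) f
    = (\<integral>p. r * (u p * frac_lap \<alpha> a b c d f p) + s * (v p * frac_lap \<alpha> a b c d f p) \<partial>lebO a b c d)"
    unfolding form_def by (intro Bochner_Integration.integral_cong refl) (simp add: algebra_simps)
  also have "\<dots> = r * form \<alpha> a b c d u f + s * form \<alpha> a b c d v f"
    unfolding form_def using i by simp
  finally show ?thesis .
qed

lemma form_lincomb_self:
  assumes f: "f \<in> Cc_inf (Omega a b c d)" and g: "g \<in> Cc_inf (Omega a b c d)" and \<alpha>: "\<alpha> \<le> 2"
  shows "form \<alpha> a b c d (\<lambda>p. r * f p + s * g p) (\<lambda>p. r * f p + s * g p)
    = r\<^sup>2 * form \<alpha> a b c d f f + 2 * r * s * form \<alpha> a b c d f g + s\<^sup>2 * form \<alpha> a b c d g g"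
proof -
  let ?B = "form \<alpha> a b c d" and ?h = "\<lambda>p. r * f p + s * g p"
  note fs = Cc_inf_sqint(1)[OF f] and gs = Cc_inf_sqint(1)[OF g] and h = Cc_inf_lincomb[OF f g, of r s]
  have 1: "?B ?h ?h = r * ?B f ?h + s * ?B g ?h" by (rule form_lincomb_left[OF fs gs h \<alpha>])
  have 2: "?B f ?h = r * ?B f f + s * ?B g f"
    unfolding form_commute[OF f h \<alpha>] by (rule form_lincomb_left[OF fs gs f \<alpha>])
  have 3: "?B g ?h = r * ?B f g + s * ?B g g"
    unfolding form_commute[OF g h \<alpha>] by (rule form_lincomb_left[OF fs gs g \<alpha>])
  show ?thesis unfolding 1 2 3 form_commute[OF g f \<alpha>] by (simp add: power2_eq_square algebra_simps)
qed

section \<open>Energy estimates\<close>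

text \<open>Keeps of membership in \<open>H0\<close> what the limits use: L2 convergence and Cauchy
  conditions in the form and in L4. Both conditions pass to linear combinations by elementary
  inequalities, so midpoints and extrapolations are covered.\<close>

definition approximates :: "real \<Rightarrow> real \<Rightarrow> real \<Rightarrow> real \<Rightarrow> real \<Rightarrow> (nat \<Rightarrow> fn2) \<Rightarrow> fn2 \<Rightarrow> bool" where
  "approximates \<alpha> a b c d us u \<longleftrightarrow> (\<forall>k. us k \<in> Cc_inf (Omega a b c d)) \<and> sqint (lebO a b c d) u
     \<and> (\<lambda>k. \<integral>p. (us k p - u p)\<^sup>2 \<partial>lebO a b c d) \<longlonglongrightarrow> 0
     \<and> (\<forall>e>0. \<exists>N. \<forall>m\<ge>N. \<forall>n\<ge>N. form \<alpha> a b c d (\<lambda>p. us m p - us n p) (\<lambda>p. us m p - us n p) < e)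
     \<and> (\<forall>e>0. \<exists>N. \<forall>m\<ge>N. \<forall>n\<ge>N. (\<integral>p. (us m p - us n p)^4 \<partial>lebO a b c d) < e)"

lemma approximatesD:
  assumes "approximates \<alpha> a b c d us u"
  shows "us k \<in> Cc_inf (Omega a b c d)" "sqint (lebO a b c d) u"
    "(\<lambda>k. \<integral>p. (us k p - u p)\<^sup>2 \<partial>lebO a b c d) \<longlonglongrightarrow> 0"
    "e > 0 \<Longrightarrow> \<exists>N. \<forall>m\<ge>N. \<forall>n\<ge>N. form \<alpha> a b c d (\<lambda>p. us m p - us n p) (\<lambda>p. us m p - us n p) < e"
    "e > 0 \<Longrightarrow> \<exists>N. \<forall>m\<ge>N. \<forall>n\<ge>N. (\<integral>p. (us m p - us n p)^4 \<partial>lebO a b c d) < e"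
  using assms unfolding approximates_def by blast+

lemma Cc_inf_diff: "f \<in> Cc_inf S \<Longrightarrow> g \<in> Cc_inf S \<Longrightarrow> (\<lambda>p. f p - g p) \<in> Cc_inf S"
  using Cc_inf_lincomb[of f S g 1 "-1"] by simp

lemma cauchy_le_lincomb:
  fixes X Y Z :: "nat \<Rightarrow> nat \<Rightarrow> real"
  assumes Y: "\<And>e. e > 0 \<Longrightarrow> \<exists>N. \<forall>m\<ge>N. \<forall>n\<ge>N. Y m n < e"
    and Z: "\<And>e. e > 0 \<Longrightarrow> \<exists>N. \<forall>m\<ge>N. \<forall>n\<ge>N. Z m n < e"
    and X: "\<And>m n. X m n \<le> r * Y m n + s * Z m n" and "r \<ge> 0" "s \<ge> 0" "e > 0"
  shows "\<exists>N. \<forall>m\<ge>N. \<forall>n\<ge>N. X m n < e"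
proof -
  \<comment> \<open>The summand 1 avoids a zero denominator for \<open>r = s = 0\<close> and leaves
    room for the strict inequality.\<close>
  define e' where "e' = e / (r + s + 1)"
  have e': "e' > 0" using assms by (simp add: e'_def)
  obtain N1 N2 where N: "\<And>m n. m \<ge> N1 \<Longrightarrow> n \<ge> N1 \<Longrightarrow> Y m n < e'" "\<And>m n. m \<ge> N2 \<Longrightarrow> n \<ge> N2 \<Longrightarrow> Z m n < e'"
    using Y[OF e'] Z[OF e'] by blast
  have "X m n < e" if "m \<ge> max N1 N2" "n \<ge> max N1 N2" for m n
  proof -
    have "X m n \<le> r * e' + s * e'"
      using N[of m n] that assms(4,5) by (intro order_trans[OF X] add_mono mult_left_mono) auto
    also have "\<dots> = (r + s) * e'" by (simp add: distrib_right)
    also have "\<dots> < (r + s + 1) * e'" using e' by simp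
    also have "\<dots> = e" using assms(4,5) by (simp add: e'_def)
    finally show ?thesis .
  qed
  then show ?thesis by blast
qed

lemma integral_square_sum_le:
  assumes "sqint M u" "sqint M v"
  shows "(\<integral>p. (r * u p + s * v p)\<^sup>2 \<partial>M) \<le> 2 * r\<^sup>2 * (\<integral>p. (u p)\<^sup>2 \<partial>M) + 2 * s\<^sup>2 * (\<integral>p. (v p)\<^sup>2 \<partial>M)"
proof -
  have "(\<integral>p. (r * u p + s * v p)\<^sup>2 \<partial>M) \<le> (\<integral>p. 2 * r\<^sup>2 * (u p)\<^sup>2 + 2 * s\<^sup>2 * (v p)\<^sup>2 \<partial>M)"
  proof (rule integral_mono)
    show "(r * u p + s * v p)\<^sup>2 \<le> 2 * r\<^sup>2 * (u p)\<^sup>2 + 2 * s\<^sup>2 * (v p)\<^sup>2" for p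
      using sum_squares_bound[of "r * u p" "s * v p"] by (simp add: power2_sum power_mult_distrib)
  qed (use sqint_integrable[OF sqint_lincomb[OF assms]] assms in \<open>auto simp: sqint_def\<close>)
  also have "\<dots> = 2 * r\<^sup>2 * (\<integral>p. (u p)\<^sup>2 \<partial>M) + 2 * s\<^sup>2 * (\<integral>p. (v p)\<^sup>2 \<partial>M)"
    using assms by (simp add: sqint_def)
  finally show ?thesis .
qed

lemma H0_approximates:
  assumes \<alpha>: "1 < \<alpha>" "\<alpha> \<le> 2" and ab: "a < b" "c < d" and u: "H0 \<alpha> (Omega a b c d) u"
  shows "\<exists>us. approximates \<alpha> a b c d us u"
proof -
  let ?M = "lebO a b c d"
  obtain us where us: "\<And>k. us k \<in> Cc_inf (Omega a b c d)"
    "(\<lambda>k. L2norm (Omega a b c d) (\<lambda>p. us k p - u p)) \<longlonglongrightarrow> 0"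
    "\<And>e. e > 0 \<Longrightarrow> \<exists>N. \<forall>m\<ge>N. \<forall>n\<ge>N. Hs_semi2 \<alpha> (\<lambda>p. us m p - us n p) < e"
    and uL2: "inL2 (Omega a b c d) u"
    using u unfolding H0_def by blast
  have su: "sqint ?M u" by (rule inL2_sqint[OF uL2])
  have sus: "sqint ?M (us k)" for k by (rule Cc_inf_sqint(1)[OF us(1)])
  have lim: "(\<lambda>k. \<integral>p. (us k p - u p)\<^sup>2 \<partial>?M) \<longlonglongrightarrow> 0"
    using tendsto_power[OF us(2), of 2] unfolding L2norm_square by simp
  let ?D = "\<lambda>m n. \<integral>p. (us m p - us n p)\<^sup>2 \<partial>?M"
  have D: "\<exists>N. \<forall>m\<ge>N. \<forall>n\<ge>N. ?D m n < e" if "e > 0" for e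
  proof (rule cauchy_le_lincomb[where r = 2 and s = 2])
    fix e :: real assume "e > 0"
    then obtain N where N: "\<And>k. k \<ge> N \<Longrightarrow> (\<integral>p. (us k p - u p)\<^sup>2 \<partial>?M) < e"
      using LIMSEQ_D[OF lim] by fastforce
    then show "\<exists>N. \<forall>m\<ge>N. \<forall>n\<ge>N. (\<integral>p. (us m p - u p)\<^sup>2 \<partial>?M) < e" "\<exists>N. \<forall>m\<ge>N. \<forall>n\<ge>N. (\<integral>p. (us n p - u p)\<^sup>2 \<partial>?M) < e"
      by blast+
  next
    fix m n
    show "?D m n \<le> 2 * (\<integral>p. (us m p - u p)\<^sup>2 \<partial>?M) + 2 * (\<integral>p. (us n p - u p)\<^sup>2 \<partial>?M)"
      using integral_square_sum_le[OF sqint_diff[OF sus su] sqint_diff[OF sus su], of 1 m "-1" n] by simp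
  qed (use that in auto)
  define G where "G m n = Hs_semi2 \<alpha> (\<lambda>p. us m p - us n p) + ?D m n" for m n
  have G0: "G m n \<ge> 0" for m n by (simp add: G_def Hs_semi2_nonneg)
  have G: "\<exists>N. \<forall>m\<ge>N. \<forall>n\<ge>N. G m n < e" if "e > 0" for e
    by (rule cauchy_le_lincomb[OF us(3) D, where r = 1 and s = 1]) (use that in \<open>auto simp: G_def\<close>)
  obtain C where C: "C \<ge> 0" "\<And>f. f \<in> Cc_inf (Omega a b c d) \<Longrightarrow>
      form \<alpha> a b c d f f \<le> C * (Hs_semi2 \<alpha> f + (\<integral>p. (f p)\<^sup>2 \<partial>?M))"
    "\<And>f. f \<in> Cc_inf (Omega a b c d) \<Longrightarrow> (\<integral>p. (f p)^4 \<partial>?M) \<le> C * (Hs_semi2 \<alpha> f + (\<integral>p. (f p)\<^sup>2 \<partial>?M))\<^sup>2"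
    using form_bounds[OF \<alpha> ab] by metis
  \<comment> \<open>The fourth-power integral is bounded by the square of the squared Sobolev norm
    \<open>G\<close>, so the Cauchy property is needed for that square.\<close>
  have G2: "\<exists>N. \<forall>m\<ge>N. \<forall>n\<ge>N. (G m n)\<^sup>2 < e" if "e > 0" for e
  proof -
    obtain N where N: "\<And>m n. m \<ge> N \<Longrightarrow> n \<ge> N \<Longrightarrow> G m n < sqrt e" using G[of "sqrt e"] \<open>e > 0\<close> by auto
    have "(G m n)\<^sup>2 < e" if "m \<ge> N" "n \<ge> N" for m n
      using power_strict_mono[OF N[OF that] G0, of 2] \<open>e > 0\<close> by simp
    then show ?thesis by blast
  qed
  have "\<exists>N. \<forall>m\<ge>N. \<forall>n\<ge>N. form \<alpha> a b c d (\<lambda>p. us m p - us n p) (\<lambda>p. us m p - us n p) < e" if "e > 0" for e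
    by (rule cauchy_le_lincomb[OF G G, where r = C and s = 0])
      (use that C(1) C(2)[OF Cc_inf_diff[OF us(1) us(1)]] in \<open>auto simp: G_def\<close>)
  moreover have "\<exists>N. \<forall>m\<ge>N. \<forall>n\<ge>N. (\<integral>p. (us m p - us n p)^4 \<partial>?M) < e" if "e > 0" for e
    by (rule cauchy_le_lincomb[OF G2 G2, where r = C and s = 0])
      (use that C(1) C(3)[OF Cc_inf_diff[OF us(1) us(1)]] in \<open>auto simp: G_def\<close>)
  ultimately show ?thesis unfolding approximates_def using us(1) su lim by blast
qed

text \<open>The right side minus the left side is the value of the form at
  \<open>r * f - s * g\<close>, which is nonnegative.\<close>

lemma form_sum_le:
  assumes \<alpha>: "1 < \<alpha>" "\<alpha> \<le> 2" and ab: "a < b" "c < d"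
    and f: "f \<in> Cc_inf (Omega a b c d)" and g: "g \<in> Cc_inf (Omega a b c d)"
  shows "form \<alpha> a b c d (\<lambda>p. r * f p + s * g p) (\<lambda>p. r * f p + s * g p)
    \<le> 2 * r\<^sup>2 * form \<alpha> a b c d f f + 2 * s\<^sup>2 * form \<alpha> a b c d g g"
proof -
  have "0 \<le> form \<alpha> a b c d (\<lambda>p. r * f p + (- s) * g p) (\<lambda>p. r * f p + (- s) * g p)"
    using form_bounds[OF \<alpha> ab] Cc_inf_lincomb[OF f g] by metis
  then show ?thesis unfolding form_lincomb_self[OF f g \<alpha>(2)] by simp
qed

lemma approximates_lincomb:
  assumes \<alpha>: "1 < \<alpha>" "\<alpha> \<le> 2" and ab: "a < b" "c < d"
    and u: "approximates \<alpha> a b c d us u" and v: "approximates \<alpha> a b c d vs v"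
  shows "approximates \<alpha> a b c d (\<lambda>k p. r * us k p + s * vs k p) (\<lambda>p. r * u p + s * v p)"
proof -
  let ?M = "lebO a b c d"
  note uD = approximatesD[OF u] and vD = approximatesD[OF v]
  have su: "sqint ?M (us k)" and sv: "sqint ?M (vs k)" for k
    by (rule Cc_inf_sqint(1)[OF uD(1)], rule Cc_inf_sqint(1)[OF vD(1)])
  have split: "r * x + s * y - (r * x' + s * y') = r * (x - x') + s * (y - y')" for x y x' y' :: real
    by (simp add: algebra_simps)
  have L2: "(\<lambda>k. \<integral>p. (r * us k p + s * vs k p - (r * u p + s * v p))\<^sup>2 \<partial>?M) \<longlonglongrightarrow> 0"
  proof (rule tendsto_sandwich[where f = "\<lambda>_. 0"])
    show "\<forall>\<^sub>F k in sequentially. (\<integral>p. (r * us k p + s * vs k p - (r * u p + s * v p))\<^sup>2 \<partial>?M)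
       \<le> 2 * r\<^sup>2 * (\<integral>p. (us k p - u p)\<^sup>2 \<partial>?M) + 2 * s\<^sup>2 * (\<integral>p. (vs k p - v p)\<^sup>2 \<partial>?M)"
      unfolding split
      by (intro always_eventually allI integral_square_sum_le sqint_diff[OF su uD(2)] sqint_diff[OF sv vD(2)])
    show "(\<lambda>k. 2 * r\<^sup>2 * (\<integral>p. (us k p - u p)\<^sup>2 \<partial>?M) + 2 * s\<^sup>2 * (\<integral>p. (vs k p - v p)\<^sup>2 \<partial>?M)) \<longlonglongrightarrow> 0"
      using tendsto_add[OF tendsto_mult_left[OF uD(3), of "2 * r\<^sup>2"] tendsto_mult_left[OF vD(3), of "2 * s\<^sup>2"]] by simp
  qed auto
  have F: "\<exists>N. \<forall>m\<ge>N. \<forall>n\<ge>N. form \<alpha> a b c d (\<lambda>p. r * us m p + s * vs m p - (r * us n p + s * vs n p))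
      (\<lambda>p. r * us m p + s * vs m p - (r * us n p + s * vs n p)) < e" if "e > 0" for e
    unfolding split
    by (rule cauchy_le_lincomb[OF uD(4) vD(4) form_sum_le[OF \<alpha> ab Cc_inf_diff[OF uD(1) uD(1)] Cc_inf_diff[OF vD(1) vD(1)]]])
      (use that in auto)
  have Q: "\<exists>N. \<forall>m\<ge>N. \<forall>n\<ge>N. (\<integral>p. (r * us m p + s * vs m p - (r * us n p + s * vs n p))^4 \<partial>?M) < e" if "e > 0" for e
    unfolding split
  proof (rule cauchy_le_lincomb[OF uD(5) vD(5), where r = "8 * r^4" and s = "8 * s^4"])
    fix m n
    note du = Cc_inf_diff[OF uD(1)[of m] uD(1)[of n]] and dv = Cc_inf_diff[OF vD(1)[of m] vD(1)[of n]]
    have "(\<integral>p. (r * (us m p - us n p) + s * (vs m p - vs n p))^4 \<partial>?M)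
      \<le> (\<integral>p. 8 * r^4 * (us m p - us n p)^4 + 8 * s^4 * (vs m p - vs n p)^4 \<partial>?M)"
    proof (rule integral_mono)
      show "(r * (us m p - us n p) + s * (vs m p - vs n p))^4 \<le> 8 * r^4 * (us m p - us n p)^4 + 8 * s^4 * (vs m p - vs n p)^4" for p
        using power4_diff_le[of "r * (us m p - us n p)" "- (s * (vs m p - vs n p))"] by (simp add: power_mult_distrib)
    qed (use Cc_inf_sqint(2)[OF du, of 4] Cc_inf_sqint(2)[OF dv, of 4] Cc_inf_sqint(2)[OF Cc_inf_lincomb[OF du dv], of r s 4] in auto)
    then show "(\<integral>p. (r * (us m p - us n p) + s * (vs m p - vs n p))^4 \<partial>?M)
      \<le> 8 * r^4 * (\<integral>p. (us m p - us n p)^4 \<partial>?M) + 8 * s^4 * (\<integral>p. (vs m p - vs n p)^4 \<partial>?M)"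
      using Cc_inf_sqint(2)[OF du, of 4] Cc_inf_sqint(2)[OF dv, of 4] by simp
  qed (use that in auto)
  show ?thesis
    unfolding approximates_def
    using Cc_inf_lincomb[OF uD(1) vD(1)] sqint_lincomb[OF uD(2) vD(2)] L2 F Q by blast
qed

lemma approximates_L4:
  assumes "approximates \<alpha> a b c d us u"
  shows "(\<integral>\<^sup>+p. ennreal ((u p)^4) \<partial>lebO a b c d) < \<infinity>"
    and "e > 0 \<Longrightarrow> \<exists>N. \<forall>m\<ge>N. (\<integral>\<^sup>+p. ennreal ((us m p - u p)^4) \<partial>lebO a b c d) \<le> ennreal e"
    and "(\<integral>\<^sup>+p. ennreal ((us k p)^4) \<partial>lebO a b c d) < \<infinity>"
proof -
  let ?M = "lebO a b c d"
  note uD = approximatesD[OF assms]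
  have su: "sqint ?M (us k)" for k by (rule Cc_inf_sqint(1)[OF uD(1)])
  have nn: "(\<integral>\<^sup>+p. ennreal ((f p)^4) \<partial>?M) = ennreal (\<integral>p. (f p)^4 \<partial>?M)" if "f \<in> Cc_inf (Omega a b c d)" for f
    by (rule nn_integral_eq_integral[OF Cc_inf_sqint(2)[OF that]]) auto
  show fin: "(\<integral>\<^sup>+p. ennreal ((us k p)^4) \<partial>?M) < \<infinity>" for k by (simp add: nn[OF uD(1)])
  have cau: "\<exists>N. \<forall>m\<ge>N. \<forall>n\<ge>N. (\<integral>\<^sup>+p. ennreal ((us m p - us n p)^4) \<partial>?M) < ennreal e" if "e > 0" for e
    using uD(5)[OF that] that by (simp add: nn[OF Cc_inf_diff[OF uD(1) uD(1)]] ennreal_less_iff)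
  have lim: "\<exists>N. \<forall>m\<ge>N. (\<integral>\<^sup>+p. ennreal ((us m p - u p)^4) \<partial>?M) \<le> ennreal e" if "e > 0" for e
    by (rule L4_limit[OF uD(2) su uD(3) cau that])
  then show "e > 0 \<Longrightarrow> \<exists>N. \<forall>m\<ge>N. (\<integral>\<^sup>+p. ennreal ((us m p - u p)^4) \<partial>?M) \<le> ennreal e" .
  obtain N where N: "(\<integral>\<^sup>+p. ennreal ((us N p - u p)^4) \<partial>?M) \<le> ennreal 1" using lim[of 1] by auto
  show "(\<integral>\<^sup>+p. ennreal ((u p)^4) \<partial>?M) < \<infinity>"
    by (rule fourth_finite_of_diff[OF sqint_measurable[OF uD(2)] sqint_measurable[OF su] fin[of N] le_less_trans[OF N]]) simp
qed

text \<open>The Cauchy condition compares all late members with \<open>us N\<close>. The bound is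
  what absorbs the second argument in \<open>form_cross_limit\<close>.\<close>

lemma approximates_form_bounded:
  assumes \<alpha>: "1 < \<alpha>" "\<alpha> \<le> 2" and ab: "a < b" "c < d" and u: "approximates \<alpha> a b c d us u"
  obtains K N where "K > 0" "\<And>k. k \<ge> N \<Longrightarrow> form \<alpha> a b c d (us k) (us k) \<le> K"
proof -
  let ?B = "form \<alpha> a b c d"
  note uD = approximatesD[OF u]
  have pos: "0 \<le> ?B f f" if "f \<in> Cc_inf (Omega a b c d)" for f using form_bounds[OF \<alpha> ab] that by metis
  obtain N where N: "\<And>m n. m \<ge> N \<Longrightarrow> n \<ge> N \<Longrightarrow> ?B (\<lambda>p. us m p - us n p) (\<lambda>p. us m p - us n p) < 1"
    using uD(4)[of 1] by auto
  show ?thesis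
  proof (rule that[of "2 * ?B (us N) (us N) + 2" N])
    show "2 * ?B (us N) (us N) + 2 > 0" using pos[OF uD(1)[of N]] by simp
    fix k assume k: "k \<ge> N"
    have "?B (us k) (us k) \<le> 2 * ?B (us N) (us N) + 2 * ?B (\<lambda>p. us k p - us N p) (\<lambda>p. us k p - us N p)"
      using form_sum_le[OF \<alpha> ab uD(1)[of N] Cc_inf_diff[OF uD(1)[of k] uD(1)[of N]], of 1 1] by simp
    with N[OF k, of N] show "?B (us k) (us k) \<le> 2 * ?B (us N) (us N) + 2" by simp
  qed
qed

text \<open>Here both arguments vary with \<open>k\<close>, and the L2 norms of the Laplacians of
  \<open>ws k\<close> need not stay bounded, so L2 convergence of \<open>us\<close> is not enough.
  The difference is instead estimated in energy for \<open>us m\<close> in place of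
  \<open>u\<close>, uniformly in \<open>m\<close>, and then \<open>m\<close> tends to infinity with
  \<open>k\<close> fixed.\<close>

lemma form_cross_limit:
  assumes \<alpha>: "1 < \<alpha>" "\<alpha> \<le> 2" and ab: "a < b" "c < d"
    and u: "approximates \<alpha> a b c d us u" and w: "approximates \<alpha> a b c d ws w"
  shows "(\<lambda>k. form \<alpha> a b c d u (ws k) - form \<alpha> a b c d (us k) (ws k)) \<longlonglongrightarrow> 0"
proof (rule LIMSEQ_I)
  fix e :: real assume e: "e > 0"
  let ?B = "form \<alpha> a b c d" and ?M = "lebO a b c d"
  note uD = approximatesD[OF u] and wD = approximatesD[OF w]
  have su: "sqint ?M (us k)" for k by (rule Cc_inf_sqint(1)[OF uD(1)])
  have pos: "0 \<le> ?B f f" if "f \<in> Cc_inf (Omega a b c d)" for f using form_bounds[OF \<alpha> ab] that by metis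
  obtain K N1 where K: "K > 0" "\<And>k. k \<ge> N1 \<Longrightarrow> ?B (ws k) (ws k) \<le> K"
    using approximates_form_bounded[OF \<alpha> ab w] by metis
  \<comment> \<open>Chosen so that \<open>t\<^sup>2 * K\<close> equals \<open>e * t / 2\<close>, the
    tolerance demanded of the energy of the differences; the sum is then
    \<open>2 * t * (e / 2)\<close>.\<close>
  define t where "t = e / (2 * K)"
  have t: "t > 0" using e K by (simp add: t_def)
  have young: "2 * t * \<bar>?B f g\<bar> \<le> ?B f f + t\<^sup>2 * ?B g g" if "f \<in> Cc_inf (Omega a b c d)" "g \<in> Cc_inf (Omega a b c d)" for f g
  proof -
    have "0 \<le> ?B f f + 2 * t * ?B f g + t\<^sup>2 * ?B g g" "0 \<le> ?B f f - 2 * t * ?B f g + t\<^sup>2 * ?B g g"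
      using pos[OF Cc_inf_lincomb[OF that, of 1 t]] pos[OF Cc_inf_lincomb[OF that, of 1 "- t"]]
      unfolding form_lincomb_self[OF that \<alpha>(2)] by simp_all
    then show ?thesis using t by (simp add: abs_if)
  qed
  have et: "e * t / 2 > 0" using e t by simp
  obtain N2 where N2: "\<And>m n. m \<ge> N2 \<Longrightarrow> n \<ge> N2 \<Longrightarrow> ?B (\<lambda>p. us m p - us n p) (\<lambda>p. us m p - us n p) < e * t / 2"
    using uD(4)[OF et] by blast
  have "norm (?B u (ws k) - ?B (us k) (ws k) - 0) < e" if k: "k \<ge> max N1 N2" for k
  proof -
    have "\<bar>?B (us m) (ws k) - ?B (us k) (ws k)\<bar> \<le> e / 2" if m: "m \<ge> N2" for m
    proof -
      have "2 * t * \<bar>?B (\<lambda>p. us m p - us k p) (ws k)\<bar> \<le> e * t / 2 + t\<^sup>2 * K"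
        using N2[of m k] m k K(2)[of k]
        by (intro order_trans[OF young[OF Cc_inf_diff[OF uD(1) uD(1)] wD(1)]] add_mono mult_left_mono) auto
      also have "e * t / 2 + t\<^sup>2 * K = 2 * t * (e / 2)"
        using K(1) by (simp add: t_def power2_eq_square field_simps)
      finally have "\<bar>?B (\<lambda>p. us m p - us k p) (ws k)\<bar> \<le> e / 2" using t by (simp only: mult_le_cancel_left_pos)
      moreover have "?B (\<lambda>p. us m p - us k p) (ws k) = ?B (us m) (ws k) - ?B (us k) (ws k)"
        using form_lincomb_left[OF su[of m] su[of k] wD(1)[of k] \<alpha>(2), of 1 "-1"] by simp
      ultimately show ?thesis by simp
    qed
    then have ev: "\<forall>\<^sub>F m in sequentially. \<bar>?B (us m) (ws k) - ?B (us k) (ws k)\<bar> \<le> e / 2"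
      unfolding eventually_sequentially by blast
    \<comment> \<open>For fixed \<open>k\<close> the Laplacian of \<open>ws k\<close> is one L2
      function, so L2 convergence suffices.\<close>
    have "(\<lambda>m. \<integral>p. frac_lap \<alpha> a b c d (ws k) p * us m p \<partial>?M) \<longlonglongrightarrow> (\<integral>p. frac_lap \<alpha> a b c d (ws k) p * u p \<partial>?M)"
      by (rule integral_mult_tendsto[OF frac_lap_sqint[OF wD(1) \<alpha>(2)] uD(2) su uD(3)])
    then have "(\<lambda>m. ?B (us m) (ws k)) \<longlonglongrightarrow> ?B u (ws k)" by (simp add: form_def mult.commute)
    then have "(\<lambda>m. \<bar>?B (us m) (ws k) - ?B (us k) (ws k)\<bar>) \<longlonglongrightarrow> \<bar>?B u (ws k) - ?B (us k) (ws k)\<bar>"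
      by (intro tendsto_rabs tendsto_diff tendsto_const)
    then have "\<bar>?B u (ws k) - ?B (us k) (ws k)\<bar> \<le> e / 2"
      by (rule tendsto_upperbound[OF _ ev]) simp
    with e show ?thesis by simp
  qed
  then show "\<exists>N. \<forall>k\<ge>N. norm (?B u (ws k) - ?B (us k) (ws k) - 0) < e" by blast
qed

text \<open>\<open>E\<close> stands for the form energy of the midpoint \<open>u\<close>. One and
  the same value occurs in both inequalities, as a gain in the first and a loss in the second, so
  that the two can be balanced later.\<close>

lemma energy_step:
  assumes \<alpha>: "1 < \<alpha>" "\<alpha> \<le> 2" and ab: "a < b" "c < d"
    and u: "approximates \<alpha> a b c d us u" and v: "approximates \<alpha> a b c d vs v" and q: "approximates \<alpha> a b c d qs q"
    and du: "sqint (lebO a b c d) du" and dv: "sqint (lebO a b c d) dv"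
    and \<mu>: "\<mu>u > 0" "\<mu>v > 0"
    and eqU: "\<And>\<phi>. \<phi> \<in> Cc_inf (Omega a b c d) \<Longrightarrow> (\<integral>p. du p * \<phi> p \<partial>lebO a b c d) = - \<mu>u * form \<alpha> a b c d u \<phi>
       - (\<integral>p. u p * (q p)\<^sup>2 * \<phi> p \<partial>lebO a b c d) + (\<integral>p. F * (1 - u p) * \<phi> p \<partial>lebO a b c d)"
    and eqV: "\<And>\<phi>. \<phi> \<in> Cc_inf (Omega a b c d) \<Longrightarrow> (\<integral>p. dv p * \<phi> p \<partial>lebO a b c d) = - \<mu>v * form \<alpha> a b c d v \<phi>
       + (\<integral>p. u p * (q p)\<^sup>2 * \<phi> p \<partial>lebO a b c d) - (\<integral>p. (F + \<kappa>) * v p * \<phi> p \<partial>lebO a b c d)"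
  obtains E where "E \<ge> 0"
    "(\<integral>p. du p * u p \<partial>lebO a b c d) \<le> - \<mu>u * E + (\<integral>p. F * (1 - u p) * u p \<partial>lebO a b c d)"
    "(\<integral>p. (du p + dv p) * (u p + v p) \<partial>lebO a b c d) \<le> (\<mu>v - \<mu>u)\<^sup>2 / (4 * \<mu>v) * E
       + (\<integral>p. F * (1 - u p) * (u p + v p) \<partial>lebO a b c d) - (\<integral>p. (F + \<kappa>) * v p * (u p + v p) \<partial>lebO a b c d)"
proof -
  let ?M = "lebO a b c d" and ?B = "form \<alpha> a b c d"
  note uD = approximatesD[OF u] and vD = approximatesD[OF v] and qD = approximatesD[OF q]
  have pos: "0 \<le> ?B f f" if "f \<in> Cc_inf (Omega a b c d)" for f using form_bounds[OF \<alpha> ab] that by metis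
  have su: "sqint ?M (us k)" and sv: "sqint ?M (vs k)" for k
    by (rule Cc_inf_sqint(1)[OF uD(1)], rule Cc_inf_sqint(1)[OF vD(1)])
  have F1: "sqint ?M (\<lambda>p. F * (1 - u p))"
    using sqint_lincomb[OF sqint_const uD(2), of 1 F "- F"] by (simp add: algebra_simps)
  have Fv: "sqint ?M (\<lambda>p. (F + \<kappa>) * v p)"
    using sqint_lincomb[OF vD(2) vD(2), of "F + \<kappa>" 0] by simp
  define w where "w p = u p + v p" for p
  define ws where "ws k p = us k p + vs k p" for k p
  have w: "approximates \<alpha> a b c d ws w"
    using approximates_lincomb[OF \<alpha> ab u v, of 1 1] by (simp add: w_def[abs_def] ws_def[abs_def])
  note wD = approximatesD[OF w]
  have sw: "sqint ?M (ws k)" for k by (rule Cc_inf_sqint(1)[OF wD(1)])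
  note limu = integral_mult_tendsto[OF _ uD(2) su uD(3)] and limw = integral_mult_tendsto[OF _ wD(2) sw wD(3)]
  have nl: "(\<lambda>k. \<integral>p. u p * (q p)\<^sup>2 * us k p \<partial>?M) \<longlonglongrightarrow> (\<integral>p. (u p)\<^sup>2 * (q p)\<^sup>2 \<partial>?M)"
    by (rule L4_product_tendsto[OF uD(2) su approximates_L4(1)[OF u] sqint_measurable[OF qD(2)]
          approximates_L4(1)[OF q] approximates_L4(3)[OF u] approximates_L4(2)[OF u]])
  \<comment> \<open>\<open>R\<close> collects the limits of all terms of the first equation other
    than diffusion, tested with \<open>us k\<close>; the equation then forces the form to converge
    to \<open>R / \<mu>u\<close>.\<close>
  define R where "R = - (\<integral>p. du p * u p \<partial>?M) - (\<integral>p. (u p)\<^sup>2 * (q p)\<^sup>2 \<partial>?M) + (\<integral>p. F * (1 - u p) * u p \<partial>?M)"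
  define E where "E = R / \<mu>u"
  have "(\<lambda>k. - (\<integral>p. du p * us k p \<partial>?M) - (\<integral>p. u p * (q p)\<^sup>2 * us k p \<partial>?M) + (\<integral>p. F * (1 - u p) * us k p \<partial>?M)) \<longlonglongrightarrow> R"
    unfolding R_def by (intro tendsto_intros nl limu[OF du] limu[OF F1])
  moreover have "- (\<integral>p. du p * us k p \<partial>?M) - (\<integral>p. u p * (q p)\<^sup>2 * us k p \<partial>?M) + (\<integral>p. F * (1 - u p) * us k p \<partial>?M) = \<mu>u * ?B u (us k)" for k
    using eqU[OF uD(1)[of k]] by simp
  ultimately have "(\<lambda>k. \<mu>u * ?B u (us k)) \<longlonglongrightarrow> R" by simp
  from tendsto_mult_left[OF this, of "1 / \<mu>u"] have "(\<lambda>k. ?B u (us k)) \<longlonglongrightarrow> E" using \<mu> by (simp add: E_def)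
  from tendsto_diff[OF this form_cross_limit[OF \<alpha> ab u u]]
  have BE: "(\<lambda>k. ?B (us k) (us k)) \<longlonglongrightarrow> E" by simp
  have E0: "E \<ge> 0" by (rule tendsto_lowerbound[OF BE]) (auto intro: always_eventually pos[OF uD(1)])
  \<comment> \<open>Tested with \<open>u\<close> the cubic reaction has a favourable sign and is
    dropped; no size bound on \<open>q\<close> enters the estimate.\<close>
  have "(\<integral>p. (u p)\<^sup>2 * (q p)\<^sup>2 \<partial>?M) \<ge> 0" by simp
  moreover have "\<mu>u * E = R" using \<mu> by (simp add: E_def)
  ultimately have 1: "(\<integral>p. du p * u p \<partial>?M) \<le> - \<mu>u * E + (\<integral>p. F * (1 - u p) * u p \<partial>?M)"
    unfolding R_def by simp
  define \<delta> where "\<delta> = \<mu>v - \<mu>u"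
  define X where "X k = (\<integral>p. du p * ws k p \<partial>?M) + (\<integral>p. dv p * ws k p \<partial>?M)
     - (\<integral>p. F * (1 - u p) * ws k p \<partial>?M) + (\<integral>p. (F + \<kappa>) * v p * ws k p \<partial>?M)" for k
  have Xlim: "X \<longlonglongrightarrow> (\<integral>p. du p * w p \<partial>?M) + (\<integral>p. dv p * w p \<partial>?M)
     - (\<integral>p. F * (1 - u p) * w p \<partial>?M) + (\<integral>p. (F + \<kappa>) * v p * w p \<partial>?M)"
    unfolding X_def by (intro tendsto_intros limw[OF du] limw[OF dv] limw[OF F1] limw[OF Fv])
  \<comment> \<open>The first two terms are the errors made by replacing \<open>u\<close> and
    \<open>v\<close> in the first argument by test functions; they vanish in the limit and leave
    only the last term.\<close>
  define Y where "Y k = - \<mu>u * (?B u (ws k) - ?B (us k) (ws k)) - \<mu>v * (?B v (ws k) - ?B (vs k) (ws k))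
     + \<delta>\<^sup>2 / (4 * \<mu>v) * ?B (us k) (us k)" for k
  have "Y \<longlonglongrightarrow> - \<mu>u * 0 - \<mu>v * 0 + \<delta>\<^sup>2 / (4 * \<mu>v) * E"
    unfolding Y_def by (intro tendsto_intros form_cross_limit[OF \<alpha> ab u w] form_cross_limit[OF \<alpha> ab v w] BE)
  then have Ylim: "Y \<longlonglongrightarrow> \<delta>\<^sup>2 / (4 * \<mu>v) * E" by simp
  have XY: "X k \<le> Y k" for k
  proof -
    have X: "X k = - \<mu>u * ?B u (ws k) - \<mu>v * ?B v (ws k)"
      unfolding X_def using eqU[OF wD(1)[of k]] eqV[OF wD(1)[of k]] by simp
    have sum: "?B (ws k) (ws k) = ?B (us k) (ws k) + ?B (vs k) (ws k)"
      using form_lincomb_left[OF su[of k] sv[of k] wD(1)[of k] \<alpha>(2), of 1 1] by (simp add: ws_def[abs_def])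
    \<comment> \<open>With \<open>v = w - u\<close> the diffusion terms become
      \<open>\<delta> * B(u, w) - \<mu>v * B(w, w)\<close>. The combination is chosen so that its
      energy divided by \<open>4 * \<mu>v\<close> completes this square and leaves
      \<open>\<delta>\<^sup>2 / (4 * \<mu>v) * B(u, u)\<close>.\<close>
    have "0 \<le> ?B (\<lambda>p. \<delta> * us k p + (- 2 * \<mu>v) * ws k p) (\<lambda>p. \<delta> * us k p + (- 2 * \<mu>v) * ws k p)"
      by (rule pos[OF Cc_inf_lincomb[OF uD(1) wD(1)]])
    then have "0 \<le> \<delta>\<^sup>2 * ?B (us k) (us k) - 4 * \<mu>v * \<delta> * ?B (us k) (ws k) + 4 * \<mu>v\<^sup>2 * ?B (ws k) (ws k)"
      unfolding form_lincomb_self[OF uD(1) wD(1) \<alpha>(2)] by (simp add: power_mult_distrib mult_ac)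
    then have "0 \<le> (\<delta>\<^sup>2 * ?B (us k) (us k) - 4 * \<mu>v * \<delta> * ?B (us k) (ws k) + 4 * \<mu>v\<^sup>2 * ?B (ws k) (ws k)) / (4 * \<mu>v)"
      using \<mu> by simp
    also have "\<dots> = \<delta>\<^sup>2 / (4 * \<mu>v) * ?B (us k) (us k) - \<delta> * ?B (us k) (ws k) + \<mu>v * ?B (ws k) (ws k)"
      using \<mu> by (simp add: field_simps power2_eq_square)
    finally show ?thesis unfolding X Y_def sum \<delta>_def by (simp add: algebra_simps)
  qed
  have 2: "(\<integral>p. du p * w p \<partial>?M) + (\<integral>p. dv p * w p \<partial>?M)
     - (\<integral>p. F * (1 - u p) * w p \<partial>?M) + (\<integral>p. (F + \<kappa>) * v p * w p \<partial>?M) \<le> \<delta>\<^sup>2 / (4 * \<mu>v) * E"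
    by (rule tendsto_le[OF _ Ylim Xlim]) (auto intro: always_eventually XY)
  have "(\<integral>p. (du p + dv p) * w p \<partial>?M) = (\<integral>p. du p * w p \<partial>?M) + (\<integral>p. dv p * w p \<partial>?M)"
    unfolding distrib_right by (intro Bochner_Integration.integral_add sqint_mult[OF du wD(2)] sqint_mult[OF dv wD(2)])
  with 2 have "(\<integral>p. (du p + dv p) * w p \<partial>?M) \<le> \<delta>\<^sup>2 / (4 * \<mu>v) * E
       + (\<integral>p. F * (1 - u p) * w p \<partial>?M) - (\<integral>p. (F + \<kappa>) * v p * w p \<partial>?M)" by simp
  with E0 1 show ?thesis by (intro that[of E]) (simp_all add: w_def \<delta>_def)
qed

text \<open>The induction carries the accumulated dissipation \<open>S\<close>, the sum of
  \<open>\<tau> * E\<close> over past steps. The first estimate keeps \<open>2 * \<mu>u * S\<close>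
  on its left side, while the second owes \<open>2 * cE * S\<close>, so one bound on
  \<open>S\<close> at the end settles the debt whatever the step size.\<close>

lemma time_induction:
  fixes x y :: "nat \<Rightarrow> real"
  assumes pos: "\<tau> > 0" "\<mu>u > 0" "cF \<ge> 0" "cE \<ge> 0" "\<kappa> \<ge> 0" and x: "\<And>n. x n \<ge> 0" and T: "real M * \<tau> \<le> T"
    and step: "\<And>n. n < M \<Longrightarrow> \<exists>E\<ge>0. x (Suc n) \<le> x n - 2 * \<tau> * \<mu>u * E + \<tau> * cF
      \<and> y (Suc n) \<le> y n + 2 * \<tau> * (cE * E) + \<tau> * cF + \<tau> * (\<kappa> / 2) * ((x n + x (Suc n)) / 2)"
    and n: "n \<le> M"
  shows "x n \<le> x 0 + T * cF \<and> y n \<le> y 0 + cE / \<mu>u * (x 0 + T * cF) + T * cF + T * (\<kappa> / 2) * (x 0 + T * cF)"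
proof -
  define X where "X = x 0 + T * cF"
  have le_T: "real k * \<tau> \<le> T" if "k \<le> M" for k
    using that pos(1) by (intro order_trans[OF mult_right_mono T]) auto
  have T0: "T \<ge> 0" using le_T[of 0] by simp
  have "\<exists>S\<ge>0. x n + 2 * \<mu>u * S \<le> x 0 + real n * \<tau> * cF
      \<and> y n \<le> y 0 + 2 * cE * S + real n * \<tau> * cF + real n * \<tau> * (\<kappa> / 2) * X"
    using n
  proof (induction n)
    case 0
    show ?case by (rule exI[of _ 0]) simp
  next
    case (Suc n)
    then obtain S where S: "S \<ge> 0" "x n + 2 * \<mu>u * S \<le> x 0 + real n * \<tau> * cF"
      "y n \<le> y 0 + 2 * cE * S + real n * \<tau> * cF + real n * \<tau> * (\<kappa> / 2) * X" by auto
    obtain E where E: "E \<ge> 0" "x (Suc n) \<le> x n - 2 * \<tau> * \<mu>u * E + \<tau> * cF"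
      "y (Suc n) \<le> y n + 2 * \<tau> * (cE * E) + \<tau> * cF + \<tau> * (\<kappa> / 2) * ((x n + x (Suc n)) / 2)"
      using step[of n] Suc.prems by auto
    have x1: "x (Suc n) + 2 * \<mu>u * (S + \<tau> * E) \<le> x 0 + real (Suc n) * \<tau> * cF"
      using S(2) E(2) by (simp add: algebra_simps)
    have "x n \<le> x 0 + real n * \<tau> * cF" by (rule order_trans[OF _ S(2)]) (use pos S(1) in simp)
    moreover have "x (Suc n) \<le> x 0 + real (Suc n) * \<tau> * cF"
      by (rule order_trans[OF _ x1]) (use pos S(1) E(1) in simp)
    moreover have "real k * \<tau> * cF \<le> T * cF" if "k \<le> M" for k
      using le_T[OF that] pos by (intro mult_right_mono) auto
    ultimately have "x n \<le> X" "x (Suc n) \<le> X" using Suc.prems unfolding X_def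
      by (meson Suc_leD add_left_mono order_trans)+
    \<comment> \<open>Both values are bounded by the first estimate, so the \<kappa> term adds at
      most a fixed amount per step and the bound grows linearly in time.\<close>
    then have "(x n + x (Suc n)) / 2 \<le> X" by simp
    then have avg: "\<tau> * (\<kappa> / 2) * ((x n + x (Suc n)) / 2) \<le> \<tau> * (\<kappa> / 2) * X"
      using pos by (intro mult_left_mono) auto
    have "y (Suc n) \<le> (y 0 + 2 * cE * S + real n * \<tau> * cF + real n * \<tau> * (\<kappa> / 2) * X)
        + 2 * \<tau> * (cE * E) + \<tau> * cF + \<tau> * (\<kappa> / 2) * X"
      by (intro order_trans[OF E(3)] add_mono S(3) avg order_refl)
    also have "\<dots> = y 0 + 2 * cE * (S + \<tau> * E) + real (Suc n) * \<tau> * cF + real (Suc n) * \<tau> * (\<kappa> / 2) * X"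
      by (simp add: algebra_simps add_divide_distrib)
    finally have "y (Suc n) \<le> y 0 + 2 * cE * (S + \<tau> * E) + real (Suc n) * \<tau> * cF + real (Suc n) * \<tau> * (\<kappa> / 2) * X" .
    with x1 S(1) E(1) pos show ?case by (intro exI[of _ "S + \<tau> * E"]) auto
  qed
  then obtain S where S: "S \<ge> 0" "x n + 2 * \<mu>u * S \<le> x 0 + real n * \<tau> * cF"
    "y n \<le> y 0 + 2 * cE * S + real n * \<tau> * cF + real n * \<tau> * (\<kappa> / 2) * X" by blast
  have X0: "X \<ge> 0" using x[of 0] T0 pos by (simp add: X_def)
  have nT: "real n * \<tau> * cF \<le> T * cF" "real n * \<tau> * (\<kappa> / 2) * X \<le> T * (\<kappa> / 2) * X"
    using le_T[OF n] pos X0 by (auto intro!: mult_right_mono)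
  have "2 * \<mu>u * S \<ge> 0" using pos S(1) by simp
  then have xX: "x n \<le> X" using S(2) nT(1) unfolding X_def by linarith
  have "2 * \<mu>u * S \<le> X" using S(2) nT(1) x[of n] unfolding X_def by linarith
  then have "2 * S \<le> X / \<mu>u" using pos by (simp add: field_simps)
  then have "cE * (2 * S) \<le> cE * (X / \<mu>u)" using pos by (intro mult_left_mono) auto
  then have "2 * cE * S \<le> cE / \<mu>u * X" by simp
  with S(3) nT xX show ?thesis unfolding X_def by linarith
qed

text \<open>Stated for an arbitrary approximable \<open>q\<close>, so that the first step and the
  later extrapolated ones are instances of the same estimate.\<close>

lemma scheme_step:
  fixes U U' V V' q :: fn2
  assumes \<alpha>: "1 < \<alpha>" "\<alpha> \<le> 2" and ab: "a < b" "c < d"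
    and apx: "approximates \<alpha> a b c d us U" "approximates \<alpha> a b c d us' U'"
      "approximates \<alpha> a b c d vs V" "approximates \<alpha> a b c d vs' V'" "approximates \<alpha> a b c d qs q"
    and pos: "\<mu>u > 0" "\<mu>v > 0" "\<tau> > 0" "F > 0" "\<kappa> > 0"
    and eqU: "\<And>\<phi>. \<phi> \<in> Cc_inf (Omega a b c d) \<Longrightarrow> (\<integral>p. (U' p - U p) / \<tau> * \<phi> p \<partial>lebO a b c d)
       = - \<mu>u * form \<alpha> a b c d (\<lambda>p. (U p + U' p) / 2) \<phi>
       - (\<integral>p. (U p + U' p) / 2 * (q p)\<^sup>2 * \<phi> p \<partial>lebO a b c d) + (\<integral>p. F * (1 - (U p + U' p) / 2) * \<phi> p \<partial>lebO a b c d)"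
    and eqV: "\<And>\<phi>. \<phi> \<in> Cc_inf (Omega a b c d) \<Longrightarrow> (\<integral>p. (V' p - V p) / \<tau> * \<phi> p \<partial>lebO a b c d)
       = - \<mu>v * form \<alpha> a b c d (\<lambda>p. (V p + V' p) / 2) \<phi>
       + (\<integral>p. (U p + U' p) / 2 * (q p)\<^sup>2 * \<phi> p \<partial>lebO a b c d) - (\<integral>p. (F + \<kappa>) * ((V p + V' p) / 2) * \<phi> p \<partial>lebO a b c d)"
  shows "\<exists>E\<ge>0. (\<integral>p. (U' p)\<^sup>2 \<partial>lebO a b c d) \<le> (\<integral>p. (U p)\<^sup>2 \<partial>lebO a b c d) - 2 * \<tau> * \<mu>u * E
       + \<tau> * (F * measure lborel (Omega a b c d) / 2)
    \<and> (\<integral>p. (U' p + V' p)\<^sup>2 \<partial>lebO a b c d) \<le> (\<integral>p. (U p + V p)\<^sup>2 \<partial>lebO a b c d)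
       + 2 * \<tau> * ((\<mu>v - \<mu>u)\<^sup>2 / (4 * \<mu>v) * E) + \<tau> * (F * measure lborel (Omega a b c d) / 2)
       + \<tau> * (\<kappa> / 2) * (((\<integral>p. (U p)\<^sup>2 \<partial>lebO a b c d) + (\<integral>p. (U' p)\<^sup>2 \<partial>lebO a b c d)) / 2)"
proof -
  let ?M = "lebO a b c d"
  define u where "u p = (U p + U' p) / 2" for p
  define v where "v p = (V p + V' p) / 2" for p
  define du where "du p = (U' p - U p) / \<tau>" for p
  define dv where "dv p = (V' p - V p) / \<tau>" for p
  define A where "A = measure lborel (Omega a b c d)"
  have u: "approximates \<alpha> a b c d (\<lambda>k p. 1/2 * us k p + 1/2 * us' k p) u"
    using approximates_lincomb[OF \<alpha> ab apx(1,2), of "1/2" "1/2"] by (simp add: u_def[abs_def] add_divide_distrib)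
  have v: "approximates \<alpha> a b c d (\<lambda>k p. 1/2 * vs k p + 1/2 * vs' k p) v"
    using approximates_lincomb[OF \<alpha> ab apx(3,4), of "1/2" "1/2"] by (simp add: v_def[abs_def] add_divide_distrib)
  note sq = approximatesD(2)[OF apx(1)] approximatesD(2)[OF apx(2)] approximatesD(2)[OF apx(3)] approximatesD(2)[OF apx(4)]
  have su: "sqint ?M u" and sv: "sqint ?M v" by (rule approximatesD(2)[OF u], rule approximatesD(2)[OF v])
  have sdu: "sqint ?M du"
    using sqint_lincomb[OF sq(2,1), of "1 / \<tau>" "- 1 / \<tau>"] by (simp add: du_def[abs_def] diff_divide_distrib)
  have sdv: "sqint ?M dv"
    using sqint_lincomb[OF sq(4,3), of "1 / \<tau>" "- 1 / \<tau>"] by (simp add: dv_def[abs_def] diff_divide_distrib)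
  have sW: "sqint ?M (\<lambda>p. U p + V p)" "sqint ?M (\<lambda>p. U' p + V' p)"
    using sqint_lincomb[OF sq(1,3), of 1 1] sqint_lincomb[OF sq(2,4), of 1 1] by simp_all
  have sw: "sqint ?M (\<lambda>p. u p + v p)" using sqint_lincomb[OF su sv, of 1 1] by simp
  have s1u: "sqint ?M (\<lambda>p. F * (1 - u p))"
    using sqint_lincomb[OF sqint_const su, of 1 F "- F"] by (simp add: algebra_simps)
  have skv: "sqint ?M (\<lambda>p. (F + \<kappa>) * v p)"
    using sqint_lincomb[OF sv sv, of "F + \<kappa>" 0] by simp
  obtain E where E: "E \<ge> 0"
    "(\<integral>p. du p * u p \<partial>?M) \<le> - \<mu>u * E + (\<integral>p. F * (1 - u p) * u p \<partial>?M)"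
    "(\<integral>p. (du p + dv p) * (u p + v p) \<partial>?M) \<le> (\<mu>v - \<mu>u)\<^sup>2 / (4 * \<mu>v) * E
       + (\<integral>p. F * (1 - u p) * (u p + v p) \<partial>?M) - (\<integral>p. (F + \<kappa>) * v p * (u p + v p) \<partial>?M)"
    by (rule energy_step[OF \<alpha> ab u v apx(5) sdu sdv pos(1,2) eqU[folded u_def du_def] eqV[folded u_def v_def dv_def]],
        assumption, assumption, rule that)
  \<comment> \<open>The Crank--Nicolson midpoint turns the time difference into a difference of
    squares, without a remainder of order \<open>\<tau>\<close>.\<close>
  have telescope: "(\<integral>p. (g' p - g p) / \<tau> * ((g p + g' p) / 2) \<partial>?M) = ((\<integral>p. (g' p)\<^sup>2 \<partial>?M) - (\<integral>p. (g p)\<^sup>2 \<partial>?M)) / (2 * \<tau>)"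
    if "sqint ?M g" "sqint ?M g'" for g g' :: fn2
  proof -
    have "(\<lambda>p. (g' p - g p) / \<tau> * ((g p + g' p) / 2)) = (\<lambda>p. ((g' p)\<^sup>2 - (g p)\<^sup>2) / (2 * \<tau>))"
      using pos(3) by (simp add: fun_eq_iff field_simps power2_eq_square)
    then show ?thesis using that by (simp add: sqint_def)
  qed
  have const: "integrable ?M (\<lambda>p. r)" for r :: real by (rule integrable_lebO_bounded[of _ "\<bar>r\<bar>"]) auto
  \<comment> \<open>Completing the square gives half of the source term that the claim
    allows.\<close>
  have quarter: "F * (1 - t) * t \<le> F / 4" for t
  proof -
    have "F * (t - 1/2)\<^sup>2 \<ge> 0" using pos by simp
    then show ?thesis by (simp add: power2_eq_square algebra_simps)
  qed
  have F4: "(\<integral>p. F / 4 \<partial>?M) = F * A / 4" unfolding integral_lebO_const A_def by simp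
  have "(\<integral>p. F * (1 - u p) * u p \<partial>?M) \<le> (\<integral>p. F / 4 \<partial>?M)"
    by (intro integral_mono sqint_mult[OF s1u su] const quarter)
  also note F4
  finally have "(\<integral>p. du p * u p \<partial>?M) \<le> - \<mu>u * E + F * A / 4" using E(2) by linarith
  then have "((\<integral>p. (U' p)\<^sup>2 \<partial>?M) - (\<integral>p. (U p)\<^sup>2 \<partial>?M)) / (2 * \<tau>) \<le> - \<mu>u * E + F * A / 4"
    unfolding du_def u_def telescope[OF sq(1,2)] .
  then have 1: "(\<integral>p. (U' p)\<^sup>2 \<partial>?M) \<le> (\<integral>p. (U p)\<^sup>2 \<partial>?M) - 2 * \<tau> * \<mu>u * E + \<tau> * (F * A / 2)"
    using pos(3) by (simp add: field_simps)
  \<comment> \<open>With \<open>w = s + t\<close> the left side is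
    \<open>F * (w - w\<^sup>2) - \<kappa> * t * w\<close>; the two squares below complete
    \<open>w\<close> around \<open>1/2\<close> and \<open>t\<close> around \<open>- s / 2\<close>,
    leaving only a term in \<open>s\<close>, the midpoint of \<open>U\<close>.\<close>
  have pt: "F * (1 - s) * (s + t) - (F + \<kappa>) * t * (s + t) \<le> F / 4 + \<kappa> / 4 * s\<^sup>2" for s t
  proof -
    have "F * (s + t - 1/2)\<^sup>2 \<ge> 0" "\<kappa> * (t + s / 2)\<^sup>2 \<ge> 0" using pos by simp_all
    moreover have "F / 4 + \<kappa> / 4 * s\<^sup>2 - (F * (1 - s) * (s + t) - (F + \<kappa>) * t * (s + t))
      = F * (s + t - 1/2)\<^sup>2 + \<kappa> * (t + s / 2)\<^sup>2"
      by (simp add: power2_eq_square field_simps)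
    ultimately show ?thesis by linarith
  qed
  have "(\<integral>p. F * (1 - u p) * (u p + v p) \<partial>?M) - (\<integral>p. (F + \<kappa>) * v p * (u p + v p) \<partial>?M)
    = (\<integral>p. F * (1 - u p) * (u p + v p) - (F + \<kappa>) * v p * (u p + v p) \<partial>?M)"
    by (rule Bochner_Integration.integral_diff[symmetric, OF sqint_mult[OF s1u sw] sqint_mult[OF skv sw]])
  also have "\<dots> \<le> (\<integral>p. F / 4 + \<kappa> / 4 * (u p)\<^sup>2 \<partial>?M)"
    by (intro integral_mono Bochner_Integration.integrable_diff Bochner_Integration.integrable_add integrable_mult_right
        sqint_mult[OF s1u sw] sqint_mult[OF skv sw] const sqint_integrable[OF su] pt)
  also have "\<dots> = F * A / 4 + \<kappa> / 4 * (\<integral>p. (u p)\<^sup>2 \<partial>?M)"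
    using const[of "F / 4"] sqint_integrable[OF su] F4 by simp
  \<comment> \<open>Convexity of the square passes from the midpoint to the two iterates, for which
    the first estimate is available.\<close>
  also have "(\<integral>p. (u p)\<^sup>2 \<partial>?M) \<le> ((\<integral>p. (U p)\<^sup>2 \<partial>?M) + (\<integral>p. (U' p)\<^sup>2 \<partial>?M)) / 2"
    using integral_square_sum_le[OF sq(1,2), of "1/2" "1/2"] by (simp add: u_def[abs_def] add_divide_distrib power2_eq_square)
  finally have rhs: "(\<integral>p. F * (1 - u p) * (u p + v p) \<partial>?M) - (\<integral>p. (F + \<kappa>) * v p * (u p + v p) \<partial>?M)
    \<le> F * A / 4 + \<kappa> / 4 * (((\<integral>p. (U p)\<^sup>2 \<partial>?M) + (\<integral>p. (U' p)\<^sup>2 \<partial>?M)) / 2)"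
    using pos by simp
  have "(\<lambda>p. (du p + dv p) * (u p + v p)) = (\<lambda>p. ((U' p + V' p) - (U p + V p)) / \<tau> * (((U p + V p) + (U' p + V' p)) / 2))"
    by (simp add: fun_eq_iff du_def dv_def u_def v_def add_divide_distrib[symmetric] algebra_simps)
  then have "((\<integral>p. (U' p + V' p)\<^sup>2 \<partial>?M) - (\<integral>p. (U p + V p)\<^sup>2 \<partial>?M)) / (2 * \<tau>)
    \<le> (\<mu>v - \<mu>u)\<^sup>2 / (4 * \<mu>v) * E + (F * A / 4 + \<kappa> / 4 * (((\<integral>p. (U p)\<^sup>2 \<partial>?M) + (\<integral>p. (U' p)\<^sup>2 \<partial>?M)) / 2))"
    using E(3) rhs telescope[OF sW] by simp
  then have "(\<integral>p. (U' p + V' p)\<^sup>2 \<partial>?M) - (\<integral>p. (U p + V p)\<^sup>2 \<partial>?M)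
    \<le> ((\<mu>v - \<mu>u)\<^sup>2 / (4 * \<mu>v) * E + (F * A / 4 + \<kappa> / 4 * (((\<integral>p. (U p)\<^sup>2 \<partial>?M) + (\<integral>p. (U' p)\<^sup>2 \<partial>?M)) / 2))) * (2 * \<tau>)"
    using pos(3) by (simp add: pos_divide_le_eq)
  then have 2: "(\<integral>p. (U' p + V' p)\<^sup>2 \<partial>?M) \<le> (\<integral>p. (U p + V p)\<^sup>2 \<partial>?M)
       + 2 * \<tau> * ((\<mu>v - \<mu>u)\<^sup>2 / (4 * \<mu>v) * E) + \<tau> * (F * A / 2)
       + \<tau> * (\<kappa> / 2) * (((\<integral>p. (U p)\<^sup>2 \<partial>?M) + (\<integral>p. (U' p)\<^sup>2 \<partial>?M)) / 2)"
    by (simp add: algebra_simps)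
  from E(1) 1 2 show ?thesis unfolding A_def by blast
qed

theorem theorem4p1:
  fixes a b c d \<alpha> T \<mu>u \<mu>v F \<kappa> :: real and M :: nat
    and u0 v0 :: fn2 and U V :: "nat \<Rightarrow> fn2"
  assumes "a < b" and "c < d"
    and "1 < \<alpha>" and "\<alpha> \<le> 2"
    and "T > 0" and "M \<ge> 1"
    and "\<mu>u > 0" and "\<mu>v > 0" and "F > 0" and "\<kappa> > 0"
    and "H0 \<alpha> (Omega a b c d) u0" and "H0 \<alpha> (Omega a b c d) v0"
    and "\<forall>n\<le>M. H0 \<alpha> (Omega a b c d) (U n) \<and> H0 \<alpha> (Omega a b c d) (V n)"
    and "U 0 = u0" and "V 0 = v0"
    and scheme: "\<forall>n<M. \<forall>\<phi>\<in>Cc_inf (Omega a b c d).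
      (let \<tau> = T / real M;
           Uh = (\<lambda>p. (U n p + U (Suc n) p) / 2);
           Vh = (\<lambda>p. (V n p + V (Suc n) p) / 2);
           Vt = (if n = 0 then V 0 else (\<lambda>p. (3 * V n p - V (n - 1) p) / 2));
           \<Omega> = Omega a b c d
       in (LINT p:\<Omega>|lborel. (U (Suc n) p - U n p) / \<tau> * \<phi> p) =
            - \<mu>u * (LINT p:\<Omega>|lborel. Uh p * frac_lap \<alpha> a b c d \<phi> p)
            - (LINT p:\<Omega>|lborel. Uh p * (Vt p)\<^sup>2 * \<phi> p)
            + (LINT p:\<Omega>|lborel. F * (1 - Uh p) * \<phi> p)
        \<and> (LINT p:\<Omega>|lborel. (V (Suc n) p - V n p) / \<tau> * \<phi> p) =
            - \<mu>v * (LINT p:\<Omega>|lborel. Vh p * frac_lap \<alpha> a b c d \<phi> p)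
            + (LINT p:\<Omega>|lborel. Uh p * (Vt p)\<^sup>2 * \<phi> p)
            - (LINT p:\<Omega>|lborel. (F + \<kappa>) * Vh p * \<phi> p))"
  shows "\<forall>n<M.
      (L2norm (Omega a b c d) (U (Suc n)))\<^sup>2
        \<le> (L2norm (Omega a b c d) u0)\<^sup>2 + F * T * measure lborel (Omega a b c d)
    \<and> (L2norm (Omega a b c d) (\<lambda>p. U (Suc n) p + V (Suc n) p))\<^sup>2
        \<le> (L2norm (Omega a b c d) (\<lambda>p. u0 p + v0 p))\<^sup>2
          + (\<kappa> * T + (\<mu>v - \<mu>u)\<^sup>2 / (2 * \<mu>u * \<mu>v * (cos (pi * \<alpha> / 2))\<^sup>2))
              * (L2norm (Omega a b c d) u0)\<^sup>2
          + (1 + \<kappa> * T + (\<mu>v - \<mu>u)\<^sup>2 / (2 * \<mu>u * \<mu>v * (cos (pi * \<alpha> / 2))\<^sup>2))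
              * F * T * measure lborel (Omega a b c d)"
proof -
  let ?M = "lebO a b c d"
  define \<tau> where "\<tau> = T / real M"
  define A where "A = measure lborel (Omega a b c d)"
  define x where "x n = (\<integral>p. (U n p)\<^sup>2 \<partial>?M)" for n
  define y where "y n = (\<integral>p. (U n p + V n p)\<^sup>2 \<partial>?M)" for n
  \<comment> \<open>The coefficient of \<open>E\<close> that Young's inequality produces in the
    estimate for the sum.\<close>
  define c2 where "c2 = (\<mu>v - \<mu>u)\<^sup>2 / (4 * \<mu>v)"
  note \<alpha> = assms(3,4) and ab = assms(1,2)
  have \<tau>: "\<tau> > 0" and MT: "real M * \<tau> = T" using assms(5,6) by (auto simp: \<tau>_def)
  have A: "A \<ge> 0" by (simp add: A_def)
  have apx: "\<exists>us. approximates \<alpha> a b c d us (U k)" "\<exists>vs. approximates \<alpha> a b c d vs (V k)" if "k \<le> M" for k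
    using H0_approximates[OF \<alpha> ab] assms(13) that by blast+
  have step: "\<exists>E\<ge>0. x (Suc k) \<le> x k - 2 * \<tau> * \<mu>u * E + \<tau> * (F * A / 2)
      \<and> y (Suc k) \<le> y k + 2 * \<tau> * (c2 * E) + \<tau> * (F * A / 2) + \<tau> * (\<kappa> / 2) * ((x k + x (Suc k)) / 2)"
    if k: "k < M" for k
  proof -
    define q where "q = (if k = 0 then V 0 else (\<lambda>p. (3 * V k p - V (k - 1) p) / 2))"
    \<comment> \<open>For \<open>k = 0\<close> truncated subtraction makes \<open>k - 1\<close>
      equal to 0, still an admissible index; the extrapolation is formed only for
      \<open>k > 0\<close>.\<close>
    obtain us us' vs vs' ws where h: "approximates \<alpha> a b c d us (U k)" "approximates \<alpha> a b c d us' (U (Suc k))"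
      "approximates \<alpha> a b c d vs (V k)" "approximates \<alpha> a b c d vs' (V (Suc k))" "approximates \<alpha> a b c d ws (V (k - 1))"
      using apx[of k] apx[of "Suc k"] apx(2)[of "k - 1"] k by (metis Suc_leI diff_le_self less_imp_le order_trans)
    have "\<exists>qs. approximates \<alpha> a b c d qs q"
    proof (cases "k = 0")
      case True
      with h(3) show ?thesis by (auto simp: q_def)
    next
      case False
      have "(\<lambda>p. 3/2 * V k p + (-1/2) * V (k - 1) p) = q" using False by (simp add: q_def fun_eq_iff field_simps)
      with approximates_lincomb[OF \<alpha> ab h(3,5), of "3/2" "-1/2"] show ?thesis by auto
    qed
    then obtain qs where q: "approximates \<alpha> a b c d qs q" by blast
    note eq = scheme[rule_format, OF k, unfolded Let_def set_integral_eq_lebO, folded \<tau>_def q_def form_def]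
    show ?thesis
      unfolding x_def y_def c2_def A_def
      by (rule scheme_step[OF \<alpha> ab h(1-4) q assms(7,8) \<tau> assms(9,10)]) (use eq in blast)+
  qed
  have x0: "x k \<ge> 0" for k by (simp add: x_def)
  have c2: "c2 \<ge> 0" using assms(8) by (simp add: c2_def)
  define G where "G = (\<mu>v - \<mu>u)\<^sup>2 / (2 * \<mu>u * \<mu>v * (cos (pi * \<alpha> / 2))\<^sup>2)"
  have "cos (pi * \<alpha> / 2) < 0"
    using \<alpha> by (intro cos_lt_zero_pi) (auto simp: field_simps)
  then have "(cos (pi * \<alpha> / 2))\<^sup>2 > 0" by simp
  \<comment> \<open>Hence twice the squared cosine is below 4, and the denominator of the claimed
    quotient is at most that of \<open>c2 / \<mu>u\<close>. Strict positivity of the square rules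
    out division by 0.\<close>
  moreover have "(cos (pi * \<alpha> / 2))\<^sup>2 \<le> 1" by (simp add: abs_square_le_1)
  ultimately have "2 * \<mu>u * \<mu>v * (cos (pi * \<alpha> / 2))\<^sup>2 \<le> 4 * \<mu>v * \<mu>u" "2 * \<mu>u * \<mu>v * (cos (pi * \<alpha> / 2))\<^sup>2 > 0"
    using assms(7,8) by (simp_all add: mult_le_cancel_left1)
  then have cG: "c2 / \<mu>u \<le> G" unfolding c2_def G_def by (simp add: frac_le)
  have G0: "G \<ge> 0" using cG c2 assms(7) by (meson divide_nonneg_pos order_trans)
  define P where "P = F * T * A"
  have P: "P \<ge> 0" "T * (F * A / 2) = P / 2" using A assms(5,9) by (simp_all add: P_def)
  \<comment> \<open>The proof yields \<open>P / 2\<close> and \<open>T * (\<kappa> / 2)\<close>;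
    rounding them up to \<open>P\<close> and \<open>\<kappa> * T\<close> gives the claimed
    form.\<close>
  have X: "0 \<le> x 0 + P / 2" "x 0 + P / 2 \<le> x 0 + P" using P x0[of 0] by simp_all
  have K: "0 \<le> \<kappa> * T" "T * (\<kappa> / 2) \<le> \<kappa> * T" using assms(5,10) by simp_all
  have le1: "T * (\<kappa> / 2) * (x 0 + P / 2) \<le> \<kappa> * T * (x 0 + P)"
    by (rule mult_mono[OF K(2) X(2) K(1) X(1)])
  have le2: "c2 / \<mu>u * (x 0 + P / 2) \<le> G * (x 0 + P)"
    using X cG G0 by (intro mult_mono) auto
  have "x (Suc n) \<le> x 0 + P \<and> y (Suc n) \<le> y 0 + (\<kappa> * T + G) * x 0 + (1 + \<kappa> * T + G) * P" if n: "n < M" for n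
  proof -
    have "x (Suc n) \<le> x 0 + T * (F * A / 2) \<and> y (Suc n) \<le> y 0 + c2 / \<mu>u * (x 0 + T * (F * A / 2))
        + T * (F * A / 2) + T * (\<kappa> / 2) * (x 0 + T * (F * A / 2))"
    proof (rule time_induction[where x = x and y = y and M = M and \<tau> = \<tau> and \<mu>u = \<mu>u and \<kappa> = \<kappa> and cE = c2])
      fix k assume "k < M"
      then show "\<exists>E\<ge>0. x (Suc k) \<le> x k - 2 * \<tau> * \<mu>u * E + \<tau> * (F * A / 2)
        \<and> y (Suc k) \<le> y k + 2 * \<tau> * (c2 * E) + \<tau> * (F * A / 2) + \<tau> * (\<kappa> / 2) * ((x k + x (Suc k)) / 2)"
        by (rule step)
    qed (use \<tau> c2 x0 MT n assms(7,9,10) A in auto)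
    then have bounds: "x (Suc n) \<le> x 0 + T * (F * A / 2)"
      "y (Suc n) \<le> y 0 + c2 / \<mu>u * (x 0 + T * (F * A / 2)) + T * (F * A / 2) + T * (\<kappa> / 2) * (x 0 + T * (F * A / 2))"
      by blast+
    have "y (Suc n) \<le> y 0 + (\<kappa> * T + G) * x 0 + (1 + \<kappa> * T + G) * P"
      using bounds(2) P le1 le2 unfolding P(2) by (simp add: algebra_simps)
    with bounds(1) P show ?thesis by simp
  qed
  then show ?thesis
    unfolding L2norm_square x_def y_def P_def A_def G_def assms(14,15) mult.assoc by blast
qed

end
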